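(* Let $b,\phi\in C_c^\infty(\mathbb{R}^n)$ be complex-valued and $h$-independent, with $\mathrm{Im}\,\phi\ge0$ on $\mathbb{R}^n$. Then: (1) $\mathrm{WF}_h\bigl(b(x)e^{\frac{i}{h}\phi(x)}\bigr)\subseteq\{(x,\partial\phi(x)) \mid x\in\mathrm{supp}\,b,\ \mathrm{Im}\,\phi(x)=0\}$. (2) $\overline{\{(x,\partial\phi(x)) \mid b(x)\ne0,\ \mathrm{Im}\,\phi(x)=0\}}\subseteq\mathrm{WF}_h\bigl(b(x)e^{\frac{i}{h}\phi(x)}\bigr)$.
   Context: Here $h\in(0,h_0)$ is a small semiclassical parameter, with $h_0>0$ fixed, and $T^*\mathbb{R}^n=\mathbb{R}^n_x\times\mathbb{R}^n_\xi$. $\partial\phi$ is the gradient of $\phi$; it is real at points where $\mathrm{Im}\,\phi=0$, because $\mathrm{Im}\,\phi\ge0$ everywhere, so both sets are subsets of $T^*\mathbb{R}^n$. The overline denotes closure in $T^*\mathbb{R}^n$. $\mathcal{O}(h^\infty)$ means $\mathcal{O}(h^N)$ as $h\to0$ for every $N$. $S$ is the set of families $a(x,\xi;h)$, $0<h<h_0$, of complex-valued functions with $a(\cdot,\cdot;h)\in C^\infty(T^*\mathbb{R}^n)$ such that every derivative $\partial_x^\alpha\partial_\xi^\beta a$ is bounded uniformly in $(x,\xi)$ and $h$. For $a\in S$ and $t\in[0,1]$, \[Op_{t,h}(a)u(x)=(2\pi h)^{-n}\iint a(tx+(1-t)y,\xi;h)e^{i\langle x-y,\xi\rangle/h}u(y)\,dy\,d\xi\]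 (an oscillatory integral for $u\in\mathscr{S}(\mathbb{R}^n)$, extending to bounded operators on $L^2(\mathbb{R}^n)$ with norm bounded uniformly in $h$). For a family $u=\{u(h)\}_{0<h<h_0}\subseteq L^2(\mathbb{R}^n)$ with $\|u(h)\|_{L^2}\le C$, $(x_0,\xi_0)\notin\mathrm{WF}_h(u)\subseteq T^*\mathbb{R}^n$ if and only if there is $c\in S$ with $\inf_h|c(x_0,\xi_0;h)|>0$ and $\|Op_{t,h}(c)u(h)\|_{L^2}=\mathcal{O}(h^\infty)$ (this does not depend on $t\in[0,1]$). *)

theory Defs
  imports "HOL-Analysis.Analysis" "HOL-Library.Landau_Symbols"
begin

subsection \<open>Smooth functions\<close>

text \<open>
  \<open>iter_deriv [v1, \<dots>, vk] f\<close> is the iterated directional derivative \<open>\<partial>\<^sub>v\<^sub>1 \<dots> \<partial>\<^sub>v\<^sub>k f\<close>. With all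
  directions in \<^const>\<open>Basis\<close> these are the partial derivatives; lists of basis vectors
  play the role of multi-indices.
\<close>

primrec iter_deriv :: "'a list \<Rightarrow> ('a::euclidean_space \<Rightarrow> complex) \<Rightarrow> 'a \<Rightarrow> complex" where
  "iter_deriv [] f = f"
| "iter_deriv (v # vs) f = (\<lambda>x. frechet_derivative (iter_deriv vs f) (at x) v)"

text \<open>
  Differentiability of all iterated partial derivatives makes each of them continuous, so
  this is \<open>C\<^sup>\<infinity>\<close>. Derivatives are only taken of functions already required to be
  differentiable, so the arbitrary value of \<^const>\<open>frechet_derivative\<close> elsewhere plays no role.
\<close>

definition smooth :: "('a::euclidean_space \<Rightarrow> complex) \<Rightarrow> bool" where
  "smooth f \<longleftrightarrow> (\<forall>vs. set vs \<subseteq> Basis \<longrightarrow> (\<forall>x. iter_deriv vs f differentiable (at x)))"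

definition supp :: "('a::euclidean_space \<Rightarrow> complex) \<Rightarrow> 'a set" where
  "supp f = closure {x. f x \<noteq> 0}"

definition test_function :: "('a::euclidean_space \<Rightarrow> complex) \<Rightarrow> bool" where
  "test_function f \<longleftrightarrow> smooth f \<and> compact (supp f)"

definition schwartz :: "('a::euclidean_space \<Rightarrow> complex) \<Rightarrow> bool" where
  "schwartz f \<longleftrightarrow> smooth f \<and>
     (\<forall>(k::nat) vs. set vs \<subseteq> Basis \<longrightarrow> (\<exists>C. \<forall>x. norm x ^ k * cmod (iter_deriv vs f x) \<le> C))"

definition grad :: "(real ^ 'n \<Rightarrow> complex) \<Rightarrow> real ^ 'n \<Rightarrow> complex ^ 'n" where
  "grad f x = (\<chi> i. frechet_derivative f (at x) (axis i 1))"

definition complex_vec :: "real ^ 'n \<Rightarrow> complex ^ 'n" where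
  "complex_vec \<xi> = (\<chi> i. complex_of_real (\<xi> $ i))"


subsection \<open>Square-integrable functions\<close>

definition L2 :: "('a::euclidean_space \<Rightarrow> complex) \<Rightarrow> bool" where
  "L2 u \<longleftrightarrow> u \<in> borel_measurable lborel \<and> integrable lborel (\<lambda>x. (cmod (u x))\<^sup>2)"

definition L2_norm :: "('a::euclidean_space \<Rightarrow> complex) \<Rightarrow> real" where
  "L2_norm u = sqrt (LINT x|lborel. (cmod (u x))\<^sup>2)"

text \<open>
  Bounded operators on \<open>L\<^sup>2\<close>, acting on representatives: linearity holds almost everywhere,
  and together with boundedness it implies that almost everywhere equal arguments have almost
  everywhere equal images. Values outside \<^const>\<open>L2\<close> are irrelevant.
\<close>

definition L2_bounded_operator ::
    "(('a::euclidean_space \<Rightarrow> complex) \<Rightarrow> ('a \<Rightarrow> complex)) \<Rightarrow> bool" where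
  "L2_bounded_operator T \<longleftrightarrow>
     (\<forall>u. L2 u \<longrightarrow> L2 (T u)) \<and>
     (\<forall>u v \<alpha> \<beta>. L2 u \<longrightarrow> L2 v \<longrightarrow>
        (AE x in lborel. T (\<lambda>x. \<alpha> * u x + \<beta> * v x) x = \<alpha> * T u x + \<beta> * T v x)) \<and>
     (\<exists>C. \<forall>u. L2 u \<longrightarrow> L2_norm (T u) \<le> C * L2_norm u)"


subsection \<open>Symbols and their quantization\<close>

text \<open>
  Phase space \<open>T\<^sup>*\<real>\<^sup>n\<close> is \<^typ>\<open>(real ^ 'n) \<times> (real ^ 'n)\<close>; its \<^const>\<open>Basis\<close> consists of the
  coordinate directions in \<open>x\<close> and those in \<open>\<xi>\<close>. A family is a function of \<open>h\<close> first, and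
  only its values at \<open>0 < h < h0\<close> matter.
\<close>

definition symbol_class ::
    "real \<Rightarrow> (real \<Rightarrow> (real ^ 'n) \<times> (real ^ 'n) \<Rightarrow> complex) set" where
  "symbol_class h0 = {a.
     (\<forall>h\<in>{0<..<h0}. smooth (a h)) \<and>
     (\<forall>vs. set vs \<subseteq> Basis \<longrightarrow>
        (\<exists>C. \<forall>h\<in>{0<..<h0}. \<forall>z. cmod (iter_deriv vs (a h) z) \<le> C))}"

text \<open>
  For Schwartz functions \<open>u\<close> the oscillatory integral is the iterated integral with \<open>y\<close>
  innermost: the inner integral converges absolutely and, by integration by parts in \<open>y\<close>,
  decays faster than any power of \<open>\<xi>\<close>, so the outer one converges absolutely as well.
\<close>

definition Op_schwartz ::
    "real \<Rightarrow> real \<Rightarrow> ((real ^ 'n) \<times> (real ^ 'n) \<Rightarrow> complex) \<Rightarrow>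
     (real ^ 'n \<Rightarrow> complex) \<Rightarrow> real ^ 'n \<Rightarrow> complex" where
  "Op_schwartz t h a u x =
     complex_of_real (1 / (2 * pi * h) ^ CARD('n)) *
     (LINT \<xi>|lborel. LINT y|lborel.
        a (t *\<^sub>R x + (1 - t) *\<^sub>R y, \<xi>) * exp (\<i> * complex_of_real (inner (x - y) \<xi> / h)) * u y)"

text \<open>
  \<open>T\<close> is the extension of the quantization to a bounded operator on \<open>L\<^sup>2\<close>. For \<open>0 < h\<close>,
  \<open>t \<in> [0,1]\<close> and a symbol \<open>a\<close> it exists (Calderon-Vaillancourt) and, by density of the
  Schwartz functions, it is unique up to equality almost everywhere.
\<close>

definition is_Op ::
    "real \<Rightarrow> real \<Rightarrow> ((real ^ 'n) \<times> (real ^ 'n) \<Rightarrow> complex) \<Rightarrow>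
     ((real ^ 'n \<Rightarrow> complex) \<Rightarrow> (real ^ 'n \<Rightarrow> complex)) \<Rightarrow> bool" where
  "is_Op t h a T \<longleftrightarrow> L2_bounded_operator T \<and>
     (\<forall>u. schwartz u \<longrightarrow> (AE x in lborel. T u x = Op_schwartz t h a u x))"


subsection \<open>Semiclassical wavefront set\<close>

text \<open>
  Meant for families \<open>u\<close> that are bounded in \<open>L\<^sup>2\<close> uniformly in \<open>0 < h < h0\<close>. The set does
  not depend on \<open>t \<in> [0,1]\<close>.
\<close>

definition WF ::
    "real \<Rightarrow> real \<Rightarrow> (real \<Rightarrow> real ^ 'n \<Rightarrow> complex) \<Rightarrow> ((real ^ 'n) \<times> (real ^ 'n)) set" where
  "WF h0 t u = {p. \<not> (\<exists>c \<in> symbol_class h0.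
      (INF h\<in>{0<..<h0}. cmod (c h p)) > 0 \<and>
      (\<exists>T. (\<forall>h\<in>{0<..<h0}. is_Op t h (c h) (T h)) \<and>
           (\<forall>N::nat. (\<lambda>h. L2_norm (T h (u h))) \<in> O[at_right 0](\<lambda>h. h ^ N))))}"

end

theory Submission
  imports Defs "HOL-Probability.Characteristic_Functions" "HOL-Probability.Sinc_Integral"
begin

text \<open>
  Inclusion (1). At a point \<open>(x0, \<xi>0)\<close> off the graph take \<open>c(x, \<xi>) = \<alpha>(x) \<beta>(\<xi>)\<close> with narrow
  box cutoffs. Its quantization is an explicit integral operator with kernel
  \<open>\<alpha>(t x + (1 - t) y) (2\<pi>h)\<^sup>-\<^sup>n k((x - y) / h)\<close>, where \<open>k\<close> is the rapidly decreasing Fourier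
  transform of \<open>\<beta>\<close>, so Schur's test replaces Calderon-Vaillancourt. If \<open>y\<close> is away from \<open>x0\<close>,
  then \<open>\<alpha>\<close> forces \<open>x\<close> and \<open>y\<close> apart and the kernel is \<open>O(h\<^sup>\<infinity>)\<close>; if \<open>y\<close> is near \<open>x0\<close>, either \<open>u\<close>
  itself is \<open>O(h\<^sup>\<infinity>)\<close> or the phase \<open>\<phi>(y) - y \<bullet> \<xi>\<close> is non-stationary in one coordinate. This
  bounds \<open>Op(c)u\<close> uniformly by every power of \<open>h\<close>; multiplied with a trivial integrable bound
  of size \<open>h\<^sup>-\<^sup>n\<close> it gives the \<open>L\<^sup>2\<close> estimate.

  Inclusion (2). Ellipticity of \<open>c\<close> at a point of the closure persists at a nearby point
  \<open>(x0, \<xi>0)\<close> with \<open>b(x0) \<noteq> 0\<close>, \<open>Im \<phi>(x0) = 0\<close> and \<open>\<xi>0 = \<partial>\<phi>(x0)\<close>. Put \<open>h = \<kappa>\<^sup>3\<close> and rescale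
  \<open>x = x0 + \<kappa>\<^sup>2 x'\<close>, \<open>\<xi> = \<xi>0 + \<kappa> \<eta>\<close>. The symbol tends to the constant \<open>c(x0, \<xi>0; h)\<close>, and two
  integrations by parts (in \<open>y\<close> for decay in \<open>\<eta>\<close>, then in \<open>\<eta>\<close> for decay in \<open>x - y\<close>) make the
  remainder \<open>O(\<kappa>)\<close> for \<open>\<bar>x'\<bar> \<le> 1\<close>, while a constant symbol acts as a multiplication by Fourier
  inversion. So \<open>\<bar>Op(c)u\<bar>\<close> is bounded below on a ball of radius \<open>\<kappa>\<^sup>2\<close>, and its \<open>L\<^sup>2\<close> norm is at
  least a constant times \<open>\<kappa>\<^sup>n\<close>.
\<close>

subsection \<open>Families with uniformly bounded derivatives\<close>

text \<open>The two scales in (2) multiply to \<open>h\<close>, so the rescaled oscillation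
  \<open>(x - y) \<bullet> \<eta>\<close> contains no parameter any more. Both tend to 0, which
  freezes the symbol, and the Taylor remainder of the phase, divided by \<open>h\<close>, has size
  \<open>\<kappa> ^ 4 / \<kappa> ^ 3 = \<kappa>\<close> for bounded \<open>x'\<close>, so the
  amplitude stays away from 0. Taking \<kappa> as the parameter avoids fractional powers of
  \<open>h\<close>.

  The obstacle in (2) is that a general symbol and its derivatives are merely bounded: the iterated
  integral need not converge absolutely as a double integral, while the support of the rescaled
  amplitude may have a radius of order \<open>1 / \<kappa>\<^sup>2\<close>. Estimates must therefore
  be uniform over a family and keep track of the growth in \<open>y\<close>; this is the purpose of
  the weights in \<open>symb\<close>.

  The definition of \<open>WF\<close> prescribes the operator only on Schwartz functions. Each
  member of the oscillating family is smooth with compact support, so in (2) the abstract operator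
  can be replaced by the explicit integral almost everywhere.\<close>

definition dd :: "'a \<Rightarrow> ('a::euclidean_space \<Rightarrow> complex) \<Rightarrow> 'a \<Rightarrow> complex" where
  "dd v f = (\<lambda>x. frechet_derivative f (at x) v)"

lemma dd_eqI: "(f has_derivative f') (at x) \<Longrightarrow> dd v f x = f' v"
  unfolding dd_def by (drule frechet_derivative_at) simp

lemma dd_works: "f differentiable (at x) \<Longrightarrow> (f has_derivative (\<lambda>v. dd v f x)) (at x)"
  unfolding dd_def by (simp add: frechet_derivative_works)

lemma differentiableI_der: "(f has_derivative f') (at x) \<Longrightarrow> f differentiable (at x)"
  by (auto simp: differentiable_def)

lemma dd_linear: "f differentiable (at x) \<Longrightarrow> linear (\<lambda>v. dd v f x)"
  using linear_frechet_derivative unfolding dd_def by auto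

lemma dd_expand:
  assumes "f differentiable (at x)"
  shows "dd v f x = (\<Sum>e\<in>Basis. complex_of_real (v \<bullet> e) * dd e f x)"
proof -
  interpret linear "\<lambda>v. dd v f x" by (rule dd_linear[OF assms])
  have "dd v f x = dd (\<Sum>e\<in>Basis. (v \<bullet> e) *\<^sub>R e) f x" by (simp add: euclidean_representation)
  also have "\<dots> = (\<Sum>e\<in>Basis. complex_of_real (v \<bullet> e) * dd e f x)"
    by (simp add: sum scale scaleR_conv_of_real)
  finally show ?thesis .
qed

lemma dd_const [simp]: "dd v (\<lambda>x. c) = (\<lambda>x. 0)"
  by (simp add: dd_def)

definition bdd_by :: "'i set \<Rightarrow> ('i \<Rightarrow> 'a \<Rightarrow> real) \<Rightarrow> ('i \<Rightarrow> 'a \<Rightarrow> complex) \<Rightarrow> bool" where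
  "bdd_by I m f \<longleftrightarrow> (\<exists>C\<ge>0. \<forall>i\<in>I. \<forall>z. cmod (f i z) \<le> C * m i z)"

lemma bdd_byI: "C \<ge> 0 \<Longrightarrow> (\<And>i z. i \<in> I \<Longrightarrow> cmod (f i z) \<le> C * m i z) \<Longrightarrow> bdd_by I m f"
  unfolding bdd_by_def by blast

lemma bdd_byE:
  assumes "bdd_by I m f"
  obtains C where "C \<ge> 0" "\<And>i z. i \<in> I \<Longrightarrow> cmod (f i z) \<le> C * m i z"
  using assms unfolding bdd_by_def by blast

lemma bdd_by_mono:
  assumes "bdd_by I m f" "C \<ge> 0" "\<And>i z. i \<in> I \<Longrightarrow> m i z \<le> C * m' i z"
  shows "bdd_by I m' f"
proof -
  obtain D where D: "D \<ge> 0" "\<And>i z. i \<in> I \<Longrightarrow> cmod (f i z) \<le> D * m i z" by (rule bdd_byE[OF assms(1)]) (rule that)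
  show ?thesis
  proof (rule bdd_byI[of "D * C"])
    fix i z assume i: "i \<in> I"
    have "D * m i z \<le> D * (C * m' i z)" by (intro mult_left_mono assms(3)[OF i] D(1))
    then show "cmod (f i z) \<le> D * C * m' i z" using D(2)[OF i, of z] by (simp add: mult_ac)
  qed (use D assms in simp)
qed

lemma bdd_by_add:
  assumes "bdd_by I m f" "bdd_by I m g"
  shows "bdd_by I m (\<lambda>i z. f i z + g i z)"
proof -
  obtain C where C: "C \<ge> 0" "\<And>i z. i \<in> I \<Longrightarrow> cmod (f i z) \<le> C * m i z" by (rule bdd_byE[OF assms(1)]) (rule that)
  obtain D where D: "D \<ge> 0" "\<And>i z. i \<in> I \<Longrightarrow> cmod (g i z) \<le> D * m i z" by (rule bdd_byE[OF assms(2)]) (rule that)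
  show ?thesis
  proof (rule bdd_byI[of "C + D"])
    fix i z assume i: "i \<in> I"
    show "cmod (f i z + g i z) \<le> (C + D) * m i z"
      using C(2)[OF i, of z] D(2)[OF i, of z] norm_triangle_ineq[of "f i z" "g i z"]
      by (simp add: distrib_right)
  qed (use C D in simp)
qed

lemma bdd_by_mult:
  assumes "bdd_by I m f" "bdd_by I n g" "\<And>i z. i \<in> I \<Longrightarrow> 0 \<le> m i z"
  shows "bdd_by I (\<lambda>i z. m i z * n i z) (\<lambda>i z. f i z * g i z)"
proof -
  obtain C where C: "C \<ge> 0" "\<And>i z. i \<in> I \<Longrightarrow> cmod (f i z) \<le> C * m i z" by (rule bdd_byE[OF assms(1)]) (rule that)
  obtain D where D: "D \<ge> 0" "\<And>i z. i \<in> I \<Longrightarrow> cmod (g i z) \<le> D * n i z" by (rule bdd_byE[OF assms(2)]) (rule that)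
  show ?thesis
  proof (rule bdd_byI[of "C * D"])
    fix i z assume i: "i \<in> I"
    have "cmod (f i z) * cmod (g i z) \<le> (C * m i z) * (D * n i z)"
      using C D(2)[OF i] assms(3)[OF i] i by (intro mult_mono) auto
    then show "cmod (f i z * g i z) \<le> (C * D) * (m i z * n i z)" by (simp add: norm_mult mult_ac)
  qed (use C D in simp)
qed

text \<open>
  \<open>symb k I w m f\<close>: the derivatives up to order \<open>k\<close> of the members \<open>f i\<close> of a family are
  bounded by \<open>m\<close>, with an additional factor \<open>w i v\<close> for each derivative in direction \<open>v\<close>,
  uniformly in \<open>i\<close>. The recursion over \<open>k\<close> turns the product, chain and quotient rules into
  short inductions.
\<close>

primrec symb :: "nat \<Rightarrow> 'i set \<Rightarrow> ('i \<Rightarrow> 'a::euclidean_space \<Rightarrow> 'a \<Rightarrow> real) \<Rightarrow>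
    ('i \<Rightarrow> 'a \<Rightarrow> real) \<Rightarrow> ('i \<Rightarrow> 'a \<Rightarrow> complex) \<Rightarrow> bool" where
  "symb 0 I w m f = bdd_by I m f"
| "symb (Suc k) I w m f = (bdd_by I m f \<and>
     (\<forall>i\<in>I. \<forall>z. f i differentiable (at z)) \<and>
     (\<forall>v\<in>Basis. symb k I w (\<lambda>i z. m i z * w i v z) (\<lambda>i. dd v (f i))))"

abbreviation symb1 :: "nat \<Rightarrow> 'i set \<Rightarrow> ('i \<Rightarrow> 'a::euclidean_space \<Rightarrow> complex) \<Rightarrow> bool" where
  "symb1 k I f \<equiv> symb k I (\<lambda>_ _ _. 1) (\<lambda>_ _. 1) f"

lemma symb_bound: "symb k I w m f \<Longrightarrow> bdd_by I m f"
  by (cases k) auto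

lemma symb_SucI:
  assumes "bdd_by I m f"
    and "\<And>i z. i \<in> I \<Longrightarrow> f i differentiable (at z)"
    and "\<And>v. v \<in> Basis \<Longrightarrow> symb k I w (\<lambda>i z. m i z * w i v z) (\<lambda>i. dd v (f i))"
  shows "symb (Suc k) I w m f"
  using assms by simp

lemma symb_differentiable: "symb (Suc k) I w m f \<Longrightarrow> i \<in> I \<Longrightarrow> f i differentiable (at z)"
  by simp

lemma symb_dd: "symb (Suc k) I w m f \<Longrightarrow> v \<in> Basis \<Longrightarrow>
    symb k I w (\<lambda>i z. m i z * w i v z) (\<lambda>i. dd v (f i))"
  by simp

lemma symb_cong: "(\<And>i. i \<in> I \<Longrightarrow> f i = g i) \<Longrightarrow> symb k I w m f = symb k I w m g"
proof (induction k arbitrary: m f g)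
  case 0
  then show ?case by (simp add: bdd_by_def)
next
  case (Suc k)
  have "symb k I w (\<lambda>i z. m i z * w i v z) (\<lambda>i. dd v (f i)) =
        symb k I w (\<lambda>i z. m i z * w i v z) (\<lambda>i. dd v (g i))" for v
    by (rule Suc.IH) (simp add: Suc.prems)
  then show ?case using Suc.prems by (simp add: bdd_by_def)
qed

lemma symb_Suc_imp: "symb (Suc k) I w m f \<Longrightarrow> symb k I w m f"
proof (induction k arbitrary: m f)
  case 0
  then show ?case by simp
next
  case (Suc k)
  show ?case
    by (rule symb_SucI[OF symb_bound[OF Suc.prems] symb_differentiable[OF Suc.prems]
        Suc.IH[OF symb_dd[OF Suc.prems]]])
qed

lemma symb_mono:
  assumes "symb k I w m f" "C \<ge> 0" "\<And>i z. i \<in> I \<Longrightarrow> m i z \<le> C * m' i z"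
    and wpos: "\<And>i v z. 0 \<le> w i v z"
  shows "symb k I w m' f"
  using assms(1,3)
proof (induction k arbitrary: m m' f)
  case 0
  then show ?case using bdd_by_mono[OF _ \<open>C \<ge> 0\<close>, of I m f m'] by simp
next
  case (Suc k)
  show ?case
  proof (rule symb_SucI)
    show "bdd_by I m' f" by (rule bdd_by_mono[OF symb_bound[OF Suc.prems(1)] \<open>C \<ge> 0\<close> Suc.prems(2)])
    show "symb k I w (\<lambda>i z. m' i z * w i v z) (\<lambda>i. dd v (f i))" if "v \<in> Basis" for v
    proof (rule Suc.IH[OF symb_dd[OF Suc.prems(1) that]])
      show "m i z * w i v z \<le> C * (m' i z * w i v z)" if "i \<in> I" for i z
        using mult_right_mono[OF Suc.prems(2)[OF that, of z] wpos[of i v z]] by (simp add: mult_ac)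
    qed
  qed (rule symb_differentiable[OF Suc.prems(1)])
qed

lemma symb_add:
  assumes "symb k I w m f" "symb k I w m g"
  shows "symb k I w m (\<lambda>i z. f i z + g i z)"
  using assms
proof (induction k arbitrary: m f g)
  case 0
  then show ?case by (simp add: bdd_by_add)
next
  case (Suc k)
  have der: "((\<lambda>z. f i z + g i z) has_derivative (\<lambda>h. dd h (f i) z + dd h (g i) z)) (at z)"
    if "i \<in> I" for i z
    by (intro has_derivative_add dd_works symb_differentiable[OF Suc.prems(1) that]
        symb_differentiable[OF Suc.prems(2) that])
  show ?case
  proof (rule symb_SucI)
    show "bdd_by I m (\<lambda>i z. f i z + g i z)"
      by (intro bdd_by_add symb_bound[OF Suc.prems(1)] symb_bound[OF Suc.prems(2)])
    show "symb k I w (\<lambda>i z. m i z * w i v z) (\<lambda>i. dd v (\<lambda>z. f i z + g i z))" if "v \<in> Basis" for v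
    proof -
      have "symb k I w (\<lambda>i z. m i z * w i v z) (\<lambda>i z. dd v (f i) z + dd v (g i) z)"
        by (rule Suc.IH[OF symb_dd[OF Suc.prems(1) that] symb_dd[OF Suc.prems(2) that]])
      then show ?thesis by (subst symb_cong[OF ext[OF dd_eqI[OF der]]])
    qed
  qed (rule differentiableI_der[OF der])
qed

lemma symb_mult:
  assumes "symb k I w m f" "symb k I w n g"
    and m: "\<And>i z. 0 \<le> m i z" and n: "\<And>i z. 0 \<le> n i z"
    and wpos: "\<And>i v z. 0 \<le> w i v z"
  shows "symb k I w (\<lambda>i z. m i z * n i z) (\<lambda>i z. f i z * g i z)"
  using assms(1-4)
proof (induction k arbitrary: m n f g)
  case 0
  then show ?case by (simp add: bdd_by_mult)
next
  case (Suc k)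
  have der: "((\<lambda>z. f i z * g i z) has_derivative (\<lambda>h. f i z * dd h (g i) z + dd h (f i) z * g i z)) (at z)"
    if "i \<in> I" for i z
    by (intro has_derivative_mult dd_works symb_differentiable[OF Suc.prems(1) that]
        symb_differentiable[OF Suc.prems(2) that])
  show ?case
  proof (rule symb_SucI)
    show "bdd_by I (\<lambda>i z. m i z * n i z) (\<lambda>i z. f i z * g i z)"
      by (intro bdd_by_mult symb_bound[OF Suc.prems(1)] symb_bound[OF Suc.prems(2)] Suc.prems)
    show "symb k I w (\<lambda>i z. m i z * n i z * w i v z) (\<lambda>i. dd v (\<lambda>z. f i z * g i z))" if v: "v \<in> Basis" for v
    proof -
      have 1: "symb k I w (\<lambda>i z. (m i z * w i v z) * n i z) (\<lambda>i z. dd v (f i) z * g i z)"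
        using Suc.prems wpos by (intro Suc.IH symb_dd[OF _ v] symb_Suc_imp[OF Suc.prems(2)]) auto
      have 2: "symb k I w (\<lambda>i z. m i z * (n i z * w i v z)) (\<lambda>i z. f i z * dd v (g i) z)"
        using Suc.prems wpos by (intro Suc.IH symb_dd[OF _ v] symb_Suc_imp[OF Suc.prems(1)]) auto
      have e1: "(\<lambda>i z. (m i z * w i v z) * n i z) = (\<lambda>i z. m i z * n i z * w i v z)"
        and e2: "(\<lambda>i z. m i z * (n i z * w i v z)) = (\<lambda>i z. m i z * n i z * w i v z)"
        by (simp_all add: mult_ac)
      show ?thesis
        using symb_add[OF 2[unfolded e2] 1[unfolded e1]] by (subst symb_cong[OF ext[OF dd_eqI[OF der]]])
    qed
  qed (rule differentiableI_der[OF der])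
qed

lemma symb_zero:
  assumes "\<And>i z. i \<in> I \<Longrightarrow> 0 \<le> m i z" "\<And>i v z. 0 \<le> w i v z"
  shows "symb k I w m (\<lambda>i z. 0)"
  using assms(1)
proof (induction k arbitrary: m)
  case 0
  then show ?case by (auto intro: bdd_byI[of 1])
next
  case (Suc k)
  show ?case
    by (rule symb_SucI) (use Suc assms(2) in \<open>auto intro: bdd_byI[of 1]\<close>)
qed

lemma symb_const:
  assumes "\<And>i z. 0 \<le> m i z" "\<And>i v z. 0 \<le> w i v z"
    and "C \<ge> 0" "\<And>i z. i \<in> I \<Longrightarrow> cmod (c i) \<le> C * m i z"
  shows "symb k I w m (\<lambda>i z. c i)"
proof (cases k)
  case 0
  then show ?thesis using assms by (auto intro: bdd_byI[of C])
next
  case (Suc l)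
  show ?thesis unfolding Suc
    by (rule symb_SucI) (use assms in \<open>auto intro: bdd_byI[of C] intro!: symb_zero\<close>)
qed

lemma symb_scale:
  assumes "symb k I w m f" "\<And>i z. 0 \<le> m i z" "\<And>i v z. 0 \<le> w i v z"
  shows "symb k I w (\<lambda>i z. cmod (c i) * m i z) (\<lambda>i z. c i * f i z)"
  by (rule symb_mult[OF symb_const[where C = 1] assms(1)]) (use assms in auto)

lemma symb_sum:
  assumes "finite B" "\<And>e. e \<in> B \<Longrightarrow> symb k I w m (f e)" "\<And>i z. 0 \<le> m i z" "\<And>i v z. 0 \<le> w i v z"
  shows "symb k I w m (\<lambda>i z. \<Sum>e\<in>B. f e i z)"
  using assms(1,2)
proof (induction B rule: finite_induct)
  case empty
  then show ?case using assms by (simp add: symb_zero)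
next
  case (insert x F)
  then show ?case by (simp add: symb_add)
qed

text \<open>Change of parameters: with this a family in \<open>h\<close> becomes one in \<kappa>, a
  single member is isolated, or further parameters such as the point \<open>x\<close> join the
  index.\<close>

lemma symb_reindex:
  "symb k I w m f \<Longrightarrow> (\<And>j. j \<in> J \<Longrightarrow> g j \<in> I) \<Longrightarrow>
   symb k J (\<lambda>j. w (g j)) (\<lambda>j. m (g j)) (\<lambda>j. f (g j))"
proof (induction k arbitrary: m f)
  case 0
  then show ?case by (auto simp: bdd_by_def)
next
  case (Suc k)
  show ?case
  proof (rule symb_SucI)
    show "bdd_by J (\<lambda>j. m (g j)) (\<lambda>j. f (g j))"
      using symb_bound[OF Suc.prems(1)] Suc.prems(2) by (auto simp: bdd_by_def)
    show "symb k J (\<lambda>j. w (g j)) (\<lambda>j z. m (g j) z * w (g j) v z) (\<lambda>j. dd v (f (g j)))" if "v \<in> Basis" for v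
      using Suc.IH[OF symb_dd[OF Suc.prems(1) that] Suc.prems(2)] by simp
  qed (use symb_differentiable[OF Suc.prems(1)] Suc.prems(2) in blast)
qed

text \<open>The derivative \<open>L i\<close> does not depend on the point, so each differentiation
  produces only constant coefficients \<open>L i v \<bullet> e\<close> and the induction stays
  within compositions with \<open>l i\<close>. The assumption on \<open>D\<close> says that these
  coefficients pay for the change of weights from \<open>w\<close> to \<open>w'\<close>.\<close>

lemma symb_affine:
  fixes f :: "'i \<Rightarrow> 'b::euclidean_space \<Rightarrow> complex" and l :: "'i \<Rightarrow> 'a::euclidean_space \<Rightarrow> 'b"
  assumes "symb k I w m f"
    and l: "\<And>i z. i \<in> I \<Longrightarrow> (l i has_derivative L i) (at z)"
    and D: "D \<ge> 0" "\<And>i v e z. i \<in> I \<Longrightarrow> v \<in> Basis \<Longrightarrow> e \<in> Basis \<Longrightarrow>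
        \<bar>L i v \<bullet> e\<bar> * w i e (l i z) \<le> D * w' i v z"
    and "\<And>i z. 0 \<le> m i z" and wpos: "\<And>i v z. 0 \<le> w i v z" "\<And>i v z. 0 \<le> w' i v z"
  shows "symb k I w' (\<lambda>i z. m i (l i z)) (\<lambda>i z. f i (l i z))"
  using assms(1,5)
proof (induction k arbitrary: m f)
  case 0
  then show ?case by (auto simp: bdd_by_def)
next
  case (Suc k)
  have der: "((\<lambda>z. f i (l i z)) has_derivative (\<lambda>h. dd (L i h) (f i) (l i z))) (at z)" if "i \<in> I" for i z
    by (rule has_derivative_compose[OF l[OF that] dd_works[OF symb_differentiable[OF Suc.prems(1) that]]])
  have eq: "dd v (\<lambda>z. f i (l i z)) z = (\<Sum>e\<in>Basis. complex_of_real (L i v \<bullet> e) * dd e (f i) (l i z))"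
    if "i \<in> I" for i v z
    unfolding dd_eqI[OF der[OF that]] by (rule dd_expand[OF symb_differentiable[OF Suc.prems(1) that]])
  show ?case
  proof (rule symb_SucI)
    show "bdd_by I (\<lambda>i z. m i (l i z)) (\<lambda>i z. f i (l i z))"
      using symb_bound[OF Suc.prems(1)] by (auto simp: bdd_by_def)
    show "symb k I w' (\<lambda>i z. m i (l i z) * w' i v z) (\<lambda>i. dd v (\<lambda>z. f i (l i z)))" if v: "v \<in> Basis" for v
    proof (subst symb_cong[OF ext[OF eq]], assumption, rule symb_sum)
      show "symb k I w' (\<lambda>i z. m i (l i z) * w' i v z)
         (\<lambda>i z. complex_of_real (L i v \<bullet> e) * dd e (f i) (l i z))" if e: "e \<in> Basis" for e
      proof (rule symb_mono)
        show "symb k I w' (\<lambda>i z. cmod (complex_of_real (L i v \<bullet> e)) * (m i (l i z) * w i e (l i z)))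
         (\<lambda>i z. complex_of_real (L i v \<bullet> e) * dd e (f i) (l i z))"
          using Suc.prems wpos by (intro symb_scale Suc.IH symb_dd[OF _ e]) auto
        show "cmod (complex_of_real (L i v \<bullet> e)) * (m i (l i z) * w i e (l i z)) \<le> D * (m i (l i z) * w' i v z)"
          if "i \<in> I" for i z
          using mult_left_mono[OF D(2)[OF that v e, of z] Suc.prems(2)[of i "l i z"]] by (simp add: mult_ac)
      qed (use D wpos in auto)
    qed (use Suc.prems wpos in auto)
  qed (rule differentiableI_der[OF der])
qed

text \<open>The derivative of \<open>1 / f\<close> is \<open>- f' / f\<^sup>2\<close>, again built
  from \<open>1 / f\<close> and a derivative of \<open>f\<close>, so the order drops by one, while
  \<epsilon> enters only through the bound on \<open>1 / f\<close> itself.\<close>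

lemma symb_inverse:
  assumes "symb k I w (\<lambda>_ _. 1) f" "\<epsilon> > 0" "\<And>i z. i \<in> I \<Longrightarrow> \<epsilon> \<le> cmod (f i z)"
    and wpos: "\<And>i v z. 0 \<le> w i v z"
  shows "symb k I w (\<lambda>_ _. 1) (\<lambda>i z. inverse (f i z))"
  using assms(1)
proof (induction k)
  have bd: "bdd_by I (\<lambda>_ _. 1) (\<lambda>i z. inverse (f i z))"
    by (rule bdd_byI[of "inverse \<epsilon>"]) (use assms in \<open>auto simp: norm_inverse intro!: le_imp_inverse_le\<close>)
  { case 0 then show ?case using bd by simp }
  { case (Suc k)
    have nz: "f i z \<noteq> 0" if "i \<in> I" for i z using assms(2) assms(3)[OF that, of z] by auto
    have der: "((\<lambda>z. inverse (f i z)) has_derivative (\<lambda>h. - (inverse (f i z) * dd h (f i) z * inverse (f i z)))) (at z)"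
      if "i \<in> I" for i z
      by (rule Deriv.has_derivative_inverse[OF nz[OF that] dd_works[OF symb_differentiable[OF Suc.prems that]]])
    have ih: "symb k I w (\<lambda>_ _. 1) (\<lambda>i z. inverse (f i z))"
      by (rule Suc.IH[OF symb_Suc_imp[OF Suc.prems]])
    show ?case
    proof (rule symb_SucI[OF bd differentiableI_der[OF der]])
      show "symb k I w (\<lambda>i z. 1 * w i v z) (\<lambda>i. dd v (\<lambda>z. inverse (f i z)))" if v: "v \<in> Basis" for v
      proof -
        have "symb k I w (\<lambda>i z. (1 * (1 * w i v z)) * 1)
            (\<lambda>i z. (inverse (f i z) * dd v (f i) z) * inverse (f i z))"
          using wpos by (intro symb_mult ih symb_dd[OF Suc.prems v]) auto
        from symb_scale[OF this, of "\<lambda>_. -1"] wpos show ?thesis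
          by (subst symb_cong[OF ext[OF dd_eqI[OF der]]]) simp_all
      qed
    qed }
qed

text \<open>Only the derivatives of \<open>f\<close> are controlled by the weights; \<open>f\<close>
  itself may be unbounded, as a rescaled phase is. The bound on the exponential comes from the sign
  of the real part and is supplied separately.\<close>

lemma symb_exp:
  assumes "\<And>v. v \<in> Basis \<Longrightarrow> symb k I w (\<lambda>i z. w i v z) (\<lambda>i. dd v (f i))"
    and diff: "\<And>i z. i \<in> I \<Longrightarrow> f i differentiable (at z)"
    and bd: "bdd_by I (\<lambda>_ _. 1) (\<lambda>i z. exp (f i z))"
    and wpos: "\<And>i v z. 0 \<le> w i v z"
  shows "symb (Suc k) I w (\<lambda>_ _. 1) (\<lambda>i z. exp (f i z))"
  using assms(1)
proof (induction k)
  have der: "((\<lambda>z. exp (f i z)) has_derivative (\<lambda>h. exp (f i z) * dd h (f i) z)) (at z)" if "i \<in> I" for i z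
    using has_derivative_compose[OF dd_works[OF diff[OF that]] DERIV_exp[unfolded has_field_derivative_def]]
    by simp
  { case 0
    show ?case
    proof (rule symb_SucI[OF bd differentiableI_der[OF der]])
      show "symb 0 I w (\<lambda>i z. 1 * w i v z) (\<lambda>i. dd v (\<lambda>z. exp (f i z)))" if v: "v \<in> Basis" for v
      proof -
        have "symb 0 I w (\<lambda>i z. 1 * w i v z) (\<lambda>i z. exp (f i z) * dd v (f i) z)"
          using wpos bd 0[OF v] by (intro symb_mult) auto
        then show ?thesis by (subst symb_cong[OF ext[OF dd_eqI[OF der]]])
      qed
    qed }
  { case (Suc k)
    have ih: "symb (Suc k) I w (\<lambda>_ _. 1) (\<lambda>i z. exp (f i z))"
      by (intro Suc.IH symb_Suc_imp[OF Suc.prems])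
    show ?case
    proof (rule symb_SucI[OF bd differentiableI_der[OF der]])
      show "symb (Suc k) I w (\<lambda>i z. 1 * w i v z) (\<lambda>i. dd v (\<lambda>z. exp (f i z)))" if v: "v \<in> Basis" for v
      proof -
        have "symb (Suc k) I w (\<lambda>i z. 1 * w i v z) (\<lambda>i z. exp (f i z) * dd v (f i) z)"
          using wpos by (intro symb_mult ih Suc.prems[OF v]) auto
        then show ?thesis by (subst symb_cong[OF ext[OF dd_eqI[OF der]]])
      qed
    qed }
qed

lemma symb_prod:
  assumes "finite B" "\<And>e. e \<in> B \<Longrightarrow> symb k I w (m e) (f e)" "\<And>e i z. 0 \<le> m e i z" "\<And>i v z. 0 \<le> w i v z"
  shows "symb k I w (\<lambda>i z. \<Prod>e\<in>B. m e i z) (\<lambda>i z. \<Prod>e\<in>B. f e i z)"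
  using assms(1,2)
proof (induction B rule: finite_induct)
  case empty
  then show ?case using assms(4) by (auto intro!: symb_const[where C = 1])
next
  case (insert x F)
  then have "symb k I w (\<lambda>i z. m x i z * (\<Prod>e\<in>F. m e i z)) (\<lambda>i z. f x i z * (\<Prod>e\<in>F. f e i z))"
    by (intro symb_mult) (auto intro!: prod_nonneg assms)
  with insert.hyps show ?case by simp
qed

text \<open>\<open>iter_deriv\<close> adds a derivative on the outside, whereas \<open>symb\<close>
  differentiates first and recurses. Taking the last list entry off instead of the first reconciles
  the two.\<close>

lemma iter_deriv_snoc: "iter_deriv (vs @ [v]) f = iter_deriv vs (dd v f)"
  by (induction vs) (simp_all add: dd_def)

lemma iter_deriv_Cons_dd: "iter_deriv (v # vs) f = dd v (iter_deriv vs f)"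
  by (simp add: dd_def)

lemma symb_iter_deriv:
  "symb (length vs + k) I (\<lambda>_ _ _. 1) m f \<Longrightarrow> set vs \<subseteq> Basis \<Longrightarrow>
   symb k I (\<lambda>_ _ _. 1) m (\<lambda>i. iter_deriv vs (f i))"
proof (induction vs arbitrary: f rule: rev_induct)
  case (snoc v vs)
  from snoc.prems have "symb (Suc (length vs + k)) I (\<lambda>_ _ _. 1) m f" "v \<in> Basis" by simp_all
  from symb_dd[OF this] have "symb (length vs + k) I (\<lambda>_ _ _. 1) m (\<lambda>i. dd v (f i))" by simp
  from snoc.IH[OF this] snoc.prems show ?case by (simp add: iter_deriv_snoc)
qed simp

lemma symb_iff_smooth:
  "(\<forall>k. symb k I (\<lambda>_ _ _. 1) m f) \<longleftrightarrow>
   (\<forall>i\<in>I. smooth (f i)) \<and> (\<forall>vs. set vs \<subseteq> Basis \<longrightarrow> bdd_by I m (\<lambda>i. iter_deriv vs (f i)))"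
proof (intro iffI conjI ballI allI impI)
  assume L: "\<forall>k. symb k I (\<lambda>_ _ _. 1) m f"
  show "smooth (f i)" if "i \<in> I" for i
    unfolding smooth_def
  proof (intro allI impI)
    fix vs :: "'b list" and x assume vs: "set vs \<subseteq> Basis"
    show "iter_deriv vs (f i) differentiable at x"
      by (rule symb_differentiable[OF symb_iter_deriv[OF L[rule_format] vs] that])
  qed
  show "bdd_by I m (\<lambda>i. iter_deriv vs (f i))" if "set vs \<subseteq> Basis" for vs
    by (rule symb_bound[OF symb_iter_deriv[OF L[rule_format] that, of 0]])
next
  fix k
  assume "(\<forall>i\<in>I. smooth (f i)) \<and> (\<forall>vs. set vs \<subseteq> Basis \<longrightarrow> bdd_by I m (\<lambda>i. iter_deriv vs (f i)))"
  then show "symb k I (\<lambda>_ _ _. 1) m f"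
  proof (induction k arbitrary: f)
    case 0
    then have "bdd_by I m (\<lambda>i. iter_deriv [] (f i))" by (metis empty_iff list.set(1) subsetI)
    then show ?case by simp
  next
    case (Suc k)
    then have s: "\<And>i. i \<in> I \<Longrightarrow> smooth (f i)"
      and b: "\<And>vs. set vs \<subseteq> Basis \<Longrightarrow> bdd_by I m (\<lambda>i. iter_deriv vs (f i))" by blast+
    show ?case
    proof (rule symb_SucI)
      show "bdd_by I m f" using b[of "[]"] by simp
      show "f i differentiable at z" if "i \<in> I" for i z
        using s[OF that, unfolded smooth_def, rule_format, of "[]"] by simp
      show "symb k I (\<lambda>_ _ _. 1) (\<lambda>i z. m i z * 1) (\<lambda>i. dd v (f i))" if v: "v \<in> Basis" for v
        unfolding mult_1_right
      proof (rule Suc.IH, intro conjI ballI allI impI)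
        show "smooth (dd v (f i))" if "i \<in> I" for i
          unfolding smooth_def
        proof (intro allI impI)
          fix vs :: "'b list" and x assume "set vs \<subseteq> Basis"
          then show "iter_deriv vs (dd v (f i)) differentiable at x"
            using s[OF that, unfolded smooth_def, rule_format, of "vs @ [v]" x] v
            by (simp add: iter_deriv_snoc)
        qed
        show "bdd_by I m (\<lambda>i. iter_deriv vs (dd v (f i)))" if "set vs \<subseteq> Basis" for vs
          using b[of "vs @ [v]"] v that by (simp add: iter_deriv_snoc)
      qed
    qed
  qed
qed

lemma symbol_class_iff_symb:
  fixes a :: "real \<Rightarrow> (real ^ 'n) \<times> (real ^ 'n) \<Rightarrow> complex"
  shows "a \<in> symbol_class h0 \<longleftrightarrow> (\<forall>k. symb1 k {0<..<h0} a)"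
proof -
  have "bdd_by I (\<lambda>_ _. 1) f \<longleftrightarrow> (\<exists>C. \<forall>h\<in>I. \<forall>z. cmod (f h z) \<le> C)" for I :: "real set" and f :: "real \<Rightarrow> (real ^ 'n) \<times> (real ^ 'n) \<Rightarrow> complex"
  proof
    assume "\<exists>C. \<forall>h\<in>I. \<forall>z. cmod (f h z) \<le> C"
    then obtain C where "\<forall>h\<in>I. \<forall>z. cmod (f h z) \<le> C" by blast
    then show "bdd_by I (\<lambda>_ _. 1) f" by (intro bdd_byI[of "\<bar>C\<bar>"]) (auto intro: order_trans[OF _ abs_ge_self])
  qed (auto simp: bdd_by_def)
  then show ?thesis by (simp only: symb_iff_smooth symbol_class_def mem_Collect_eq)
qed

lemma symb_continuous_on: "symb (Suc k) I w m f \<Longrightarrow> i \<in> I \<Longrightarrow> continuous_on S (f i)"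
  by (meson continuous_at_imp_continuous_on differentiable_imp_continuous_within symb_differentiable)

lemma dd_eq_0_outside:
  assumes "closed K" "\<And>z. z \<notin> K \<Longrightarrow> f z = 0" "z \<notin> K"
  shows "dd v f z = 0"
proof -
  have "(f has_derivative (\<lambda>_. 0)) (at z)"
  proof (rule has_derivative_transform_within_open[of "\<lambda>_. 0" _ _ "UNIV" "- K"])
    show "open (- K)" using assms(1) by (simp add: open_Compl)
  qed (use assms in auto)
  from dd_eqI[OF this] show ?thesis .
qed

text \<open>Differentiation does not enlarge a closed set outside which a function vanishes, so the
  indicator survives at every order. For compact sets this provides integrable majorants.\<close>

lemma symb_indicator:
  assumes "symb k I w m f" "\<And>i. i \<in> I \<Longrightarrow> closed (K i)" "\<And>i z. i \<in> I \<Longrightarrow> z \<notin> K i \<Longrightarrow> f i z = 0"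
  shows "symb k I w (\<lambda>i z. m i z * indicator (K i) z) f"
  using assms(1,3)
proof (induction k arbitrary: m f)
  have bd: "bdd_by I (\<lambda>i z. m i z * indicator (K i) z) f"
    if b: "bdd_by I m f" "\<And>i z. i \<in> I \<Longrightarrow> z \<notin> K i \<Longrightarrow> f i z = 0" for m f
  proof -
    obtain C where C: "C \<ge> 0" "\<And>i z. i \<in> I \<Longrightarrow> cmod (f i z) \<le> C * m i z" by (rule bdd_byE[OF b(1)]) (rule that)
    show ?thesis by (rule bdd_byI[of C]) (use C b(2) in \<open>auto simp: indicator_def\<close>)
  qed
  { case 0 then show ?case using bd by simp }
  { case (Suc k)
    show ?case
    proof (rule symb_SucI[OF bd[OF symb_bound[OF Suc.prems(1)] Suc.prems(2)] symb_differentiable[OF Suc.prems(1)]])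
      fix v :: 'b assume v: "v \<in> Basis"
      have "symb k I w (\<lambda>i z. m i z * w i v z * indicator (K i) z) (\<lambda>i. dd v (f i))"
        by (rule Suc.IH[OF symb_dd[OF Suc.prems(1) v]])
          (rule dd_eq_0_outside[OF assms(2) Suc.prems(2)])
      moreover have "(\<lambda>i z. m i z * w i v z * indicator (K i) z) = (\<lambda>i z. m i z * indicator (K i) z * w i v z)"
        by (simp add: mult_ac)
      ultimately show "symb k I w (\<lambda>i z. m i z * indicator (K i) z * w i v z) (\<lambda>i. dd v (f i))" by simp
    qed }
qed

lemma test_function_symb:
  assumes "test_function f"
  shows "symb1 k I (\<lambda>_. f)"
proof -
  have sm: "smooth f" and cp: "compact (supp f)" using assms by (auto simp: test_function_def)
  have zero: "iter_deriv vs f z = 0" if "z \<notin> supp f" for vs z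
    using that
  proof (induction vs arbitrary: z)
    case Nil
    have "{x. f x \<noteq> 0} \<subseteq> supp f" unfolding supp_def by (rule closure_subset)
    with Nil show ?case by auto
  next
    case (Cons v vs)
    then show ?case unfolding iter_deriv_Cons_dd
      by (intro dd_eq_0_outside[OF compact_imp_closed[OF cp]]) auto
  qed
  have "bdd_by I (\<lambda>_ _. 1) (\<lambda>_. iter_deriv vs f)" if "set vs \<subseteq> Basis" for vs
  proof -
    have "continuous_on UNIV (iter_deriv vs f)"
      using sm that unfolding smooth_def
      by (meson continuous_at_imp_continuous_on differentiable_imp_continuous_within)
    then have "compact (iter_deriv vs f ` supp f)"
      using cp by (meson compact_continuous_image continuous_on_subset subset_UNIV)
    then obtain B where B: "\<forall>z\<in>supp f. cmod (iter_deriv vs f z) \<le> B"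
      using compact_imp_bounded bounded_iff by (metis imageI)
    have "cmod (iter_deriv vs f z) \<le> \<bar>B\<bar>" for z
      using B zero[of z vs] by (cases "z \<in> supp f") (auto intro: order_trans[OF _ abs_ge_self])
    then show ?thesis by (intro bdd_byI[of "\<bar>B\<bar>"]) auto
  qed
  then have "\<forall>k. symb1 k I (\<lambda>_. f)"
    unfolding symb_iff_smooth using sm by blast
  then show ?thesis by blast
qed

lemma schwartzI:
  assumes "\<And>k. symb1 k {()} (\<lambda>_. f)" "bounded K" "closed K" "\<And>x. x \<notin> K \<Longrightarrow> f x = 0"
  shows "schwartz f"
proof -
  have "\<forall>k. symb k {()} (\<lambda>_ _ _. 1) (\<lambda>_ z. 1 * indicator K z) (\<lambda>_. f)"
    using assms by (intro allI symb_indicator) auto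
  then have sm: "smooth f" and b: "\<And>vs. set vs \<subseteq> Basis \<Longrightarrow> bdd_by {()} (\<lambda>_ z. 1 * indicator K z) (\<lambda>_. iter_deriv vs f)"
    unfolding symb_iff_smooth by auto
  obtain R where R: "R > 0" "\<And>x. x \<in> K \<Longrightarrow> norm x \<le> R" using assms(2) bounded_pos by blast
  show ?thesis unfolding schwartz_def
  proof (intro conjI sm allI impI)
    fix k :: nat and vs :: "'a list" assume "set vs \<subseteq> Basis"
    from b[OF this] obtain C where C: "C \<ge> 0" "\<And>z. cmod (iter_deriv vs f z) \<le> C * indicator K z"
      by (auto simp: bdd_by_def)
    have "norm x ^ k * cmod (iter_deriv vs f x) \<le> R ^ k * C" for x
      using C(2)[of x] C(1) R(1) R(2)[of x]
      by (cases "x \<in> K") (auto intro!: mult_mono power_mono)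
    then show "\<exists>C. \<forall>x. norm x ^ k * cmod (iter_deriv vs f x) \<le> C" by blast
  qed
qed

subsection \<open>Integration\<close>

lemma integral_affine:
  fixes f :: "'a::euclidean_space \<Rightarrow> 'b::{banach, second_countable_topology}"
  assumes c: "c \<noteq> 0" and [measurable]: "f \<in> borel_measurable borel"
  shows "(LINT x|lborel. f x) = \<bar>c\<bar> ^ DIM('a) *\<^sub>R (LINT x|lborel. f (t + c *\<^sub>R x))"
  by (subst lborel_affine[OF c, of t]) (simp add: integral_density integral_distr)

lemma integrable_affine:
  fixes f :: "'a::euclidean_space \<Rightarrow> 'b::{banach, second_countable_topology}"
  assumes c: "c \<noteq> 0" and f: "integrable lborel f"
  shows "integrable lborel (\<lambda>x. f (t + c *\<^sub>R x))"
proof -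
  have [measurable]: "f \<in> borel_measurable borel" using f by auto
  have "integrable (density (distr lborel borel (\<lambda>x. t + c *\<^sub>R x)) (\<lambda>_. \<bar>c\<bar> ^ DIM('a))) f"
    using f lborel_affine[OF c, of t] by simp
  then have "integrable (distr lborel borel (\<lambda>x. t + c *\<^sub>R x)) (\<lambda>x. \<bar>c\<bar> ^ DIM('a) *\<^sub>R f x)"
    by (subst (asm) integrable_density) auto
  then have "integrable lborel (\<lambda>x. \<bar>c\<bar> ^ DIM('a) *\<^sub>R f (t + c *\<^sub>R x))"
    by (subst (asm) integrable_distr_eq) auto
  from integrable_scaleR_right[OF this, of "inverse (\<bar>c\<bar> ^ DIM('a))"] show ?thesis using c by simp
qed

lemma integrable_bound_cont:
  fixes f :: "'a::euclidean_space \<Rightarrow> complex"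
  assumes "integrable lborel g" "continuous_on UNIV f" "\<And>x. cmod (f x) \<le> g x"
  shows "integrable lborel f"
proof (rule Bochner_Integration.integrable_bound[OF assms(1)])
  show "f \<in> borel_measurable lborel" using borel_measurable_continuous_onI[OF assms(2)] by simp
  show "AE x in lborel. norm (f x) \<le> norm (g x)"
    using assms(3) by (intro AE_I2) (auto intro: order_trans[OF _ abs_ge_self])
qed

lemma integral_cmod_bound:
  fixes f :: "'a::euclidean_space \<Rightarrow> complex"
  assumes "integrable lborel g" "\<And>x. cmod (f x) \<le> g x"
  shows "cmod (LINT x|lborel. f x) \<le> (LINT x|lborel. g x)"
proof (cases "integrable lborel f")
  case True
  then show ?thesis
    by (intro order_trans[OF integral_norm_bound] integral_mono assms integrable_norm)
next
  case False
  have "0 \<le> (LINT x|lborel. g x)"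
    by (intro integral_nonneg_AE AE_I2) (use assms(2) norm_ge_zero order_trans in blast)
  with False show ?thesis by (simp add: not_integrable_integral_eq)
qed

lemma pair_integrable_majorant:
  fixes f :: "'a::euclidean_space \<Rightarrow> 'b::euclidean_space \<Rightarrow> complex"
  assumes A: "integrable lborel A" and B: "integrable lborel B"
    and cont: "continuous_on UNIV (\<lambda>(x, y). f x y)"
    and bd: "\<And>x y. cmod (f x y) \<le> A x * B y"
  shows "integrable (lborel \<Otimes>\<^sub>M lborel) (\<lambda>(x, y). f x y)"
proof (rule lborel_pair.Fubini_integrable)
  have [measurable]: "(\<lambda>(x, y). f x y) \<in> borel_measurable (lborel \<Otimes>\<^sub>M lborel)"
    using borel_measurable_continuous_onI[OF cont] by (simp add: lborel_prod)
  then show "(\<lambda>(x, y). f x y) \<in> borel_measurable (lborel \<Otimes>\<^sub>M lborel)" .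
  have fx: "integrable lborel (\<lambda>y. f x y)" for x
  proof (rule integrable_bound_cont)
    show "integrable lborel (\<lambda>y. A x * B y)" using B by simp
    show "continuous_on UNIV (f x)"
      using continuous_on_compose2[OF cont, of UNIV "\<lambda>y. (x, y)"] by (simp add: continuous_on_Pair)
  qed (rule bd)
  then show "AE x in lborel. integrable lborel (\<lambda>y. (\<lambda>(x, y). f x y) (x, y))" by simp
  show "integrable lborel (\<lambda>x. LINT y|lborel. norm ((\<lambda>(x, y). f x y) (x, y)))"
  proof (rule Bochner_Integration.integrable_bound[where f = "\<lambda>x. A x * (LINT y|lborel. B y)"])
    show "integrable lborel (\<lambda>x. A x * (LINT y|lborel. B y))" using A by simp
    show "(\<lambda>x. LINT y|lborel. norm ((\<lambda>(x, y). f x y) (x, y))) \<in> borel_measurable lborel"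
      by measurable
    have "0 \<le> (LINT y|lborel. cmod (f x y))" "(LINT y|lborel. cmod (f x y)) \<le> A x * (LINT y|lborel. B y)" for x
      using integral_mono[OF integrable_norm[OF fx] integrable_mult_right[OF B, of "A x"] bd] by simp_all
    then show "AE x in lborel. norm (LINT y|lborel. norm ((\<lambda>(x, y). f x y) (x, y)))
        \<le> norm (A x * (LINT y|lborel. B y))"
      by (intro AE_I2) (auto intro: order_trans[OF _ abs_ge_self])
  qed
qed

lemma swap_integrals_majorant:
  fixes f :: "'a::euclidean_space \<Rightarrow> 'b::euclidean_space \<Rightarrow> complex"
  assumes "integrable lborel A" "integrable lborel B"
    and "continuous_on UNIV (\<lambda>(x, y). f x y)"
    and "\<And>x y. cmod (f x y) \<le> A x * B y"
  shows "(LINT x|lborel. LINT y|lborel. f x y) = (LINT y|lborel. LINT x|lborel. f x y)"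
  using lborel_pair.Fubini_integral[OF pair_integrable_majorant[OF assms]] by simp

text \<open>\<open>F (x + v) - F x\<close> is the integral of
  \<open>dd v F (x + s *\<^sub>R v)\<close> over \<open>s\<close> in \<open>[0, 1]\<close>.
  Integrating over \<open>x\<close> and exchanging the integrals, translation invariance gives 0 on
  one side and the integral of \<open>dd v F\<close> on the other. In this form integration by parts
  asks for integrability alone, not for pointwise decay at infinity.\<close>

lemma integral_dd_eq_0:
  fixes F :: "'a::euclidean_space \<Rightarrow> complex"
  assumes diff: "\<And>x. F differentiable (at x)" and cont: "continuous_on UNIV (dd v F)"
    and F: "integrable lborel F" and dF: "integrable lborel (dd v F)"
  shows "(LINT x|lborel. dd v F x) = 0"
proof -
  let ?G = "\<lambda>(s::real) x. indicator {0..1} s *\<^sub>R dd v F (x + s *\<^sub>R v)"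
  have meas[measurable]: "dd v F \<in> borel_measurable borel"
    by (rule borel_measurable_continuous_onI[OF cont])
  have shift: "integrable lborel (\<lambda>x. f (x + a))" "(LINT x|lborel. f (x + a)) = (LINT x|lborel. f x)"
    if f: "integrable lborel f" for f :: "'a \<Rightarrow> 'b::{banach,second_countable_topology}" and a
  proof -
    have [measurable]: "f \<in> borel_measurable borel" using f by auto
    show "integrable lborel (\<lambda>x. f (x + a))" "(LINT x|lborel. f (x + a)) = (LINT x|lborel. f x)"
      using integrable_affine[OF _ f, of 1 a] integral_affine[of 1 f a] by (simp_all add: add.commute)
  qed
  have "integrable (lborel \<Otimes>\<^sub>M lborel) (\<lambda>(s, x). ?G s x)"
  proof (rule lborel_pair.Fubini_integrable)
    show "(\<lambda>(s, x). ?G s x) \<in> borel_measurable (lborel \<Otimes>\<^sub>M lborel)" by measurable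
    have "(\<lambda>s. LINT y|lborel. norm ((\<lambda>(s, x). ?G s x) (s, y))) =
        (\<lambda>s. indicator {0..1} s * (LINT x|lborel. norm (dd v F x)))"
      using shift(2)[OF integrable_norm[OF dF]] by auto
    then show "integrable lborel (\<lambda>s. LINT y|lborel. norm ((\<lambda>(s, x). ?G s x) (s, y)))"
      by (simp only:) simp
    show "AE s in lborel. integrable lborel (\<lambda>x. (\<lambda>(s, x). ?G s x) (s, x))"
      using shift(1)[OF dF] by simp
  qed
  from lborel_pair.Fubini_integral[OF this]
  have "(LINT x|lborel. LINT s|lborel. ?G s x) = (LINT s|lborel. LINT x|lborel. ?G s x)" .
  also have "(\<lambda>x. LINT s|lborel. ?G s x) = (\<lambda>x. F (x + v) - F x)"
  proof
    fix x
    have "(LINT s|lborel. ?G s x) = F (x + 1 *\<^sub>R v) - F (x + 0 *\<^sub>R v)"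
    proof (rule integral_FTC_atLeastAtMost)
      fix s :: real
      have "((\<lambda>s. x + s *\<^sub>R v) has_derivative (\<lambda>s. s *\<^sub>R v)) (at s within {0..1})"
        by (auto intro!: derivative_eq_intros)
      from has_derivative_compose[OF this dd_works[OF diff]]
      have "((\<lambda>s. F (x + s *\<^sub>R v)) has_derivative (\<lambda>t. dd (t *\<^sub>R v) F (x + s *\<^sub>R v))) (at s within {0..1})" .
      moreover have "dd (t *\<^sub>R v) F (x + s *\<^sub>R v) = t *\<^sub>R dd v F (x + s *\<^sub>R v)" for t
        using linear_scale[OF dd_linear[OF diff]] .
      ultimately show "((\<lambda>s. F (x + s *\<^sub>R v)) has_vector_derivative dd v F (x + s *\<^sub>R v)) (at s within {0..1})"
        by (simp add: has_vector_derivative_def)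
    next
      show "continuous_on {0..1} (\<lambda>s. dd v F (x + s *\<^sub>R v))"
        by (rule continuous_on_compose2[OF cont]) (auto intro!: continuous_intros)
    qed simp
    then show "(LINT s|lborel. ?G s x) = F (x + v) - F x" by simp
  qed
  also have "(LINT x|lborel. F (x + v) - F x) = 0"
    using shift[OF F, of v] F by simp
  also have "(LINT s|lborel. LINT x|lborel. ?G s x) = (LINT s|lborel. indicator {0..1::real} s *\<^sub>R (LINT x|lborel. dd v F x))"
    using shift(2)[OF dF] by simp
  also have "\<dots> = (LINT x|lborel. dd v F x)"
    by (subst integral_scaleR_left) simp_all
  finally show ?thesis by simp
qed

text \<open>A tensor product of the weights \<open>1 / (1 + s\<^sup>2)\<close>: integrable in every
  dimension by its product form, yet dominated by \<open>1 / (1 + (norm x)\<^sup>2)\<close>. It is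
  also exactly the gain from integrating by parts twice along each coordinate.\<close>

definition decay :: "'a::euclidean_space \<Rightarrow> real" where
  "decay x = (\<Prod>b\<in>Basis. inverse (1 + (x \<bullet> b)\<^sup>2))"

lemma decay_eq: "decay x = inverse (\<Prod>b\<in>Basis. 1 + (x \<bullet> b)\<^sup>2)"
  unfolding decay_def by (rule prod_inversef[unfolded o_def])

lemma one_plus_sq_pos: "0 < 1 + (a::real)\<^sup>2" by (simp add: add_pos_nonneg)

lemma decay_pos: "0 < decay x" and decay_nonneg: "0 \<le> decay x"
  using one_plus_sq_pos by (auto simp: decay_def intro!: prod_pos less_imp_le)

lemma decay_le_1: "decay x \<le> 1"
  unfolding decay_def using one_plus_sq_pos
  by (intro prod_le_1) (auto simp: inverse_le_1_iff intro: less_imp_le)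

lemma decay_minus: "decay (x - y) = decay (y - x)"
  unfolding decay_def by (intro prod.cong refl) (simp add: inner_diff_left power2_commute)

lemma decay_continuous: "continuous_on S decay"
  unfolding decay_def[abs_def] using one_plus_sq_pos
  by (intro continuous_intros) (metis less_irrefl)

lemma decay_measurable [measurable]: "decay \<in> borel_measurable borel"
  by (rule borel_measurable_continuous_onI[OF decay_continuous])

lemma integral_lborel_prod:
  fixes f :: "'a::euclidean_space \<Rightarrow> real \<Rightarrow> 'b::{real_normed_field, banach, second_countable_topology}"
  assumes "\<And>b. b \<in> Basis \<Longrightarrow> integrable lborel (f b)"
  shows "integrable lborel (\<lambda>x. \<Prod>b\<in>Basis. f b (x \<bullet> b))"
    and "(LINT x|lborel. (\<Prod>b\<in>Basis. f b (x \<bullet> b))) = (\<Prod>b\<in>Basis. (LINT x|lborel. f b x))"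
proof -
  interpret product_sigma_finite "\<lambda>_::'a. lborel :: real measure" ..
  have [measurable]: "f b \<in> borel_measurable borel" if "b \<in> Basis" for b using assms[OF that] by auto
  have eq: "(\<Prod>b\<in>Basis. f b ((\<Sum>c\<in>Basis. y c *\<^sub>R c) \<bullet> b)) = (\<Prod>b\<in>Basis. f b (y b))" for y
    by (intro prod.cong refl) (simp add: inner_sum_left inner_Basis if_distrib sum.delta' cong: if_cong)
  show "integrable lborel (\<lambda>x. \<Prod>b\<in>Basis. f b (x \<bullet> b))"
    by (subst lborel_eq, subst integrable_distr_eq)
      (auto simp: eq intro!: product_integrable_prod assms)
  show "(LINT x|lborel. (\<Prod>b\<in>Basis. f b (x \<bullet> b))) = (\<Prod>b\<in>Basis. (LINT x|lborel. f b x))"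
    by (subst lborel_eq, subst integral_distr)
      (auto simp: eq intro!: product_integral_prod assms)
qed

lemma decay_integrable: "integrable lborel (decay :: 'a::euclidean_space \<Rightarrow> real)"
  unfolding decay_def[abs_def]
  by (rule integral_lborel_prod) (use integrable_inverse_1_plus_square in \<open>simp add: set_integrable_def einterval_eq\<close>)

lemma decay_integrable_minus: "integrable lborel (\<lambda>y. decay (x - y))"
    and decay_integral_minus: "(LINT y|lborel. decay (x - y)) = (LINT y|lborel. decay (y::'a))"
    for x :: "'a::euclidean_space"
proof -
  show "integrable lborel (\<lambda>y. decay (x - y))"
    using integrable_affine[OF _ decay_integrable, of "-1" x] by simp
  show "(LINT y|lborel. decay (x - y)) = (LINT y|lborel. decay (y::'a))"
    using integral_affine[of "-1" "decay :: 'a \<Rightarrow> real" x, symmetric] by simp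
qed

text \<open>Peetre's inequality for this weight. It holds factor by factor, with the constant 2 in
  each coordinate.\<close>

lemma decay_peetre: "decay (x - y) * decay y \<le> 2 ^ DIM('a) * decay (x::'a::euclidean_space)"
proof -
  have "inverse (1 + (a - b)\<^sup>2) * inverse (1 + b\<^sup>2) \<le> 2 * inverse (1 + a\<^sup>2)" for a b :: real
  proof -
    have "1 + a\<^sup>2 \<le> 2 * ((1 + (a - b)\<^sup>2) * (1 + b\<^sup>2))"
    proof -
      \<comment> \<open>This sum of squares is exactly the right-hand side minus the left-hand
        side.\<close>
      have "0 \<le> (a - 2 * b)\<^sup>2 + 2 * ((a - b) * b)\<^sup>2 + 1" by simp
      then show ?thesis by (simp add: power2_eq_square algebra_simps)
    qed
    then show ?thesis
      using one_plus_sq_pos[of a] one_plus_sq_pos[of b] one_plus_sq_pos[of "a - b"]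
      by (simp add: divide_simps mult_ac)
  qed
  then have "(\<Prod>b\<in>Basis. inverse (1 + (x \<bullet> b - y \<bullet> b)\<^sup>2) * inverse (1 + (y \<bullet> b)\<^sup>2))
      \<le> (\<Prod>b\<in>Basis. 2 * inverse (1 + (x \<bullet> b)\<^sup>2))"
    using one_plus_sq_pos by (intro prod_mono) (auto intro!: mult_nonneg_nonneg less_imp_le)
  then show ?thesis by (simp add: decay_def prod.distrib inner_diff_left)
qed

lemma one_plus_sum_le_prod:
  fixes a :: "'b \<Rightarrow> real"
  assumes "finite B" "\<And>b. b \<in> B \<Longrightarrow> 0 \<le> a b"
  shows "1 + (\<Sum>b\<in>B. a b) \<le> (\<Prod>b\<in>B. 1 + a b)"
  using assms
proof (induction B rule: finite_induct)
  case (insert x F)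
  then have ih: "1 + (\<Sum>b\<in>F. a b) \<le> (\<Prod>b\<in>F. 1 + a b)" and x: "0 \<le> a x"
    and F: "0 \<le> (\<Sum>b\<in>F. a b)" by (auto intro: sum_nonneg)
  have "1 + (a x + (\<Sum>b\<in>F. a b)) \<le> (1 + a x) * (1 + (\<Sum>b\<in>F. a b))"
    using x F by (simp add: algebra_simps)
  also have "\<dots> \<le> (1 + a x) * (\<Prod>b\<in>F. 1 + a b)" using ih x by (intro mult_left_mono) auto
  finally show ?case using insert by simp
qed simp

lemma norm_sq_eq_sum: "(norm x)\<^sup>2 = (\<Sum>b\<in>Basis. (x \<bullet> b)\<^sup>2)" for x :: "'a::euclidean_space"
  unfolding power2_norm_eq_inner by (subst euclidean_inner) (simp add: power2_eq_square)

lemma decay_norm_sq: "decay x * (1 + (norm x)\<^sup>2) \<le> 1"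
proof -
  have "1 + (norm x)\<^sup>2 \<le> (\<Prod>b\<in>Basis. 1 + (x \<bullet> b)\<^sup>2)"
    unfolding norm_sq_eq_sum by (rule one_plus_sum_le_prod) auto
  moreover have "(\<Prod>b\<in>Basis. 1 + (x \<bullet> b)\<^sup>2) = inverse (decay x)"
    by (simp add: decay_eq)
  ultimately show ?thesis using decay_pos[of x] by (simp add: field_simps)
qed

lemma decay_norm: "decay x * (1 + norm x) \<le> 2"
proof -
  have "1 + norm x \<le> 2 * (1 + (norm x)\<^sup>2)"
    using sum_squares_ge_zero[of "norm x - 1/4" 0] zero_le_power2[of "norm x - 1/4"]
    by (simp add: power2_eq_square algebra_simps)
  then have "decay x * (1 + norm x) \<le> decay x * (2 * (1 + (norm x)\<^sup>2))"
    by (intro mult_left_mono decay_nonneg)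
  also have "\<dots> = 2 * (decay x * (1 + (norm x)\<^sup>2))" by simp
  also have "\<dots> \<le> 2" using decay_norm_sq[of x] by simp
  finally show ?thesis .
qed

subsection \<open>Oscillatory integrals\<close>

definition osc :: "'a::euclidean_space \<Rightarrow> 'a \<Rightarrow> complex" where
  "osc w y = exp (\<i> * complex_of_real (w \<bullet> y))"

lemma cmod_osc [simp]: "cmod (osc w y) = 1"
  unfolding osc_def by (simp add: norm_exp_i_times)

lemma osc_add: "osc (v + w) y = osc v y * osc w y"   and osc_commute: "osc v w = osc w v" and osc_zero [simp]: "osc 0 y = 1"
  and osc_scaleR: "osc (c *\<^sub>R v) w = osc v (c *\<^sub>R w)"
  and osc_minus: "osc (- v) w = osc v (- w)"
  unfolding osc_def by (simp_all add: inner_add_left inner_add_right exp_add[symmetric] distrib_left inner_commute)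

lemma osc_continuous [continuous_intros]:
  "continuous_on S f \<Longrightarrow> continuous_on S g \<Longrightarrow> continuous_on S (\<lambda>x. osc (f x) (g x))"
  unfolding osc_def by (intro continuous_intros)

lemma osc_has_derivative:
  "((\<lambda>y. osc w y) has_derivative (\<lambda>v. osc w y * (\<i> * complex_of_real (w \<bullet> v)))) (at y)"
proof -
  have "((\<lambda>y. \<i> * complex_of_real (w \<bullet> y)) has_derivative (\<lambda>v. \<i> * complex_of_real (w \<bullet> v))) (at y)"
    by (auto intro!: derivative_eq_intros)
  from has_derivative_compose[OF this DERIV_exp[unfolded has_field_derivative_def]]
  show ?thesis unfolding osc_def by simp
qed

text \<open>\<open>1 - dd v\<close> is the formal transpose of \<open>1 + dd v\<close>, which
  multiplies \<open>osc w\<close> by \<open>1 + \<i> (w \<bullet> v)\<close>. Unlike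
  \<open>w \<bullet> v\<close>, this factor never vanishes, so one may divide by it at every
  frequency.\<close>

primrec dops :: "'a list \<Rightarrow> ('a::euclidean_space \<Rightarrow> complex) \<Rightarrow> 'a \<Rightarrow> complex" where
  "dops [] f = f"
| "dops (v # vs) f = dops vs (\<lambda>z. f z - dd v f z)"

lemma symb_minus_dd:
  assumes "symb (Suc k) I w m f" "v \<in> Basis" and W: "\<And>i z. w i v z \<le> W i z" "\<And>i z. 1 \<le> W i z"
    and m: "\<And>i z. 0 \<le> m i z" and wpos: "\<And>i v z. 0 \<le> w i v z"
  shows "symb k I w (\<lambda>i z. m i z * W i z) (\<lambda>i z. f i z - dd v (f i) z)"
proof -
  have "symb k I w (\<lambda>i z. m i z * W i z) f"
    by (rule symb_mono[OF symb_Suc_imp[OF assms(1)], of 1])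
      (use mult_left_mono[OF W(2) m] wpos in auto)
  moreover have "symb k I w (\<lambda>i z. m i z * W i z) (\<lambda>i z. -1 * dd v (f i) z)"
  proof (rule symb_mono[OF symb_scale[OF symb_dd[OF assms(1,2)]], of 1])
    show "cmod (- 1) * (m i z * w i v z) \<le> 1 * (m i z * W i z)" for i z
      using mult_left_mono[OF W(1) m] by simp
  qed (use m wpos in auto)
  ultimately have "symb k I w (\<lambda>i z. m i z * W i z) (\<lambda>i z. f i z + -1 * dd v (f i) z)"
    by (rule symb_add)
  then show ?thesis by simp
qed

text \<open>\<open>W\<close> dominates the weights of all listed directions and, being at least 1,
  also the undifferentiated terms. The cost therefore depends on the list only through its
  length.\<close>

lemma symb_dops:
  assumes "symb (length vs + k) I w m f" "set vs \<subseteq> Basis"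
    and W: "\<And>i v z. v \<in> set vs \<Longrightarrow> w i v z \<le> W i z" "\<And>i z. 1 \<le> W i z"
    and "\<And>i z. 0 \<le> m i z" and wpos: "\<And>i v z. 0 \<le> w i v z"
  shows "symb k I w (\<lambda>i z. m i z * W i z ^ length vs) (\<lambda>i. dops vs (f i))"
  using assms(1-3,5)
proof (induction vs arbitrary: m f)
  case Nil
  then show ?case by simp
next
  case (Cons v vs)
  have "symb (length vs + k) I w (\<lambda>i z. m i z * W i z) (\<lambda>i z. f i z - dd v (f i) z)"
    using Cons.prems by (intro symb_minus_dd) (auto intro: W wpos)
  then have "symb k I w (\<lambda>i z. m i z * W i z * W i z ^ length vs) (\<lambda>i. dops vs (\<lambda>z. f i z - dd v (f i) z))"
    by (rule Cons.IH) (use Cons.prems W(2) in \<open>auto intro!: mult_nonneg_nonneg intro: order_trans[of 0 1]\<close>)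
  then show ?case by (simp add: mult.assoc)
qed

lemma symb_integrable:
  assumes "symb (Suc k) I w m f" "i \<in> I" "integrable lborel (m i)"
  shows "integrable lborel (f i)"
proof -
  obtain C where C: "C \<ge> 0" "\<And>i z. i \<in> I \<Longrightarrow> cmod (f i z) \<le> C * m i z"
    by (rule bdd_byE[OF symb_bound[OF assms(1)]]) (rule that)
  show ?thesis
    by (rule integrable_bound_cont[OF _ symb_continuous_on[OF assms(1,2)] C(2)[OF assms(2)]])
      (use assms(3) in simp)
qed

lemma osc_integrable:
  assumes "continuous_on UNIV f" "integrable lborel f"
  shows "integrable lborel (\<lambda>y. osc w y * f y)"
  by (rule integrable_bound_cont[OF integrable_norm[OF assms(2)]])
    (auto intro!: continuous_intros assms(1) simp: norm_mult)

lemma osc_ibp_step: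
  assumes "symb (Suc (Suc k)) I (\<lambda>_ _ _. 1) m f" "i \<in> I" "integrable lborel (m i)" "v \<in> Basis"
  shows "(1 + \<i> * complex_of_real (w \<bullet> v)) * (LINT y|lborel. osc w y * f i y) =
    (LINT y|lborel. osc w y * (f i y - dd v (f i) y))"
proof -
  let ?F = "\<lambda>y. osc w y * f i y" and ?G = "\<lambda>y. osc w y * dd v (f i) y"
  have df: "symb (Suc k) I (\<lambda>_ _ _. 1) m (\<lambda>i. dd v (f i))" using symb_dd[OF assms(1,4)] by simp
  have cf: "continuous_on UNIV (f i)" and cdf: "continuous_on UNIV (dd v (f i))"
    using symb_continuous_on[OF assms(1,2)] symb_continuous_on[OF df assms(2)] by auto
  have F: "integrable lborel ?F"
    by (rule osc_integrable[OF cf symb_integrable[OF assms(1-3)]])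
  have G: "integrable lborel ?G"
    by (rule osc_integrable[OF cdf symb_integrable[OF df assms(2,3)]])
  have der: "(?F has_derivative (\<lambda>h. osc w y * dd h (f i) y + (osc w y * (\<i> * complex_of_real (w \<bullet> h))) * f i y)) (at y)" for y
    by (intro has_derivative_mult osc_has_derivative dd_works symb_differentiable[OF assms(1,2)])
  have eq: "dd v ?F = (\<lambda>y. ?G y + (\<i> * complex_of_real (w \<bullet> v)) * ?F y)"
    by (rule ext, subst dd_eqI[OF der]) (simp add: mult_ac)
  have "(LINT y|lborel. dd v ?F y) = 0"
  proof (rule integral_dd_eq_0[OF differentiableI_der[OF der] _ F])
    show "continuous_on UNIV (dd v ?F)" unfolding eq by (intro continuous_intros cf cdf)
    show "integrable lborel (dd v ?F)" unfolding eq using F G by simp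
  qed
  then have "(LINT y|lborel. ?G y) + (\<i> * complex_of_real (w \<bullet> v)) * (LINT y|lborel. ?F y) = 0"
    unfolding eq using F G by simp
  moreover have "(LINT y|lborel. osc w y * (f i y - dd v (f i) y)) = (LINT y|lborel. ?F y) - (LINT y|lborel. ?G y)"
    using F G by (simp add: right_diff_distrib)
  ultimately show ?thesis by (simp add: algebra_simps add_eq_0_iff)
qed

lemma osc_ibp:
  assumes "symb (Suc (length vs)) I (\<lambda>_ _ _. 1) m f" "i \<in> I" "integrable lborel (m i)" "set vs \<subseteq> Basis"
    and m: "\<And>i z. 0 \<le> m i z"
  shows "prod_list (map (\<lambda>v. 1 + \<i> * complex_of_real (w \<bullet> v)) vs) * (LINT y|lborel. osc w y * f i y) =
    (LINT y|lborel. osc w y * dops vs (f i) y)"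
  using assms(1,4)
proof (induction vs arbitrary: f)
  case (Cons v vs)
  have s: "symb (Suc (Suc (length vs))) I (\<lambda>_ _ _. 1) m f" and v: "v \<in> Basis" using Cons.prems by simp_all
  have "symb (Suc (length vs)) I (\<lambda>_ _ _. 1) (\<lambda>i z. m i z * 1) (\<lambda>i z. f i z - dd v (f i) z)"
    by (rule symb_minus_dd[OF s v]) (auto intro: m)
  then have s': "symb (Suc (length vs)) I (\<lambda>_ _ _. 1) m (\<lambda>i z. f i z - dd v (f i) z)" by simp
  from Cons.IH[OF s'] Cons.prems
  show ?case by (simp add: osc_ibp_step[OF s assms(2,3) v, symmetric] mult_ac)
qed simp

text \<open>An arbitrary enumeration of the basis, repeated \<open>2 * L\<close> times: the modulus
  of \<open>1 + \<i> s\<close> is the square root of \<open>1 + s\<^sup>2\<close>, and the doubling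
  turns the total factor into the power \<open>L\<close> of \<open>1 / decay\<close>.\<close>

definition dirs :: "nat \<Rightarrow> 'a::euclidean_space list" where
  "dirs L = concat (replicate (2 * L) (SOME bs. distinct bs \<and> set bs = Basis))"

definition pfac :: "nat \<Rightarrow> 'a::euclidean_space \<Rightarrow> complex" where
  "pfac L w = prod_list (map (\<lambda>v. 1 + \<i> * complex_of_real (w \<bullet> v)) (dirs L))"

lemma set_dirs: "set (dirs L :: 'a::euclidean_space list) \<subseteq> Basis"
  and pfac_eq: "pfac L (w :: 'a) = (\<Prod>b\<in>Basis. 1 + \<i> * complex_of_real (w \<bullet> b)) ^ (2 * L)"
proof -
  define bs :: "'a list" where "bs = (SOME bs. distinct bs \<and> set bs = Basis)"
  have "\<exists>bs :: 'a list. distinct bs \<and> set bs = Basis"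
    using finite_distinct_list[OF finite_Basis] by blast
  then have bs: "distinct bs" "set bs = Basis"
    unfolding bs_def by (metis (mono_tags, lifting) someI_ex)+
  have d: "dirs L = concat (replicate (2 * L) bs)" for L by (simp add: dirs_def bs_def)
  show "set (dirs L :: 'a list) \<subseteq> Basis" using bs by (auto simp: d)
  have "prod_list (map f (concat (replicate n bs))) = prod_list (map f bs) ^ n" for f :: "'a \<Rightarrow> complex" and n
    by (induction n) simp_all
  then show "pfac L w = (\<Prod>b\<in>Basis. 1 + \<i> * complex_of_real (w \<bullet> b)) ^ (2 * L)"
    using prod.distinct_set_conv_list[OF bs(1), of "\<lambda>b. 1 + \<i> * complex_of_real (w \<bullet> b)"]
    by (simp add: pfac_def d bs(2))
qed

lemma cmod_pfac: "cmod (pfac L w) = inverse (decay w) ^ L"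
proof -
  have "(cmod (1 + \<i> * complex_of_real a))\<^sup>2 = 1 + a\<^sup>2" for a
    by (simp add: cmod_power2)
  then have "cmod (pfac L w) = (\<Prod>b\<in>Basis. 1 + (w \<bullet> b)\<^sup>2) ^ L"
    by (simp add: pfac_eq norm_power prod_norm[symmetric] power_mult prod_power_distrib)
  then show ?thesis by (simp add: decay_eq)
qed

lemma pfac_neq_0: "pfac L w \<noteq> 0"
  using cmod_pfac[of L w] decay_pos[of w] by auto

lemma osc_ibp_pfac:
  assumes "symb (Suc (length (dirs L :: 'a list))) I (\<lambda>_ _ _. 1) m f" "i \<in> I" "integrable lborel (m i)"
    and "\<And>i z. 0 \<le> m i z"
  shows "(LINT y|lborel. osc w y * f i y) = inverse (pfac L w) * (LINT y|lborel. osc w y * dops (dirs L) (f i) (y::'a::euclidean_space))"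
  unfolding osc_ibp[OF assms(1-3) set_dirs assms(4), symmetric] pfac_def[symmetric]
  using pfac_neq_0[of L w] by simp

text \<open>Rapid decay of Fourier transforms, uniformly over a family. \<open>L\<close> is
  arbitrary because derivatives of every order are controlled by the same majorant
  \<open>m\<close>.\<close>

lemma osc_bound:
  fixes f :: "'i \<Rightarrow> 'a::euclidean_space \<Rightarrow> complex"
  assumes f: "\<And>k. symb k I (\<lambda>_ _ _. 1) m f" and m: "\<And>i z. 0 \<le> m i z" "\<And>i. i \<in> I \<Longrightarrow> integrable lborel (m i)"
  shows "\<exists>C\<ge>0. \<forall>i\<in>I. \<forall>w. cmod (LINT y|lborel. osc w y * f i y) \<le> C * (decay w ^ L * (LINT y|lborel. m i y))"
proof -
  have "symb 0 I (\<lambda>_ _ _. 1) (\<lambda>i z. m i z * 1 ^ length (dirs L :: 'a list)) (\<lambda>i. dops (dirs L) (f i))"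
    by (rule symb_dops[OF f set_dirs]) (use m in auto)
  then have "bdd_by I m (\<lambda>i. dops (dirs L) (f i))" by simp
  then obtain C where C: "C \<ge> 0" "\<And>i z. i \<in> I \<Longrightarrow> cmod (dops (dirs L) (f i) z) \<le> C * m i z"
    by (rule bdd_byE) (rule that)
  show ?thesis
  proof (intro exI[of _ C] conjI ballI allI)
    fix i w assume i: "i \<in> I"
    have "cmod (LINT y|lborel. osc w y * dops (dirs L) (f i) y) \<le> (LINT y|lborel. C * m i y)"
      by (rule integral_cmod_bound) (use C(2)[OF i] m(2)[OF i] in \<open>auto simp: norm_mult\<close>)
    then have "decay w ^ L * cmod (LINT y|lborel. osc w y * dops (dirs L) (f i) y) \<le> decay w ^ L * (C * (LINT y|lborel. m i y))"
      by (intro mult_left_mono) (auto simp: decay_nonneg)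
    then show "cmod (LINT y|lborel. osc w y * f i y) \<le> C * (decay w ^ L * (LINT y|lborel. m i y))"
      unfolding osc_ibp_pfac[OF f i m(2)[OF i] m(1), of w L] norm_mult norm_inverse cmod_pfac
      by (simp add: power_inverse mult_ac)
  qed (rule C(1))
qed

subsection \<open>Fourier inversion\<close>

definition gauss :: "'a::euclidean_space \<Rightarrow> real" where
  "gauss x = exp (- (norm x)\<^sup>2 / 2)"

lemma gauss_eq_prod: "gauss x = (\<Prod>b\<in>Basis. exp (- (x \<bullet> b)\<^sup>2 / 2))"
  unfolding gauss_def norm_sq_eq_sum by (simp add: exp_sum[symmetric] sum_negf sum_divide_distrib)

lemma gauss_continuous [continuous_intros]: "continuous_on S f \<Longrightarrow> continuous_on S (\<lambda>x. gauss (f x))"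
  unfolding gauss_def by (intro continuous_intros) auto

lemma gauss_nonneg: "0 \<le> gauss x" and gauss_le_1: "gauss x \<le> 1" and gauss_0 [simp]: "gauss 0 = 1"
  by (simp_all add: gauss_def)

text \<open>Read off from the characteristic function of the standard normal distribution.\<close>

lemma fourier_gauss_real:
  "integrable lborel (\<lambda>s::real. exp (\<i> * complex_of_real (a * s)) * complex_of_real (exp (- s\<^sup>2 / 2)))"
  "(LINT s|lborel. exp (\<i> * complex_of_real (a * s)) * complex_of_real (exp (- s\<^sup>2 / 2))) =
    complex_of_real (sqrt (2 * pi)) * complex_of_real (exp (- a\<^sup>2 / 2))"
proof -
  let ?f = "\<lambda>s::real. exp (\<i> * complex_of_real (a * s)) * complex_of_real (exp (- s\<^sup>2 / 2))"
  have eq: "std_normal_density s *\<^sub>R exp (\<i> * complex_of_real (a * s)) = complex_of_real (1 / sqrt (2 * pi)) * ?f s" for s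
    by (simp add: std_normal_density_def scaleR_conv_of_real mult_ac)
  interpret real_distribution std_normal_distribution by (rule real_dist_normal_dist)
  have "integrable std_normal_distribution (\<lambda>s. exp (\<i> * complex_of_real (a * s)))"
    by (rule integrable_iexp) auto
  then have "integrable lborel (\<lambda>s. std_normal_density s *\<^sub>R exp (\<i> * complex_of_real (a * s)))"
    by (subst (asm) integrable_density) auto
  from integrable_mult_right[OF this[unfolded eq], of "complex_of_real (sqrt (2 * pi))"]
  show "integrable lborel ?f" by (simp add: mult.assoc[symmetric] of_real_mult[symmetric] del: of_real_mult)
  have "char std_normal_distribution a = (LINT s|lborel. std_normal_density s *\<^sub>R exp (\<i> * complex_of_real (a * s)))"
    unfolding char_def by (subst integral_density) auto
  then have "complex_of_real (exp (- a\<^sup>2 / 2)) = complex_of_real (1 / sqrt (2 * pi)) * (LINT s|lborel. ?f s)"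
    unfolding char_std_normal_distribution eq by simp
  then show "(LINT s|lborel. ?f s) = complex_of_real (sqrt (2 * pi)) * complex_of_real (exp (- a\<^sup>2 / 2))"
    by (simp add: field_simps)
qed

lemma fourier_gauss:
  fixes w :: "'a::euclidean_space"
  shows "integrable lborel (\<lambda>x. osc w x * complex_of_real (gauss x))"
    and "(LINT x|lborel. osc w x * complex_of_real (gauss x)) =
      complex_of_real (sqrt (2 * pi) ^ DIM('a) * gauss w)"
proof -
  have eq: "osc w x * complex_of_real (gauss x) =
      (\<Prod>b\<in>Basis. exp (\<i> * complex_of_real ((w \<bullet> b) * (x \<bullet> b))) * complex_of_real (exp (- (x \<bullet> b)\<^sup>2 / 2)))" for x
    unfolding osc_def gauss_eq_prod by (subst euclidean_inner) (simp add: exp_sum prod.distrib sum_distrib_left)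
  show "integrable lborel (\<lambda>x. osc w x * complex_of_real (gauss x))"
    unfolding eq by (rule integral_lborel_prod(1)) (rule fourier_gauss_real(1))
  show "(LINT x|lborel. osc w x * complex_of_real (gauss x)) = complex_of_real (sqrt (2 * pi) ^ DIM('a) * gauss w)"
    unfolding eq
    by (subst integral_lborel_prod(2)[OF fourier_gauss_real(1)], unfold fourier_gauss_real(2))
      (simp add: prod.distrib gauss_eq_prod)
qed

lemma gauss_integrable: "integrable lborel (gauss :: 'a::euclidean_space \<Rightarrow> real)"
  using integrable_norm[OF fourier_gauss(1)[of "0::'a"]] by (simp add: gauss_nonneg)

text \<open>Gaussian summation: with an additional factor \<open>gauss (c *\<^sub>R \<eta>)\<close>
  the double integral converges absolutely and its \<eta>-integral is explicit. As \<open>c\<close>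
  tends to 0, dominated convergence applies on the frequency side thanks to \<open>B\<close> and on
  the space side thanks to \<open>M\<close>.\<close>

lemma fourier_inversion:
  fixes V :: "'a::euclidean_space \<Rightarrow> complex"
  assumes cont: "continuous_on UNIV V" and A: "integrable lborel A" "\<And>y. cmod (V y) \<le> A y"
    and M: "\<And>y. cmod (V y) \<le> M"
    and B: "integrable lborel B" "\<And>\<eta>. cmod (LINT y|lborel. osc (- \<eta>) y * V y) \<le> B \<eta>"
  shows "(LINT \<eta>|lborel. LINT y|lborel. osc (x - y) \<eta> * V y) = complex_of_real ((2 * pi) ^ DIM('a)) * V x"
proof -
  define s where "s = complex_of_real (sqrt (2 * pi) ^ DIM('a))"
  define H where "H \<eta> = (LINT y|lborel. osc (x - y) \<eta> * V y)" for \<eta>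
  define e where "e k = 1 / real (Suc k)" for k
  have e: "e k > 0" "e \<longlonglongrightarrow> 0" for k
    unfolding e_def using LIMSEQ_inverse_real_of_nat by (simp_all add: inverse_eq_divide)
  have HV: "H \<eta> = osc x \<eta> * (LINT y|lborel. osc (- \<eta>) y * V y)" for \<eta>
  proof -
    have eq: "osc (x - y) \<eta> * V y = osc x \<eta> * (osc (- \<eta>) y * V y)" for y
      using osc_add[of x "- y" \<eta>] by (simp add: osc_commute[of "-y"] osc_minus[of \<eta>])
    show ?thesis unfolding H_def eq by simp
  qed
  have Hb: "cmod (H \<eta>) \<le> B \<eta>" for \<eta> using B(2) by (simp add: HV norm_mult)
  have Hm[measurable]: "H \<in> borel_measurable borel"
  proof -
    have [measurable]: "(\<lambda>(\<eta>, y). osc (x - y) \<eta> * V y) \<in> borel_measurable (borel \<Otimes>\<^sub>M borel)"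
      unfolding borel_prod split_beta'
      by (intro borel_measurable_continuous_onI continuous_intros continuous_on_compose2[OF cont]) auto
    show ?thesis unfolding H_def by measurable
  qed
  have inner: "(LINT \<eta>|lborel. osc (x - y) \<eta> * complex_of_real (gauss (c *\<^sub>R \<eta>))) =
      complex_of_real (inverse c ^ DIM('a)) * s * complex_of_real (gauss ((x - y) /\<^sub>R c))" if "c > 0" for c y
  proof -
    have "(\<lambda>\<eta>. osc (x - y) \<eta> * complex_of_real (gauss (c *\<^sub>R \<eta>))) \<in> borel_measurable borel"
      by (intro borel_measurable_continuous_onI continuous_intros)
    from integral_affine[OF _ this, of "inverse c" 0] that
    show ?thesis using fourier_gauss(2)[of "(x - y) /\<^sub>R c"]
      by (simp add: osc_scaleR[symmetric] s_def scaleR_conv_of_real)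
  qed
  have key: "(LINT \<eta>|lborel. H \<eta> * complex_of_real (gauss (c *\<^sub>R \<eta>))) = s * (LINT z|lborel. V (x - c *\<^sub>R z) * complex_of_real (gauss z))"
    if c: "c > 0" for c
  proof -
    have "(LINT \<eta>|lborel. H \<eta> * complex_of_real (gauss (c *\<^sub>R \<eta>))) =
        (LINT \<eta>|lborel. LINT y|lborel. osc (x - y) \<eta> * V y * complex_of_real (gauss (c *\<^sub>R \<eta>)))"
      unfolding H_def by simp
    also have "\<dots> = (LINT y|lborel. LINT \<eta>|lborel. osc (x - y) \<eta> * V y * complex_of_real (gauss (c *\<^sub>R \<eta>)))"
    proof (rule swap_integrals_majorant)
      show "integrable lborel (\<lambda>\<eta>::'a. gauss (c *\<^sub>R \<eta>))"
        using integrable_affine[OF _ gauss_integrable, of c 0] c by simp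
      show "continuous_on UNIV (\<lambda>(\<eta>, y). osc (x - y) \<eta> * V y * complex_of_real (gauss (c *\<^sub>R \<eta>)))"
        unfolding split_beta' by (intro continuous_intros continuous_on_compose2[OF cont]) auto
      show "cmod (osc (x - y) \<eta> * V y * complex_of_real (gauss (c *\<^sub>R \<eta>))) \<le> gauss (c *\<^sub>R \<eta>) * A y" for \<eta> y
        using mult_right_mono[OF A(2), of "gauss (c *\<^sub>R \<eta>)" y] by (simp add: gauss_nonneg norm_mult mult_ac)
    qed (rule A)
    also have "\<dots> = (LINT y|lborel. V y * (complex_of_real (inverse c ^ DIM('a)) * s * complex_of_real (gauss ((x - y) /\<^sub>R c))))"
      using inner[OF c] by (subst mult.assoc[symmetric]) (simp add: mult_ac)
    also have "\<dots> = s * (LINT z|lborel. V (x - c *\<^sub>R z) * complex_of_real (gauss z))"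
    proof -
      \<comment> \<open>The substitution \<open>y = x - c *\<^sub>R z\<close> brings in a power of
        \<open>c\<close> that cancels the one produced by the inner integral.\<close>
      have "(\<lambda>y. V y * complex_of_real (gauss ((x - y) /\<^sub>R c))) \<in> borel_measurable borel"
        by (intro borel_measurable_continuous_onI continuous_intros cont)
      from integral_affine[OF _ this, of "- c" x] c
      have f: "(LINT y|lborel. V y * complex_of_real (gauss ((x - y) /\<^sub>R c))) =
          complex_of_real (c ^ DIM('a)) * (LINT z|lborel. V (x - c *\<^sub>R z) * complex_of_real (gauss z))"
        by (simp add: scaleR_conv_of_real)
      have e: "V y * (complex_of_real (inverse c ^ DIM('a)) * s * complex_of_real (gauss ((x - y) /\<^sub>R c))) =
          (complex_of_real (inverse c ^ DIM('a)) * s) * (V y * complex_of_real (gauss ((x - y) /\<^sub>R c)))" for y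
        by (simp add: mult_ac)
      show ?thesis unfolding e integral_mult_right_zero f using c
        by (simp add: power_inverse)
    qed
    finally show ?thesis .
  qed
  have "(\<lambda>k. LINT \<eta>|lborel. H \<eta> * complex_of_real (gauss (e k *\<^sub>R \<eta>))) \<longlonglongrightarrow> (LINT \<eta>|lborel. H \<eta>)"
  proof (rule integral_dominated_convergence[where w = B])
    show "AE \<eta> in lborel. (\<lambda>k. H \<eta> * complex_of_real (gauss (e k *\<^sub>R \<eta>))) \<longlonglongrightarrow> H \<eta>"
    proof (rule AE_I2)
      fix \<eta> :: 'a
      have "(\<lambda>k. gauss (e k *\<^sub>R \<eta>)) \<longlonglongrightarrow> gauss (0 *\<^sub>R \<eta>)"
        unfolding gauss_def by (intro tendsto_intros e) auto
      then have "(\<lambda>k. H \<eta> * complex_of_real (gauss (e k *\<^sub>R \<eta>))) \<longlonglongrightarrow> H \<eta> * complex_of_real (gauss (0 *\<^sub>R \<eta>))"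
        by (intro tendsto_intros)
      then show "(\<lambda>k. H \<eta> * complex_of_real (gauss (e k *\<^sub>R \<eta>))) \<longlonglongrightarrow> H \<eta>" by simp
    qed
    show "AE \<eta> in lborel. norm (H \<eta> * complex_of_real (gauss (e k *\<^sub>R \<eta>))) \<le> B \<eta>" for k
    proof (rule AE_I2)
      fix \<eta> :: 'a
      have "cmod (H \<eta>) * gauss (e k *\<^sub>R \<eta>) \<le> cmod (H \<eta>) * 1" by (intro mult_left_mono gauss_le_1) auto
      then show "norm (H \<eta> * complex_of_real (gauss (e k *\<^sub>R \<eta>))) \<le> B \<eta>"
        using Hb[of \<eta>] by (simp add: gauss_nonneg norm_mult)
    qed
    show "(\<lambda>\<eta>. H \<eta> * complex_of_real (gauss (e k *\<^sub>R \<eta>))) \<in> borel_measurable lborel" for k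
      unfolding gauss_def by measurable
  qed (use B in simp_all)
  moreover have "(\<lambda>k. LINT z|lborel. V (x - e k *\<^sub>R z) * complex_of_real (gauss z)) \<longlonglongrightarrow> (LINT z|lborel. V x * complex_of_real (gauss (z::'a)))"
  proof (rule integral_dominated_convergence[where w = "\<lambda>z. M * gauss z"])
    show "AE z in lborel. (\<lambda>k. V (x - e k *\<^sub>R z) * complex_of_real (gauss z)) \<longlonglongrightarrow> V x * complex_of_real (gauss (z::'a))"
    proof (rule AE_I2)
      fix z :: 'a
      have "isCont V x" using cont by (simp add: continuous_on_eq_continuous_at)
      moreover have "(\<lambda>k. x - e k *\<^sub>R z) \<longlonglongrightarrow> x - 0 *\<^sub>R z" by (intro tendsto_intros e)
      ultimately have "(\<lambda>k. V (x - e k *\<^sub>R z)) \<longlonglongrightarrow> V x" using isCont_tendsto_compose by force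
      then show "(\<lambda>k. V (x - e k *\<^sub>R z) * complex_of_real (gauss z)) \<longlonglongrightarrow> V x * complex_of_real (gauss (z::'a))"
        by (intro tendsto_intros)
    qed
    show "AE z in lborel. norm (V (x - e k *\<^sub>R z) * complex_of_real (gauss z)) \<le> M * gauss z" for k
      using M by (intro AE_I2) (auto simp: norm_mult gauss_nonneg intro!: mult_right_mono)
    show "integrable lborel (\<lambda>z::'a. M * gauss z)" by (intro integrable_mult_right gauss_integrable)
    show "(\<lambda>z. V (x - e k *\<^sub>R z) * complex_of_real (gauss z)) \<in> borel_measurable lborel" for k
      by (simp, intro borel_measurable_continuous_onI continuous_intros continuous_on_compose2[OF cont]) auto
    show "(\<lambda>z. V x * complex_of_real (gauss (z::'a))) \<in> borel_measurable lborel"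
      by (simp, intro borel_measurable_continuous_onI continuous_intros)
  qed
  then have "(\<lambda>k. s * (LINT z|lborel. V (x - e k *\<^sub>R z) * complex_of_real (gauss z))) \<longlonglongrightarrow> s * (LINT z|lborel. V x * complex_of_real (gauss (z::'a)))"
    by (intro tendsto_intros)
  ultimately have "(LINT \<eta>|lborel. H \<eta>) = s * (LINT z|lborel. V x * complex_of_real (gauss (z::'a)))"
    unfolding key[OF e(1)] by (rule LIMSEQ_unique)
  \<comment> \<open>One factor \<open>s\<close> stems from the transform of the Gaussian, the other
    is the total mass of the Gaussian.\<close>
  also have "\<dots> = s * (V x * s)"
    using fourier_gauss(2)[of "0 :: 'a"] by (simp add: s_def)
  also have "\<dots> = (s * s) * V x" by (simp only: mult_ac)
  also have "s * s = complex_of_real ((2 * pi) ^ DIM('a))"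
    unfolding s_def of_real_mult[symmetric] power_mult_distrib[symmetric] by simp
  finally show ?thesis unfolding H_def .
qed

subsection \<open>Iterated oscillatory integrals\<close>

lemma dops_eq_0_outside:
  assumes "closed K" "\<And>z. z \<notin> K \<Longrightarrow> f z = 0" "z \<notin> K"
  shows "dops vs f z = 0"
  using assms(2)
proof (induction vs arbitrary: f)
  case Nil
  then show ?case using assms(3) by simp
next
  case (Cons v vs)
  have "f z - dd v f z = 0" if "z \<notin> K" for z
    using dd_eq_0_outside[OF assms(1) Cons.prems that] Cons.prems[OF that] by simp
  from Cons.IH[OF this] show ?case by simp
qed

text \<open>Links integration by parts in \<open>y\<close> at fixed \<eta> with the bounds, which
  are stated for functions of the pair \<open>(y, \<eta>)\<close>.\<close>

lemma dops_slice:
  fixes f :: "'a::euclidean_space \<times> 'b::euclidean_space \<Rightarrow> complex"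
  assumes "symb (length vs) I w m F" "i \<in> I" "set vs \<subseteq> Basis" "f = F i"
    and "\<And>i z. 0 \<le> m i z" and wpos: "\<And>i v z. 0 \<le> w i v z"
  shows "dops vs (\<lambda>y. f (y, \<eta>)) = (\<lambda>y. dops (map (\<lambda>v. (v, 0)) vs) f (y, \<eta>))"
  using assms(1,3,4,5)
proof (induction vs arbitrary: f F m)
  case (Cons v vs)
  have v: "(v, 0) \<in> Basis" using Cons.prems(2) by (simp add: Basis_prod_def)
  have s: "symb (Suc (length vs)) I w m F" using Cons.prems by simp
  have "((\<lambda>y. f (y, \<eta>)) has_derivative (\<lambda>h. dd (h, 0) f (y, \<eta>))) (at y)" for y
  proof -
    have "((\<lambda>y. (y, \<eta>)) has_derivative (\<lambda>h. (h, 0))) (at y)" by (auto intro!: derivative_eq_intros)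
    moreover have "(f has_derivative (\<lambda>h. dd h f (y, \<eta>))) (at (y, \<eta>))"
      using symb_differentiable[OF s assms(2)] Cons.prems(3) by (intro dd_works) simp
    ultimately show ?thesis by (rule has_derivative_compose)
  qed
  then have eq: "dd v (\<lambda>y. f (y, \<eta>)) = (\<lambda>y. dd (v, 0) f (y, \<eta>))" by (intro ext dd_eqI)
  have "symb (length vs) I w (\<lambda>i z. m i z * (1 + w i (v, 0) z)) (\<lambda>i z. F i z - dd (v, 0) (F i) z)"
    by (rule symb_minus_dd[OF s v]) (use Cons.prems wpos in auto)
  then have "dops vs (\<lambda>y. f (y, \<eta>) - dd (v, 0) f (y, \<eta>)) =
      (\<lambda>y. dops (map (\<lambda>v. (v, 0)) vs) (\<lambda>z. f z - dd (v, 0) f z) (y, \<eta>))"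
    by (rule Cons.IH) (use Cons.prems wpos in auto)
  then show ?case by (simp add: eq)
qed simp

text \<open>Weights are harmless wherever they are bounded on the set on which the majorant
  \<open>m\<close> lives, for instance if \<open>m\<close> contains the indicator of a ball: each
  weight is absorbed into \<open>D\<close>.\<close>

lemma symb_weight_one:
  assumes "symb k I w m f" "D \<ge> 0" "\<And>i v z. i \<in> I \<Longrightarrow> v \<in> Basis \<Longrightarrow> m i z * w i v z \<le> D * m i z"
    and wpos: "\<And>i v z. 0 \<le> w i v z"
  shows "symb k I (\<lambda>_ _ _. 1) m f"
  using assms(1)
proof (induction k arbitrary: f)
  case (Suc k)
  show ?case
  proof (rule symb_SucI[OF symb_bound[OF Suc.prems] symb_differentiable[OF Suc.prems]])
    show "symb k I (\<lambda>_ _ _. 1) (\<lambda>i z. m i z * 1) (\<lambda>i. dd v (f i))" if v: "v \<in> Basis" for v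
      using Suc.IH[OF symb_mono[OF symb_dd[OF Suc.prems v] assms(2,3) wpos]] v by simp
  qed
qed simp

lemma symb_power:
  assumes "symb k I w m f" "\<And>i z. 0 \<le> m i z" "\<And>i v z. 0 \<le> w i v z"
  shows "symb k I w (\<lambda>i z. m i z ^ n) (\<lambda>i z. f i z ^ n)"
proof (induction n)
  case 0
  then show ?case using assms(3) by (auto intro!: symb_const[where C = 1])
next
  case (Suc n)
  show ?case unfolding power_Suc by (rule symb_mult[OF assms(1) Suc]) (use assms in auto)
qed

text \<open>A derivative of \<open>1 / (1 + \<i> (l \<bullet> z))\<close> is a constant times the
  square of this function, so differentiation never loses decay.\<close>

lemma symb_inverse_linear:
  fixes l :: "'a::euclidean_space"
  assumes w1: "\<And>i v z. 1 \<le> w i v z"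
  shows "symb k I w (\<lambda>_ z. inverse (sqrt (1 + (l \<bullet> z)\<^sup>2))) (\<lambda>_ z. inverse (1 + \<i> * complex_of_real (l \<bullet> z)))"
proof (induction k)
  let ?f = "\<lambda>z. inverse (1 + \<i> * complex_of_real (l \<bullet> z))"
    and ?m = "\<lambda>z. inverse (sqrt (1 + (l \<bullet> z)\<^sup>2))"
  have cm: "cmod (?f z) = ?m z" for z
  proof -
    have "cmod (1 + \<i> * complex_of_real a) = sqrt (1 + a\<^sup>2)" for a by (simp add: cmod_def)
    then show ?thesis unfolding norm_inverse by simp
  qed
  then have bd: "bdd_by I (\<lambda>_. ?m) (\<lambda>_. ?f)" by (intro bdd_byI[of 1]) auto
  have w0: "0 \<le> w i v z" for i v z using w1[of i v z] by simp
  { case 0 then show ?case using bd by simp }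
  { case (Suc k)
    have nz: "1 + \<i> * complex_of_real a \<noteq> 0" for a by (simp add: complex_eq_iff)
    have der: "(?f has_derivative (\<lambda>h. - (?f z * (\<i> * complex_of_real (l \<bullet> h)) * ?f z))) (at z)" for z
      by (rule Deriv.has_derivative_inverse) (use nz in \<open>auto intro!: derivative_eq_intros\<close>)
    show ?case
    proof (rule symb_SucI[OF bd differentiableI_der[OF der]])
      fix v :: 'a assume v: "v \<in> Basis"
      have "symb k I w (\<lambda>i z. cmod (- (\<i> * complex_of_real (l \<bullet> v))) * (?m z * ?m z))
          (\<lambda>i z. - (\<i> * complex_of_real (l \<bullet> v)) * (?f z * ?f z))"
        by (intro symb_scale symb_mult Suc.IH) (auto simp: w0)
      then have "symb k I w (\<lambda>i z. ?m z * w i v z) (\<lambda>i z. - (\<i> * complex_of_real (l \<bullet> v)) * (?f z * ?f z))"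
      proof (rule symb_mono[where C = "\<bar>l \<bullet> v\<bar>"])
        fix i z
        have "?m z \<le> 1" by (simp add: inverse_le_1_iff)
        then have "?m z \<le> w i v z" using w1[of i v z] by linarith
        then have "?m z * ?m z \<le> ?m z * w i v z" by (intro mult_left_mono) auto
        then show "cmod (- (\<i> * complex_of_real (l \<bullet> v))) * (?m z * ?m z) \<le> \<bar>l \<bullet> v\<bar> * (?m z * w i v z)"
          by (simp add: norm_mult mult_left_mono)
      qed (auto simp: w0)
      then show "symb k I w (\<lambda>i z. ?m z * w i v z) (\<lambda>i. dd v ?f)"
        by (subst symb_cong[OF ext[OF dd_eqI[OF der]]]) (simp add: mult_ac)
    qed }
qed

text \<open>\<open>- snd z\<close> is the frequency of \<open>y\<close> in
  \<open>osc (x - y) \<eta>\<close>. Derivatives in \<eta> keep the decay, so what the integration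
  by parts in \<open>y\<close> has gained survives the one in \<eta>.\<close>

lemma symb_inverse_pfac:
  assumes w1: "\<And>i v z. 1 \<le> w i v z"
  shows "symb k I w (\<lambda>_ z. decay (snd z) ^ L) (\<lambda>_ (z :: 'b::euclidean_space \<times> 'a::euclidean_space). inverse (pfac L (- snd z)))"
proof -
  have w0: "0 \<le> w i v z" for i v z using w1[of i v z] by simp
  let ?l = "\<lambda>b::'a. (0::'b, - b)"
  have "symb k I w (\<lambda>_ z. (\<Prod>b\<in>Basis. inverse (sqrt (1 + (?l b \<bullet> z)\<^sup>2))) ^ (2 * L))
      (\<lambda>_ z. (\<Prod>b\<in>Basis. inverse (1 + \<i> * complex_of_real (?l b \<bullet> z))) ^ (2 * L))"
    using w0 w1 by (intro symb_power symb_prod symb_inverse_linear) (auto intro!: prod_nonneg)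
  moreover have "(\<Prod>b\<in>Basis. inverse (sqrt (1 + (?l b \<bullet> z)\<^sup>2))) ^ (2 * L) = decay (snd z) ^ L" for z
  proof -
    have "(\<Prod>b\<in>Basis. inverse (sqrt (1 + (?l b \<bullet> z)\<^sup>2)))\<^sup>2 = decay (snd z)"
      by (simp add: decay_def prod_power_distrib power_inverse inner_prod_def inner_commute)
    then show ?thesis by (simp add: power_mult)
  qed
  moreover have "(\<Prod>b\<in>Basis. inverse (1 + \<i> * complex_of_real (?l b \<bullet> z))) ^ (2 * L) = inverse (pfac L (- snd z))" for z
    by (simp add: pfac_eq inner_prod_def inner_commute prod_inversef[unfolded o_def] power_inverse)
  ultimately show ?thesis by simp
qed

text \<open>
  A derivative of the rescaled oscillating function in \<open>y\<close> costs a factor \<open>1 + \<bar>y\<bar>\<close>, one in \<open>\<eta>\<close>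
  nothing. Since the growth in \<open>y\<close> does not depend on the number of \<open>\<eta>\<close>-derivatives, it can be
  beaten by sufficiently many integrations by parts in \<open>\<eta>\<close>.
\<close>

definition growing :: "'i \<Rightarrow> 'a::euclidean_space \<times> 'a \<Rightarrow> 'a \<times> 'a \<Rightarrow> real" where
  "growing i v z = (if snd v = 0 then 1 + norm (fst z) else 1)"

lemma growing_ge_1: "1 \<le> growing i v z" and growing_nonneg: "0 \<le> growing i v z"
  by (auto simp: growing_def)

lemma integrable_indicator_cball: "integrable lborel (indicator (cball a R) :: 'a::euclidean_space \<Rightarrow> real)"
  using emeasure_bounded_finite[of "cball a R"] by (simp add: integrable_real_indicator)

text \<open>Integrating by parts \<open>n\<close> times in \<open>y\<close> costs
  \<open>(1 + norm y) ^ n\<close> on top of the growth of \<open>A\<close>. Since \<eta>-derivatives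
  add nothing to this, the number of integrations in \<eta> can be chosen afterwards. The integrals
  may be exchanged once the first step has produced decay in \<eta>. \<open>C\<close> does not
  involve the radius of the support, which varies without bound over the families to be
  treated.\<close>

lemma double_osc_bound:
  fixes A :: "'i \<Rightarrow> 'a::euclidean_space \<times> 'a \<Rightarrow> complex"
  assumes A: "\<And>k. symb k I growing (\<lambda>i z. \<mu> i * ((1 + norm (fst z)) * (1 + norm (snd z)))) A"
    and \<mu>: "\<And>i. 0 \<le> \<mu> i"
    and supp: "\<And>i. i \<in> I \<Longrightarrow> \<exists>R. \<forall>y \<eta>. norm y > R \<longrightarrow> A i (y, \<eta>) = 0"
    and x: "\<And>i. i \<in> I \<Longrightarrow> norm (x i) \<le> 1"
  shows "\<exists>C\<ge>0. \<forall>i\<in>I. integrable lborel (\<lambda>\<eta>. LINT y|lborel. osc (x i - y) \<eta> * A i (y, \<eta>)) \<and>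
    cmod (LINT \<eta>|lborel. LINT y|lborel. osc (x i - y) \<eta> * A i (y, \<eta>)) \<le> C * \<mu> i"
proof -
  \<comment> \<open>With exponent 2, one power of \<open>decay\<close> absorbs the growth
    \<open>1 + norm \<eta>\<close> of the amplitude and the other one stays integrable.\<close>
  define D :: "'a list" where "D = dirs 2"
  define n where "n = length D"
  define B0 where "B0 i = dops (map (\<lambda>v. (v, 0)) D) (A i)" for i
  define B where "B i z = inverse (pfac 2 (- snd z)) * B0 i z" for i and z :: "'a \<times> 'a"
  have D: "set D \<subseteq> Basis" unfolding D_def by (rule set_dirs)
  have D': "set (map (\<lambda>v. (v, 0)) D) \<subseteq> (Basis :: ('a \<times> 'a) set)" using D by (auto simp: Basis_prod_def)
  have "symb k I growing (\<lambda>i z. \<mu> i * ((1 + norm (fst z)) * (1 + norm (snd z))) * (1 + norm (fst z)) ^ length (map (\<lambda>v. (v, 0::'a)) D)) B0" for k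
    unfolding B0_def[abs_def]
    by (rule symb_dops[OF A D']) (auto simp: growing_def \<mu>)
  then have B0: "symb k I growing (\<lambda>i z. \<mu> i * ((1 + norm (fst z)) * (1 + norm (snd z))) * (1 + norm (fst z)) ^ n) B0" for k
    by (simp add: n_def)
  define M where "M i z = \<mu> i * (1 + norm (fst z)) ^ Suc n * decay (snd z)" for i and z :: "'a \<times> 'a"
  have B: "symb k I growing M B" for k
  proof -
    have "symb k I growing (\<lambda>i z. decay (snd z) ^ 2 * (\<mu> i * ((1 + norm (fst z)) * (1 + norm (snd z))) * (1 + norm (fst z)) ^ n)) B"
      unfolding B_def[abs_def]
      by (intro symb_mult symb_inverse_pfac B0 growing_ge_1 growing_nonneg) (auto simp: \<mu> decay_nonneg)
    then show ?thesis
    proof (rule symb_mono[where C = 2])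
      fix i and z :: "'a \<times> 'a"
      have "(decay (snd z) * (1 + norm (snd z))) * (\<mu> i * (1 + norm (fst z)) ^ Suc n * decay (snd z))
          \<le> 2 * (\<mu> i * (1 + norm (fst z)) ^ Suc n * decay (snd z))"
        by (intro mult_right_mono decay_norm mult_nonneg_nonneg) (auto simp: \<mu> decay_nonneg)
      then show "(decay (snd z))\<^sup>2 * (\<mu> i * ((1 + norm (fst z)) * (1 + norm (snd z))) * (1 + norm (fst z)) ^ n) \<le> 2 * M i z"
        by (simp add: M_def power2_eq_square mult_ac)
    qed (auto simp: growing_nonneg)
  qed
  have M0: "0 \<le> M i z" for i z by (simp add: M_def \<mu> decay_nonneg)
  \<comment> \<open>Here \<open>y\<close> joins the index: for the integral in \<eta> it is a
    parameter, and the estimate has to be uniform in it.\<close>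
  have slice: "symb k (I \<times> UNIV) (\<lambda>_ _ _. 1) (\<lambda>j \<eta>. M (fst j) (snd j, \<eta>)) (\<lambda>j \<eta>. B (fst j) (snd j, \<eta>))" for k
  proof (rule symb_affine[where L = "\<lambda>_ v. (0, v)" and D = 1])
    show "symb k (I \<times> UNIV) (\<lambda>j. growing (fst j)) (\<lambda>j. M (fst j)) (\<lambda>j. B (fst j))"
      by (rule symb_reindex[OF B]) auto
    show "\<bar>(0, v) \<bullet> e\<bar> * growing (fst j) e (snd j, z) \<le> 1 * 1"
      if "v \<in> Basis" "e \<in> Basis" for j :: "'i \<times> 'a" and v :: 'a and e :: "'a \<times> 'a" and z
      using that inner_Basis[of v "snd e"] by (auto simp: Basis_prod_def growing_def inner_Basis)
  qed (auto intro!: derivative_eq_intros simp: M0 growing_nonneg)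
  \<comment> \<open>\<open>n + 1\<close> of these powers are spent on
    \<open>(1 + norm y) ^ Suc n\<close>; the remaining one makes the bound integrable in
    \<open>y\<close>.\<close>
  have "\<exists>C\<ge>0. \<forall>j\<in>I \<times> UNIV. \<forall>w. cmod (LINT \<eta>|lborel. osc w \<eta> * B (fst j) (snd j, \<eta>))
      \<le> C * (decay w ^ (n + 2) * (LINT \<eta>|lborel. M (fst j) (snd j, \<eta>)))"
    by (rule osc_bound[OF slice M0]) (simp add: M_def decay_integrable)
  then obtain C where C: "C \<ge> 0" and Cb: "\<And>i y w. i \<in> I \<Longrightarrow> cmod (LINT \<eta>|lborel. osc w \<eta> * B i (y, \<eta>))
      \<le> C * (decay w ^ (n + 2) * (LINT \<eta>|lborel. M i (y, \<eta>)))"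
    by fastforce
  define c where "c = (LINT \<eta>|lborel. decay (\<eta>::'a))"
  have c: "c \<ge> 0" unfolding c_def by (simp add: decay_nonneg)
  \<comment> \<open>Since \<open>norm (x i) \<le> 1\<close>, the point \<open>x i\<close> may
    replace the origin: \<open>1 + norm y\<close> is at most twice
    \<open>1 + norm (x i - y)\<close>.\<close>
  have yb: "cmod (LINT \<eta>|lborel. osc (x i - y) \<eta> * B i (y, \<eta>)) \<le> C * \<mu> i * c * 4 ^ Suc n * decay (x i - y)"
    if i: "i \<in> I" for i y
  proof -
    have "norm y \<le> norm (x i) + norm (x i - y)" using norm_triangle_sub[of y "x i"] by (simp add: norm_minus_commute)
    then have "1 + norm y \<le> 1 + (1 + norm (x i - y))" using x[OF i] by simp
    also have "\<dots> \<le> 2 * (1 + norm (x i - y))" by simp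
    finally have "1 + norm y \<le> 2 * (1 + norm (x i - y))" .
    then have "decay (x i - y) * (1 + norm y) \<le> decay (x i - y) * (2 * (1 + norm (x i - y)))"
      by (intro mult_left_mono decay_nonneg)
    also have "\<dots> = 2 * (decay (x i - y) * (1 + norm (x i - y)))" by simp
    also have "\<dots> \<le> 4" using decay_norm[of "x i - y"] by simp
    finally have "(decay (x i - y) * (1 + norm y)) ^ Suc n \<le> 4 ^ Suc n"
      by (intro power_mono) (auto simp: decay_nonneg)
    then have "C * \<mu> i * c * decay (x i - y) * (decay (x i - y) * (1 + norm y)) ^ Suc n \<le> C * \<mu> i * c * decay (x i - y) * 4 ^ Suc n"
      by (intro mult_left_mono) (auto simp: C \<mu> c decay_nonneg)
    moreover have "(LINT \<eta>|lborel. M i (y, \<eta>)) = \<mu> i * (1 + norm y) ^ Suc n * c"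
      by (simp add: M_def c_def)
    ultimately show ?thesis using Cb[OF i, of "x i - y" y] by (simp add: power_mult_distrib mult_ac)
  qed
  show ?thesis
  proof (intro exI[of _ "C * c * 4 ^ Suc n * c"] conjI ballI)
    fix i assume i: "i \<in> I"
    obtain R0 where R0: "\<And>y \<eta>. norm y > R0 \<Longrightarrow> A i (y, \<eta>) = 0" using supp[OF i] by blast
    define R where "R = max R0 0"
    have R: "R \<ge> 0" "\<And>y \<eta>. norm y > R \<Longrightarrow> A i (y, \<eta>) = 0" using R0 by (auto simp: R_def)
    have B0z: "B0 i (y, \<eta>) = 0" if "norm y > R" for y \<eta>
      unfolding B0_def
    proof (rule dops_eq_0_outside[of "cball 0 R \<times> UNIV"])
      show "closed (cball 0 R \<times> (UNIV :: 'a set))" by (intro closed_Times closed_cball closed_UNIV)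
      show "A i z = 0" if "z \<notin> cball 0 R \<times> UNIV" for z
        using that R(2)[of "fst z" "snd z"] by (cases z) auto
    qed (use that in simp)
    \<comment> \<open>Now \<eta> is the index and \<open>R\<close> may enter: this bound only
      justifies the integration by parts in \<open>y\<close> and leaves no trace in the final
      constant.\<close>
    have As: "symb k (UNIV :: 'a set) (\<lambda>_ _ _. 1) (\<lambda>\<eta> y. \<mu> i * (1 + norm \<eta>) * (1 + R) * indicator (cball 0 R) y) (\<lambda>\<eta> y. A i (y, \<eta>))" for k
    proof -
      have "symb k (UNIV :: 'a set) (\<lambda>_ _ y. 1 + norm y) (\<lambda>\<eta> y. \<mu> i * ((1 + norm (fst (y, \<eta>))) * (1 + norm (snd (y, \<eta>))))) (\<lambda>\<eta> y. A i (y, \<eta>))"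
      proof (rule symb_affine[where L = "\<lambda>_ v. (v, 0)" and D = 1 and w = "\<lambda>_. growing i"])
        show "symb k (UNIV :: 'a set) (\<lambda>_. growing i) (\<lambda>_ z. \<mu> i * ((1 + norm (fst z)) * (1 + norm (snd z)))) (\<lambda>_. A i)"
          by (rule symb_reindex[OF A, where g = "\<lambda>_. i"]) (use i in auto)
        show "\<bar>(v, 0) \<bullet> e\<bar> * growing i e (y, \<eta>) \<le> 1 * (1 + norm y)"
          if "v \<in> Basis" "e \<in> Basis" for \<eta> and v y :: 'a and e :: "'a \<times> 'a"
          using that by (auto simp: Basis_prod_def growing_def inner_Basis)
      qed (auto intro!: derivative_eq_intros simp: \<mu> growing_nonneg)
      from symb_indicator[OF this, where K = "\<lambda>_. cball 0 R"] R
      have "symb k (UNIV :: 'a set) (\<lambda>_ _ y. 1 + norm y) (\<lambda>\<eta> y. \<mu> i * ((1 + norm y) * (1 + norm \<eta>)) * indicator (cball 0 R) y) (\<lambda>\<eta> y. A i (y, \<eta>))"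
        by auto
      then have "symb k (UNIV :: 'a set) (\<lambda>_ _ y. 1 + norm y) (\<lambda>\<eta> y. \<mu> i * (1 + norm \<eta>) * (1 + R) * indicator (cball 0 R) y) (\<lambda>\<eta> y. A i (y, \<eta>))"
      proof (rule symb_mono[where C = 1])
        fix \<eta> y :: 'a
        have "(1 + norm y) * (\<mu> i * (1 + norm \<eta>)) \<le> (1 + R) * (\<mu> i * (1 + norm \<eta>))" if "norm y \<le> R"
          using that \<mu>[of i] by (intro mult_right_mono) auto
        then show "\<mu> i * ((1 + norm y) * (1 + norm \<eta>)) * indicator (cball 0 R) y
            \<le> 1 * (\<mu> i * (1 + norm \<eta>) * (1 + R) * indicator (cball 0 R) y)"
          by (auto simp: indicator_def mult_ac)
      qed auto
      then show ?thesis
      proof (rule symb_weight_one[where D = "1 + R"])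
        fix \<eta> y :: 'a
        have "(1 + norm y) * (\<mu> i * (1 + norm \<eta>) * (1 + R)) \<le> (1 + R) * (\<mu> i * (1 + norm \<eta>) * (1 + R))" if "norm y \<le> R"
          using that \<mu>[of i] R(1) by (intro mult_right_mono) auto
        then show "\<mu> i * (1 + norm \<eta>) * (1 + R) * indicator (cball 0 R) y * (1 + norm y)
            \<le> (1 + R) * (\<mu> i * (1 + norm \<eta>) * (1 + R) * indicator (cball 0 R) y)"
          by (auto simp: indicator_def mult_ac)
      qed (use R(1) in auto)
    qed
    have inner: "(LINT y|lborel. osc (x i - y) \<eta> * A i (y, \<eta>)) = (LINT y|lborel. osc (x i - y) \<eta> * B i (y, \<eta>))" for \<eta>
    proof -
      have o: "osc (x i - y) \<eta> = osc (x i) \<eta> * osc (- \<eta>) y" for y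
        using osc_add[of "x i" "- y" \<eta>] by (simp add: osc_commute[of "-y"] osc_minus[of \<eta>])
      have "(LINT y|lborel. osc (- \<eta>) y * A i (y, \<eta>)) =
          inverse (pfac 2 (- \<eta>)) * (LINT y|lborel. osc (- \<eta>) y * dops D (\<lambda>y. A i (y, \<eta>)) y)"
        unfolding D_def
        by (rule osc_ibp_pfac[OF As]) (auto simp: R(1) \<mu> intro!: integrable_mult_right integrable_indicator_cball)
      also have "dops D (\<lambda>y. A i (y, \<eta>)) = (\<lambda>y. B0 i (y, \<eta>))"
        unfolding B0_def by (rule dops_slice[OF A i D refl]) (auto simp: \<mu> growing_nonneg)
      finally have fin: "(LINT y|lborel. osc (- \<eta>) y * A i (y, \<eta>)) =
          inverse (pfac 2 (- \<eta>)) * (LINT y|lborel. osc (- \<eta>) y * B0 i (y, \<eta>))" .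
      have "(LINT y|lborel. osc (x i - y) \<eta> * A i (y, \<eta>)) = osc (x i) \<eta> * (LINT y|lborel. osc (- \<eta>) y * A i (y, \<eta>))"
        by (simp add: o mult.assoc)
      moreover have "osc (x i - y) \<eta> * B i (y, \<eta>) =
          (osc (x i) \<eta> * inverse (pfac 2 (- \<eta>))) * (osc (- \<eta>) y * B0 i (y, \<eta>))" for y
        by (simp add: o B_def mult_ac)
      ultimately show ?thesis by (simp add: fin mult.assoc)
    qed
    obtain E where E: "E \<ge> 0" "\<And>z. cmod (B i z) \<le> E * M i z"
      using bdd_byE[OF symb_bound[OF B]] i by metis
    \<comment> \<open>The amplitude \<open>B\<close> decays in \<eta>, and in \<open>y\<close> the
      compact support supplies the integrable factor.\<close>
    have maj: "integrable (lborel \<Otimes>\<^sub>M lborel) (\<lambda>(\<eta>, y). osc (x i - y) \<eta> * B i (y, \<eta>))"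
    proof (rule pair_integrable_majorant)
      show "integrable lborel (\<lambda>\<eta>::'a. decay \<eta>)" by (rule decay_integrable)
      show "integrable lborel (\<lambda>y::'a. E * \<mu> i * (1 + R) ^ Suc n * indicator (cball 0 R) y)"
        by (intro integrable_mult_right integrable_indicator_cball)
      show "continuous_on UNIV (\<lambda>(\<eta>, y). osc (x i - y) \<eta> * B i (y, \<eta>))"
        unfolding split_beta'
        by (intro continuous_intros continuous_on_compose2[OF symb_continuous_on[OF B i]]) auto
      show "cmod (osc (x i - y) \<eta> * B i (y, \<eta>)) \<le> decay \<eta> * (E * \<mu> i * (1 + R) ^ Suc n * indicator (cball 0 R) y)" for \<eta> y
      proof (cases "norm y \<le> R")
        case True
        have "E * M i (y, \<eta>) \<le> E * (\<mu> i * (1 + R) ^ Suc n * decay \<eta>)"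
          unfolding M_def fst_conv snd_conv using True R(1) by (intro mult_left_mono mult_right_mono power_mono) (auto simp: E \<mu> decay_nonneg)
        then show ?thesis using True E(2)[of "(y, \<eta>)"] by (simp add: norm_mult mult_ac)
      next
        case False
        then show ?thesis using B0z by (simp add: B_def)
      qed
    qed
    show "integrable lborel (\<lambda>\<eta>. LINT y|lborel. osc (x i - y) \<eta> * A i (y, \<eta>))"
      unfolding inner using lborel_pair.integrable_fst[OF maj] by simp
    have "(LINT \<eta>|lborel. LINT y|lborel. osc (x i - y) \<eta> * A i (y, \<eta>)) =
        (LINT y|lborel. LINT \<eta>|lborel. osc (x i - y) \<eta> * B i (y, \<eta>))"
      unfolding inner using lborel_pair.Fubini_integral[OF maj] by simp
    also have "cmod \<dots> \<le> (LINT y|lborel. C * \<mu> i * c * 4 ^ Suc n * decay (x i - y))"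
      by (rule integral_cmod_bound[OF _ yb[OF i]]) (intro integrable_mult_right decay_integrable_minus)
    also have "\<dots> = C * c * 4 ^ Suc n * c * \<mu> i"
      by (simp add: decay_integral_minus c_def[symmetric] mult_ac)
    finally show "cmod (LINT \<eta>|lborel. LINT y|lborel. osc (x i - y) \<eta> * A i (y, \<eta>)) \<le> C * c * 4 ^ Suc n * c * \<mu> i" .
  qed (use C c in simp)
qed

subsection \<open>Rescaled symbols\<close>

lemma symb_lipschitz:
  assumes "symb1 (Suc 0) I (f :: 'i \<Rightarrow> 'a::euclidean_space \<Rightarrow> complex)"
  shows "\<exists>C\<ge>0. \<forall>i\<in>I. \<forall>p q. cmod (f i p - f i q) \<le> C * norm (p - q)"
proof -
  have "\<forall>e\<in>Basis. \<exists>C\<ge>0. \<forall>i\<in>I. \<forall>z. cmod (dd e (f i) z) \<le> C"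
    using symb_bound[OF symb_dd[OF assms]] unfolding bdd_by_def by simp
  then obtain C where C: "\<And>e. e \<in> Basis \<Longrightarrow> C e \<ge> 0" "\<And>e i z. e \<in> Basis \<Longrightarrow> i \<in> I \<Longrightarrow> cmod (dd e (f i) z) \<le> C e"
    by metis
  define K where "K = (\<Sum>e\<in>Basis. C e)"
  have K: "K \<ge> 0" unfolding K_def by (intro sum_nonneg C)
  have "cmod (f i p - f i q) \<le> K * norm (p - q)" if i: "i \<in> I" for i p q
  proof (rule differentiable_bound[where S = UNIV and f' = "\<lambda>x v. dd v (f i) x"])
    show "(f i has_derivative (\<lambda>v. dd v (f i) x)) (at x within UNIV)" for x
      by (intro dd_works symb_differentiable[OF assms i])
    show "onorm (\<lambda>v. dd v (f i) x) \<le> K" for x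
    proof (rule onorm_le)
      fix v
      have "cmod (dd v (f i) x) \<le> (\<Sum>e\<in>Basis. \<bar>v \<bullet> e\<bar> * cmod (dd e (f i) x))"
        unfolding dd_expand[OF symb_differentiable[OF assms i], of v x]
        by (rule order_trans[OF norm_sum]) (simp add: norm_mult)
      also have "\<dots> \<le> (\<Sum>e\<in>Basis. norm v * C e)"
        by (intro sum_mono mult_mono C(2) i Basis_le_norm) auto
      finally show "cmod (dd v (f i) x) \<le> K * norm v" by (simp add: K_def sum_distrib_left mult_ac)
    qed
  qed auto
  with K show ?thesis by blast
qed

text \<open>Subtracting the value at 0 gains one factor \<sigma>: for the function itself by the
  Lipschitz bound, at the price of \<open>1 + norm z\<close>, and for its derivatives by the chain
  rule.\<close>

lemma symb_diff_affine:
  fixes f :: "'i \<Rightarrow> 'b::euclidean_space \<Rightarrow> complex" and l :: "'i \<Rightarrow> 'a::euclidean_space \<Rightarrow> 'b"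
  assumes f: "\<And>k. symb1 k I f"
    and l: "\<And>i z. i \<in> I \<Longrightarrow> (l i has_derivative L i) (at z)"
    and ln: "\<And>i z. i \<in> I \<Longrightarrow> norm (l i z - l i 0) \<le> \<sigma> i * norm z"
    and Ls: "\<And>i v e. i \<in> I \<Longrightarrow> v \<in> Basis \<Longrightarrow> e \<in> Basis \<Longrightarrow> \<bar>L i v \<bullet> e\<bar> \<le> \<sigma> i"
    and s: "\<And>i. i \<in> I \<Longrightarrow> \<sigma> i \<le> 1" "\<And>i. 0 \<le> \<sigma> i"
  shows "symb k I (\<lambda>_ _ _. 1) (\<lambda>i z. \<sigma> i * (1 + norm z)) (\<lambda>i z. f i (l i z) - f i (l i 0))"
proof -
  let ?g = "\<lambda>i z. f i (l i z) - f i (l i 0)" and ?m = "\<lambda>i z. \<sigma> i * (1 + norm z)"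
  obtain K where K: "K \<ge> 0" "\<And>i p q. i \<in> I \<Longrightarrow> cmod (f i p - f i q) \<le> K * norm (p - q)"
    using symb_lipschitz[OF f] by blast
  have bd: "bdd_by I ?m ?g"
  proof (rule bdd_byI[OF K(1)])
    fix i z assume i: "i \<in> I"
    have "cmod (?g i z) \<le> K * norm (l i z - l i 0)" by (rule K(2)[OF i])
    also have "\<dots> \<le> K * (\<sigma> i * norm z)" by (intro mult_left_mono ln K i)
    also have "\<dots> \<le> K * ?m i z" by (intro mult_left_mono K s) auto
    finally show "cmod (?g i z) \<le> K * ?m i z" .
  qed
  have fl: "symb k I (\<lambda>i _ _. \<sigma> i) (\<lambda>_ _. 1) (\<lambda>i z. f i (l i z))" for k
    by (rule symb_affine[OF f l, where D = 1]) (use Ls s in auto)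
  have der: "(?g i has_derivative (\<lambda>h. dd h (\<lambda>z. f i (l i z)) z - 0)) (at z)" if "i \<in> I" for i z
    by (intro has_derivative_diff has_derivative_const dd_works symb_differentiable[OF fl that])
  show ?thesis
  proof (cases k)
    case 0
    then show ?thesis using bd by simp
  next
    case (Suc k')
    have "symb k' I (\<lambda>_ _ _. 1) (\<lambda>i z. \<sigma> i * (1 + norm z) * 1) (\<lambda>i. dd v (?g i))" if v: "v \<in> Basis" for v
    proof -
      have "symb k' I (\<lambda>i _ _. \<sigma> i) (\<lambda>i _. \<sigma> i) (\<lambda>i. dd v (\<lambda>z. f i (l i z)))"
        using symb_dd[OF fl v] by simp
      then have "symb k' I (\<lambda>_ _ _. 1) (\<lambda>i _. \<sigma> i) (\<lambda>i. dd v (\<lambda>z. f i (l i z)))"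
        by (rule symb_weight_one[where D = 1]) (use s in \<open>auto intro: mult_left_le\<close>)
      then have "symb k' I (\<lambda>_ _ _. 1) (\<lambda>i z. \<sigma> i * (1 + norm z) * 1) (\<lambda>i. dd v (\<lambda>z. f i (l i z)))"
        by (rule symb_mono[where C = 1]) (use s(2) in \<open>auto simp: distrib_left\<close>)
      then show ?thesis by (subst symb_cong[OF ext[OF dd_eqI[OF der]]]) simp_all
    qed
    then show ?thesis unfolding Suc by (intro symb_SucI[OF bd differentiableI_der[OF der]]) auto
  qed
qed

lemma symb_raise_weight:
  assumes "symb k I (\<lambda>_ _ _. 1) m f" "\<And>i v z. 1 \<le> w i v z" "\<And>i z. 0 \<le> m i z"
  shows "symb k I w m f"
proof -
  have "0 \<le> w i v z" for i v z using assms(2)[of i v z] by simp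
  note w0 = this
  show ?thesis
  \<comment> \<open>Composition with the identity map, because \<open>symb_affine\<close> allows the
    weights to change.\<close>
  proof (rule symb_affine[OF assms(1), where l = "\<lambda>_ z. z" and L = "\<lambda>_ v. v" and D = 1])
    show "\<bar>v \<bullet> e\<bar> * 1 \<le> 1 * w i v z" if "v \<in> Basis" "e \<in> Basis" for i v e z
      using that assms(2)[of i v z] w0[of i v z] by (cases "v = e") (simp_all add: inner_Basis)
  qed (use w0 assms(3) in auto)
qed

subsection \<open>The rescaled oscillating function\<close>

locale wkb =
  fixes b \<phi> :: "real ^ 'n \<Rightarrow> complex" and h0 :: real
  assumes h0: "h0 > 0" and b: "test_function b" and \<phi>: "test_function \<phi>"
    and Im\<phi>: "\<And>x. Im (\<phi> x) \<ge> 0"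
begin

definition u :: "real \<Rightarrow> real ^ 'n \<Rightarrow> complex" where
  "u h x = b x * exp (\<i> / complex_of_real h * \<phi> x)"

lemma supp_b: "b x \<noteq> 0 \<Longrightarrow> x \<in> supp b"
  unfolding supp_def by (rule closure_subset[THEN subsetD]) simp

lemma bsymb: "symb1 k I (\<lambda>_. b)" and \<phi>symb: "symb1 k I (\<lambda>_. \<phi>)"
  using test_function_symb b \<phi> by blast+

lemma phi_der: "(\<phi> has_derivative (\<lambda>v. dd v \<phi> y)) (at y)"
  using symb_differentiable[OF \<phi>symb, of "()" "{()}"] by (intro dd_works) simp

lemma exp_phase_le_1: "h > 0 \<Longrightarrow> cmod (exp (\<i> / complex_of_real h * \<phi> x)) \<le> 1"
  using Im\<phi>[of x] by (simp add: norm_exp_eq_Re)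

text \<open>These bounds depend on \<open>h\<close>, hence the one-point index set. They serve the
  qualitative facts that \<open>u h\<close> is continuous and Schwartz.\<close>

lemma usymb:
  assumes "h > 0"
  shows "symb1 k {()} (\<lambda>_. u h)"
proof -
  have "symb k {()} (\<lambda>_ _ _. 1) (\<lambda>_ z. \<bar>1 / h\<bar> * 1) (\<lambda>_ z. (\<i> / complex_of_real h) * \<phi> z)" for k
    using symb_scale[OF \<phi>symb, where c = "\<lambda>_::unit. \<i> / complex_of_real h"] by (simp add: norm_divide)
  then have E: "symb1 k {()} (\<lambda>_ z. (\<i> / complex_of_real h) * \<phi> z)" for k
    by (rule symb_mono[where C = "\<bar>1 / h\<bar>"]) auto
  have "symb1 (Suc k) {()} (\<lambda>_ z. exp ((\<i> / complex_of_real h) * \<phi> z))" for k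
  proof (rule symb_exp)
    show "symb1 k {()} (\<lambda>_. dd v (\<lambda>z. (\<i> / complex_of_real h) * \<phi> z))" if "v \<in> Basis" for v
      using symb_dd[OF E that] by simp
    show "bdd_by {()} (\<lambda>_ _. 1) (\<lambda>_ z. exp ((\<i> / complex_of_real h) * \<phi> z))"
      by (rule bdd_byI[of 1]) (use exp_phase_le_1[OF assms] in auto)
  qed (use symb_differentiable[OF E] in auto)
  then have "symb1 k {()} (\<lambda>_ z. exp ((\<i> / complex_of_real h) * \<phi> z))"
    using symb_Suc_imp by blast
  from symb_mult[OF bsymb this] show ?thesis unfolding u_def by simp
qed

lemma compact_supp_b: "compact (supp b)" using b by (simp add: test_function_def)

lemma b_vanishes: "\<exists>R. \<forall>y. norm y > R \<longrightarrow> b y = 0"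
  using compact_imp_bounded[OF compact_supp_b] supp_b unfolding bounded_iff by (meson not_le)

lemma u_schwartz: "h > 0 \<Longrightarrow> schwartz (u h)"
  by (rule schwartzI[OF usymb compact_imp_bounded[OF compact_supp_b] compact_imp_closed[OF compact_supp_b]])
    (use supp_b in \<open>auto simp: u_def\<close>)

lemma u_continuous: "h > 0 \<Longrightarrow> continuous_on S (u h)"
  using symb_continuous_on[OF usymb] by blast

end

section \<open>Rescaling at a point of the graph\<close>

locale wkb_point = wkb b \<phi> h0 for b \<phi> :: "real ^ 'n \<Rightarrow> complex" and h0 :: real +
  fixes x0 \<xi>0 :: "real ^ 'n"
  assumes b0: "b x0 \<noteq> 0" and Im0: "Im (\<phi> x0) = 0" and grad0: "complex_vec \<xi>0 = grad \<phi> x0"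
begin

definition K :: "real set" where "K = {\<kappa>. 0 < \<kappa> \<and> \<kappa> < 1 \<and> \<kappa> ^ 3 < h0}"

text \<open>\<open>\<i> / h\<close> times the Taylor remainder of the phase at \<open>x0\<close>, in
  the rescaled variable. The constant and linear terms split off here turn into the unimodular
  factor \<open>E\<close> in \<open>Op_rescale\<close>.\<close>

definition \<psi> :: "real \<Rightarrow> real ^ 'n \<Rightarrow> complex" where
  "\<psi> \<kappa> y = \<i> * (\<phi> (x0 + \<kappa>\<^sup>2 *\<^sub>R y) - \<phi> x0 - complex_of_real (\<kappa>\<^sup>2 * (\<xi>0 \<bullet> y))) / complex_of_real (\<kappa> ^ 3)"

definition v :: "real \<Rightarrow> real ^ 'n \<Rightarrow> complex" where
  "v \<kappa> y = b (x0 + \<kappa>\<^sup>2 *\<^sub>R y) * exp (\<psi> \<kappa> y)"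

lemma dd_phi_x0: "e \<in> Basis \<Longrightarrow> dd e \<phi> x0 = complex_of_real (\<xi>0 \<bullet> e)"
proof -
  assume "e \<in> Basis"
  then obtain j where j: "e = axis j 1" by (auto simp: Basis_vec_def)
  have "complex_vec \<xi>0 $ j = grad \<phi> x0 $ j" using grad0 by simp
  then show ?thesis by (simp add: j complex_vec_def grad_def dd_def inner_axis)
qed

lemma psi_der:
  assumes "\<kappa> \<in> K"
  shows "(\<psi> \<kappa> has_derivative (\<lambda>h. \<i> * (dd (\<kappa>\<^sup>2 *\<^sub>R h) \<phi> (x0 + \<kappa>\<^sup>2 *\<^sub>R y) - 0 - complex_of_real (\<kappa>\<^sup>2 * (\<xi>0 \<bullet> h))) / complex_of_real (\<kappa> ^ 3))) (at y)"
proof -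
  have "((\<lambda>y. x0 + \<kappa>\<^sup>2 *\<^sub>R y) has_derivative (\<lambda>h. \<kappa>\<^sup>2 *\<^sub>R h)) (at y)" by (auto intro!: derivative_eq_intros)
  from has_derivative_compose[OF this phi_der]
  have 1: "((\<lambda>y. \<phi> (x0 + \<kappa>\<^sup>2 *\<^sub>R y)) has_derivative (\<lambda>h. dd (\<kappa>\<^sup>2 *\<^sub>R h) \<phi> (x0 + \<kappa>\<^sup>2 *\<^sub>R y))) (at y)" .
  show ?thesis unfolding \<psi>_def[abs_def] divide_inverse
    by (intro has_derivative_mult_left has_derivative_mult_right has_derivative_diff 1 has_derivative_const has_derivative_of_real)
      (auto intro!: derivative_eq_intros)
qed

text \<open>By the choice of \<open>\<xi>0\<close>, the linear term removed in \<psi> has the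
  derivative of \<phi> at \<open>x0\<close>. What remains is an increment of
  \<open>dd e \<phi>\<close>, the form that \<open>symb_diff_affine\<close> treats.\<close>

lemma dd_psi:
  assumes "\<kappa> \<in> K" "e \<in> Basis"
  shows "dd e (\<psi> \<kappa>) y = (\<i> / complex_of_real \<kappa>) * (dd e \<phi> (x0 + \<kappa>\<^sup>2 *\<^sub>R y) - dd e \<phi> (x0 + \<kappa>\<^sup>2 *\<^sub>R 0))"
proof -
  have "dd (\<kappa>\<^sup>2 *\<^sub>R e) \<phi> x = complex_of_real (\<kappa>\<^sup>2) * dd e \<phi> x" for x
    using linear_scale[OF dd_linear[OF differentiableI_der[OF phi_der]]] by (simp add: scaleR_conv_of_real[where 'a = complex])
  moreover have "\<kappa> \<noteq> 0" using assms by (auto simp: K_def)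
  ultimately show ?thesis
    unfolding dd_eqI[OF psi_der[OF assms(1)]]
    by (simp add: dd_phi_x0[OF assms(2)] field_simps power2_eq_square power3_eq_cube)
qed

lemma scale_der: "((\<lambda>y. x0 + \<kappa>\<^sup>2 *\<^sub>R y) has_derivative (\<lambda>h. \<kappa>\<^sup>2 *\<^sub>R h)) (at y)"
  by (auto intro!: derivative_eq_intros)

lemma K_bounds: "\<kappa> \<in> K \<Longrightarrow> 0 < \<kappa> \<and> \<kappa> < 1 \<and> \<kappa>\<^sup>2 \<le> 1 \<and> \<kappa>\<^sup>2 \<le> \<kappa>"
  unfolding K_def by (auto simp: power_le_one power2_eq_square mult_le_one mult_left_le_one_le)

text \<open>The increment of \<open>dd e \<phi>\<close> is of order
  \<open>\<kappa>\<^sup>2 * (1 + norm y)\<close>; the division by \<kappa> still leaves a factor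
  \<kappa>, which is at most 1 on \<open>K\<close>.\<close>

lemma psi_symb:
  assumes "e \<in> Basis"
  shows "symb k K (\<lambda>_ _ _. 1) (\<lambda>\<kappa> y. 1 + norm y) (\<lambda>\<kappa>. dd e (\<psi> \<kappa>))"
proof -
  have "symb k K (\<lambda>_ _ _. 1) (\<lambda>\<kappa> y. \<kappa>\<^sup>2 * (1 + norm y)) (\<lambda>\<kappa> y. dd e \<phi> (x0 + \<kappa>\<^sup>2 *\<^sub>R y) - dd e \<phi> (x0 + \<kappa>\<^sup>2 *\<^sub>R 0))"
  proof (rule symb_diff_affine[OF _ scale_der])
    show "symb1 k K (\<lambda>_. dd e \<phi>)" for k
      using symb_dd[OF \<phi>symb assms] by simp
    show "\<bar>\<kappa>\<^sup>2 *\<^sub>R f \<bullet> e\<bar> \<le> \<kappa>\<^sup>2" if "f \<in> Basis" "e \<in> Basis" for f e :: "real ^ 'n" and \<kappa>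
      using that by (auto simp: inner_Basis)
  qed (use K_bounds in auto)
  from symb_scale[OF this, of "\<lambda>\<kappa>. \<i> / complex_of_real \<kappa>"]
  have "symb k K (\<lambda>_ _ _. 1) (\<lambda>\<kappa> y. cmod (\<i> / complex_of_real \<kappa>) * (\<kappa>\<^sup>2 * (1 + norm y)))
     (\<lambda>\<kappa> y. (\<i> / complex_of_real \<kappa>) * (dd e \<phi> (x0 + \<kappa>\<^sup>2 *\<^sub>R y) - dd e \<phi> (x0 + \<kappa>\<^sup>2 *\<^sub>R 0)))" by simp
  then have "symb k K (\<lambda>_ _ _. 1) (\<lambda>\<kappa> y. 1 + norm y)
     (\<lambda>\<kappa> y. (\<i> / complex_of_real \<kappa>) * (dd e \<phi> (x0 + \<kappa>\<^sup>2 *\<^sub>R y) - dd e \<phi> (x0 + \<kappa>\<^sup>2 *\<^sub>R 0)))"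
  proof (rule symb_mono[where C = 1])
    fix \<kappa> and y :: "real ^ 'n" assume "\<kappa> \<in> K"
    from K_bounds[OF this] have "0 < \<kappa>" "\<kappa> \<le> 1" by auto
    then have "\<kappa> * (1 + norm y) \<le> 1 * (1 + norm y)" by (intro mult_right_mono) auto
    then show "cmod (\<i> / complex_of_real \<kappa>) * (\<kappa>\<^sup>2 * (1 + norm y)) \<le> 1 * (1 + norm y)"
      using \<open>0 < \<kappa>\<close> by (simp add: norm_divide power2_eq_square)
  qed auto
  then show ?thesis
    by (subst symb_cong[where g = "\<lambda>\<kappa> y. (\<i> / complex_of_real \<kappa>) * (dd e \<phi> (x0 + \<kappa>\<^sup>2 *\<^sub>R y) - dd e \<phi> (x0 + \<kappa>\<^sup>2 *\<^sub>R 0))"])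
      (auto simp: dd_psi[OF _ assms])
qed

text \<open>The terms subtracted in \<psi> are real, so the real part of \<psi> only sees
  \<open>Im \<phi>\<close>, which is nonnegative.\<close>

lemma exp_psi_le_1:
  assumes "\<kappa> \<in> K"
  shows "cmod (exp (\<psi> \<kappa> y)) \<le> 1"
proof -
  have "Re (\<psi> \<kappa> y) = - Im (\<phi> (x0 + \<kappa>\<^sup>2 *\<^sub>R y)) / \<kappa> ^ 3"
    unfolding \<psi>_def by (simp add: Re_divide_of_real Im0 del: of_real_power)
  then have "Re (\<psi> \<kappa> y) \<le> 0"
    using Im\<phi>[of "x0 + \<kappa>\<^sup>2 *\<^sub>R y"] K_bounds[OF assms] by (simp only:) simp
  then show ?thesis by (simp add: norm_exp_eq_Re)
qed

lemma v_symb: "symb k K (\<lambda>_ _ y. 1 + norm y) (\<lambda>_ _. 1) v"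
proof -
  let ?w = "\<lambda>_ _ y. 1 + norm (y :: real ^ 'n)"
  have "symb (Suc k) K ?w (\<lambda>_ _. 1) (\<lambda>\<kappa> y. exp (\<psi> \<kappa> y))"
  proof (rule symb_exp)
    show "symb k K ?w (\<lambda>_ y. 1 + norm y) (\<lambda>\<kappa>. dd e (\<psi> \<kappa>))" if "e \<in> Basis" for e
      by (rule symb_raise_weight[OF psi_symb[OF that]]) auto
    show "bdd_by K (\<lambda>_ _. 1) (\<lambda>\<kappa> y. exp (\<psi> \<kappa> y))"
      by (rule bdd_byI[of 1]) (use exp_psi_le_1 in auto)
  qed (auto intro: differentiableI_der[OF psi_der])
  then have 1: "symb k K ?w (\<lambda>_ _. 1) (\<lambda>\<kappa> y. exp (\<psi> \<kappa> y))" by (rule symb_Suc_imp)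
  have "symb1 k K (\<lambda>\<kappa> y. b (x0 + \<kappa>\<^sup>2 *\<^sub>R y))"
  proof (rule symb_affine[OF bsymb scale_der, where D = 1])
    show "\<bar>\<kappa>\<^sup>2 *\<^sub>R f \<bullet> e\<bar> * 1 \<le> 1 * 1" if "f \<in> Basis" "e \<in> Basis" "\<kappa> \<in> K" for f e :: "real ^ 'n" and \<kappa>
      using that K_bounds by (auto simp: inner_Basis)
  qed auto
  then have 2: "symb k K ?w (\<lambda>_ _. 1) (\<lambda>\<kappa> y. b (x0 + \<kappa>\<^sup>2 *\<^sub>R y))"
    by (rule symb_raise_weight) auto
  from symb_mult[OF 2 1] show ?thesis unfolding v_def[abs_def] by simp
qed

lemma v_symb_growing: "symb k K growing (\<lambda>_ _. 1) (\<lambda>\<kappa> z. v \<kappa> (fst z))"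
  using v_symb
proof (rule symb_affine[where L = "\<lambda>_. fst" and D = 1 and l = "\<lambda>_. fst"])
  show "\<bar>fst f \<bullet> e\<bar> * (1 + norm (fst z)) \<le> 1 * growing \<kappa> f z" if "f \<in> Basis" "e \<in> Basis"
    for f :: "(real ^ 'n) \<times> (real ^ 'n)" and e :: "real ^ 'n" and z and \<kappa> :: real
    using that by (auto simp: Basis_prod_def growing_def inner_Basis)
qed (auto intro!: derivative_eq_intros simp: growing_nonneg)

end

lemma integrable_compact_support:
  fixes f :: "'a::euclidean_space \<Rightarrow> complex"
  assumes "continuous_on UNIV f" "\<And>y. norm y > R \<Longrightarrow> f y = 0"
  shows "integrable lborel f"
proof -
  have "integrable lborel (\<lambda>x. indicator (cball 0 R) x *\<^sub>R f x)"
    by (rule borel_integrable_compact) (auto intro: continuous_on_subset[OF assms(1)])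
  moreover have "(\<lambda>x. indicator (cball 0 R) x *\<^sub>R f x) = f"
    using assms(2) by (auto simp: indicator_def fun_eq_iff)
  ultimately show ?thesis by simp
qed

context wkb_point
begin

text \<open>Pulling back the fixed support of \<open>b\<close> gives a radius of order
  \<open>1 / \<kappa>\<^sup>2\<close>, not uniform in \<kappa>.\<close>

lemma v_support:
  assumes "\<kappa> \<in> K"
  shows "\<exists>R. \<forall>y. norm y > R \<longrightarrow> v \<kappa> y = 0"
proof -
  obtain R where R: "\<And>x. b x \<noteq> 0 \<Longrightarrow> norm x \<le> R" using b_vanishes by (meson not_le)
  have k: "\<kappa>\<^sup>2 > 0" using K_bounds[OF assms] by simp
  have "v \<kappa> y = 0" if y: "norm y > (R + norm x0) / \<kappa>\<^sup>2" for y
  proof (rule ccontr)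
    assume "v \<kappa> y \<noteq> 0"
    then have "b (x0 + \<kappa>\<^sup>2 *\<^sub>R y) \<noteq> 0" by (auto simp: v_def)
    from R[OF this] have "norm (x0 + \<kappa>\<^sup>2 *\<^sub>R y) \<le> R" .
    moreover have "norm (\<kappa>\<^sup>2 *\<^sub>R y) \<le> norm (x0 + \<kappa>\<^sup>2 *\<^sub>R y) + norm x0"
      using norm_triangle_ineq4[of "x0 + \<kappa>\<^sup>2 *\<^sub>R y" x0] by simp
    ultimately have "\<kappa>\<^sup>2 * norm y \<le> R + norm x0" by simp
    moreover have "R + norm x0 < \<kappa>\<^sup>2 * norm y" using y k by (simp add: divide_less_eq mult.commute)
    ultimately show False by simp
  qed
  then show ?thesis by blast
qed

lemma v_continuous: "\<kappa> \<in> K \<Longrightarrow> continuous_on S (v \<kappa>)"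
  using symb_continuous_on[OF v_symb] by blast

text \<open>An exact identity for one \<kappa> at a time, so the majorants may depend on the radius
  \<open>R\<close>; the one-element index sets reflect this.\<close>

lemma v_inversion:
  assumes \<kappa>: "\<kappa> \<in> K"
  shows "(LINT \<eta>|lborel. LINT y|lborel. osc (x - y) \<eta> * v \<kappa> y) = complex_of_real ((2 * pi) ^ CARD('n)) * v \<kappa> x"
proof -
  obtain R where R: "\<And>y. norm y > R \<Longrightarrow> v \<kappa> y = 0" using v_support[OF \<kappa>] by blast
  have s: "symb k {\<kappa>} (\<lambda>_ _ _. 1) (\<lambda>_. indicator (cball 0 R)) v" for k
  proof -
    have "symb k {\<kappa>} (\<lambda>_ _ y. 1 + norm y) (\<lambda>_ y. 1 * indicator (cball 0 R) y) v"
      by (rule symb_indicator[OF symb_reindex[OF v_symb, of "{\<kappa>}" "\<lambda>\<kappa>. \<kappa>"]]) (use \<kappa> R in auto)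
    then have "symb k {\<kappa>} (\<lambda>_ _ y. 1 + norm y) (\<lambda>_. indicator (cball 0 R)) v" by (simp only: mult_1_left)
    then show ?thesis
      by (rule symb_weight_one[where D = "1 + \<bar>R\<bar>"]) (auto simp: indicator_def)
  qed
  obtain C where C: "C \<ge> 0" "\<And>y. cmod (v \<kappa> y) \<le> C * indicator (cball 0 R) y"
    using bdd_byE[OF symb_bound[OF s]] by (metis singletonI)
  have "\<exists>C\<ge>0. \<forall>i\<in>{\<kappa>}. \<forall>w. cmod (LINT y|lborel. osc w y * v i y) \<le> C * (decay w ^ 1 * (LINT y|lborel. indicator (cball 0 R) (y::real^'n)))"
    by (rule osc_bound[OF s]) (auto intro: integrable_indicator_cball)
  then obtain D where D: "\<And>w. cmod (LINT y|lborel. osc w y * v \<kappa> y) \<le> D * (decay w * (LINT y|lborel. indicator (cball 0 R) (y::real^'n)))"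
    by auto
  have "(LINT \<eta>|lborel. LINT y|lborel. osc (x - y) \<eta> * v \<kappa> y) = complex_of_real ((2 * pi) ^ DIM(real ^ 'n)) * v \<kappa> x"
  proof (rule fourier_inversion[OF v_continuous[OF \<kappa>] _ C(2)])
    show "cmod (v \<kappa> y) \<le> C" for y using C(2)[of y] C(1) by (cases "norm y \<le> R") simp_all
    show "cmod (LINT y|lborel. osc (- \<eta>) y * v \<kappa> y) \<le> D * (decay \<eta> * (LINT y|lborel. indicator (cball 0 R) (y::real^'n)))" for \<eta>
      using D[of "- \<eta>"] decay_minus[of 0 \<eta>] by simp
  qed (auto intro!: integrable_mult_right integrable_mult_left integrable_indicator_cball decay_integrable)
  then show ?thesis by simp
qed

text \<open>Mean value inequality, starting from \<open>\<psi> \<kappa> 0 = 0\<close>. It keeps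
  \<open>exp (\<psi> \<kappa> x)\<close> away from 0 on the unit ball, complementing the upper bound
  \<open>exp_psi_le_1\<close>.\<close>

lemma psi_bound: "\<exists>C. \<forall>\<kappa>\<in>K. \<forall>x. norm x \<le> 1 \<longrightarrow> cmod (\<psi> \<kappa> x) \<le> C"
proof -
  have "\<forall>e\<in>Basis. \<exists>C\<ge>0. \<forall>\<kappa>\<in>K. \<forall>y. cmod (dd e (\<psi> \<kappa>) y) \<le> C * (1 + norm y)"
    using symb_bound[OF psi_symb] unfolding bdd_by_def by blast
  then obtain C where C: "\<And>e. e \<in> Basis \<Longrightarrow> C e \<ge> 0"
    "\<And>e \<kappa> y. e \<in> Basis \<Longrightarrow> \<kappa> \<in> K \<Longrightarrow> cmod (dd e (\<psi> \<kappa>) y) \<le> C e * (1 + norm y)"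
    by metis
  define D where "D = (\<Sum>e\<in>(Basis :: (real ^ 'n) set). C e * 2)"
  have "cmod (\<psi> \<kappa> x) \<le> D" if \<kappa>: "\<kappa> \<in> K" and x: "norm x \<le> 1" for \<kappa> x
  proof -
    have "cmod (\<psi> \<kappa> x - \<psi> \<kappa> 0) \<le> D * norm (x - 0)"
    proof (rule differentiable_bound[where S = "cball 0 1" and f' = "\<lambda>x v. dd v (\<psi> \<kappa>) x"])
      fix y :: "real ^ 'n" assume "y \<in> cball 0 1"
      then have y: "norm y \<le> 1" by simp
      have d: "\<psi> \<kappa> differentiable (at y)" by (rule differentiableI_der[OF psi_der[OF \<kappa>]])
      show "(\<psi> \<kappa> has_derivative (\<lambda>v. dd v (\<psi> \<kappa>) y)) (at y within cball 0 1)"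
        by (rule has_derivative_at_withinI[OF dd_works[OF d]])
      show "onorm (\<lambda>v. dd v (\<psi> \<kappa>) y) \<le> D"
      proof (rule onorm_le)
        fix h
        have "cmod (dd h (\<psi> \<kappa>) y) \<le> (\<Sum>e\<in>Basis. \<bar>h \<bullet> e\<bar> * cmod (dd e (\<psi> \<kappa>) y))"
          unfolding dd_expand[OF d, of h] by (rule order_trans[OF norm_sum]) (simp add: norm_mult)
        also have "\<dots> \<le> (\<Sum>e\<in>Basis. norm h * (C e * 2))"
        proof (intro sum_mono mult_mono Basis_le_norm)
          fix e :: "real ^ 'n" assume e: "e \<in> Basis"
          have "C e * (1 + norm y) \<le> C e * 2" using y by (intro mult_left_mono C(1)[OF e]) simp
          then show "cmod (dd e (\<psi> \<kappa>) y) \<le> C e * 2" using C(2)[OF e \<kappa>, of y] by linarith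
        qed auto
        finally show "cmod (dd h (\<psi> \<kappa>) y) \<le> D * norm h" by (simp add: D_def sum_distrib_left mult_ac)
      qed
    qed (use x in auto)
    moreover have "D * norm x \<le> D * 1"
      using x C(1) by (intro mult_left_mono) (auto simp: D_def intro!: sum_nonneg)
    moreover have "\<psi> \<kappa> 0 = 0" by (simp add: \<psi>_def)
    ultimately show ?thesis by simp
  qed
  then show ?thesis by blast
qed

end

section \<open>The rescaled quantization and its lower bound\<close>

locale wkb_symbol = wkb_point b \<phi> h0 x0 \<xi>0 for b \<phi> :: "real ^ 'n \<Rightarrow> complex" and h0 :: real and x0 \<xi>0 +
  fixes t :: real and c :: "real \<Rightarrow> (real ^ 'n) \<times> (real ^ 'n) \<Rightarrow> complex"
  assumes t: "0 \<le> t" "t \<le> 1" and c: "c \<in> symbol_class h0"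
begin

definition ck :: "real \<Rightarrow> (real ^ 'n) \<times> (real ^ 'n) \<Rightarrow> complex" where
  "ck \<kappa> z = c (\<kappa> ^ 3) (x0 + \<kappa>\<^sup>2 *\<^sub>R fst z, \<xi>0 + \<kappa> *\<^sub>R snd z)"

definition Op1 :: "real \<Rightarrow> real ^ 'n \<Rightarrow> complex" where
  "Op1 \<kappa> x = (LINT \<eta>|lborel. LINT y|lborel. osc (x - y) \<eta> * (ck \<kappa> (t *\<^sub>R x + (1 - t) *\<^sub>R y, \<eta>) * v \<kappa> y))"

lemma c_symb: "symb1 k {0<..<h0} c"
  using c unfolding symbol_class_iff_symb by blast

lemma c_continuous: "0 < h \<Longrightarrow> h < h0 \<Longrightarrow> continuous_on S (c h)"
  using symb_continuous_on[OF c_symb] by simp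

lemma ck_0: "ck \<kappa> 0 = c (\<kappa> ^ 3) (x0, \<xi>0)" by (simp add: ck_def)

lemma ck_continuous: "\<kappa> \<in> K \<Longrightarrow> continuous_on S (ck \<kappa>)"
  unfolding ck_def[abs_def]
  by (rule continuous_on_compose2[OF c_continuous[where S = UNIV]]) (auto simp: K_def intro!: continuous_intros)

text \<open>Of the two scales the larger one, \<kappa>, decides. The absolute value keeps the
  majorant nonnegative at all real indices, including those outside \<open>K\<close>.\<close>

lemma ck_symb: "symb k K (\<lambda>_ _ _. 1) (\<lambda>\<kappa> z. \<bar>\<kappa>\<bar> * (1 + norm z)) (\<lambda>\<kappa> z. ck \<kappa> z - ck \<kappa> 0)"
  unfolding ck_def
proof (rule symb_diff_affine[where f = "\<lambda>\<kappa>. c (\<kappa> ^ 3)" and l = "\<lambda>\<kappa> z. (x0 + \<kappa>\<^sup>2 *\<^sub>R fst z, \<xi>0 + \<kappa> *\<^sub>R snd z)"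
      and L = "\<lambda>\<kappa> z. (\<kappa>\<^sup>2 *\<^sub>R fst z, \<kappa> *\<^sub>R snd z)"])
  show "symb1 k K (\<lambda>\<kappa>. c (\<kappa> ^ 3))" for k
    using symb_reindex[OF c_symb, of K "\<lambda>\<kappa>. \<kappa> ^ 3"] by (auto simp: K_def)
  fix \<kappa> :: real
  show "((\<lambda>z. (x0 + \<kappa>\<^sup>2 *\<^sub>R fst z, \<xi>0 + \<kappa> *\<^sub>R snd z)) has_derivative (\<lambda>z. (\<kappa>\<^sup>2 *\<^sub>R fst z, \<kappa> *\<^sub>R snd z))) (at z)" for z
    by (auto intro!: derivative_eq_intros)
  assume \<kappa>: "\<kappa> \<in> K"
  note kb = K_bounds[OF \<kappa>]
  show "norm ((x0 + \<kappa>\<^sup>2 *\<^sub>R fst z, \<xi>0 + \<kappa> *\<^sub>R snd z) - (x0 + \<kappa>\<^sup>2 *\<^sub>R fst 0, \<xi>0 + \<kappa> *\<^sub>R snd 0)) \<le> \<bar>\<kappa>\<bar> * norm z" for z :: "(real ^ 'n) \<times> (real ^ 'n)"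
  proof -
    have "(\<kappa>\<^sup>2 *\<^sub>R fst z, \<kappa> *\<^sub>R snd z) = \<kappa> *\<^sub>R (\<kappa> *\<^sub>R fst z, snd z)" by (simp add: power2_eq_square)
    then have "norm (\<kappa>\<^sup>2 *\<^sub>R fst z, \<kappa> *\<^sub>R snd z) = \<bar>\<kappa>\<bar> * norm (\<kappa> *\<^sub>R fst z, snd z)" by (simp only: norm_scaleR)
    also have "\<dots> \<le> \<bar>\<kappa>\<bar> * norm (fst z, snd z)"
      unfolding norm_Pair using kb
      by (intro mult_left_mono real_sqrt_le_mono add_right_mono power_mono) (auto intro: mult_left_le_one_le)
    finally show ?thesis by simp
  qed
  show "\<bar>(\<kappa>\<^sup>2 *\<^sub>R fst f, \<kappa> *\<^sub>R snd f) \<bullet> e\<bar> \<le> \<bar>\<kappa>\<bar>" if "f \<in> Basis" "e \<in> Basis" for f e :: "(real ^ 'n) \<times> (real ^ 'n)"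
    using that kb by (auto simp: Basis_prod_def inner_Basis)
  show "\<bar>\<kappa>\<bar> \<le> 1" using kb by auto
qed auto

lemma op_approx:
  "\<exists>C\<ge>0. \<forall>\<kappa>\<in>K. \<forall>x. norm x \<le> 1 \<longrightarrow>
    cmod (Op1 \<kappa> x - complex_of_real ((2 * pi) ^ CARD('n)) * ck \<kappa> 0 * v \<kappa> x) \<le> C * \<kappa>"
proof -
  define J where "J = K \<times> cball (0 :: real ^ 'n) 1"
  define l where "l j z = (t *\<^sub>R snd j + (1 - t) *\<^sub>R fst z, snd z)" for j :: "real \<times> (real ^ 'n)" and z :: "(real ^ 'n) \<times> (real ^ 'n)"
  define A where "A j z = (ck (fst j) (l j z) - ck (fst j) 0) * v (fst j) (fst z)" for j and z :: "(real ^ 'n) \<times> (real ^ 'n)"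
  have vs: "symb k J growing (\<lambda>_ _. 1) (\<lambda>j z. v (fst j) (fst z))" for k
    using symb_reindex[OF v_symb_growing, of J fst k] by (auto simp: J_def growing_def[abs_def])
  have l_norm: "1 + norm (l j z) \<le> 2 * ((1 + norm (fst z)) * (1 + norm (snd z)))" if "j \<in> J" for j z
  proof -
    have "norm (l j z) \<le> norm (t *\<^sub>R snd j + (1 - t) *\<^sub>R fst z) + norm (snd z)"
      unfolding l_def by (rule norm_Pair_le)
    also have "norm (t *\<^sub>R snd j + (1 - t) *\<^sub>R fst z) \<le> t * norm (snd j) + (1 - t) * norm (fst z)"
      using t by (intro order_trans[OF norm_triangle_ineq]) simp
    also have "t * norm (snd j) + (1 - t) * norm (fst z) \<le> 1 + norm (fst z)"
      using t that by (intro add_mono mult_le_one mult_left_le_one_le) (auto simp: J_def)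
    finally have "1 + norm (l j z) \<le> 2 + norm (fst z) + norm (snd z)" by simp
    also have "\<dots> \<le> 2 * ((1 + norm (fst z)) * (1 + norm (snd z)))" by (simp add: algebra_simps)
    finally show ?thesis .
  qed
  have As: "symb k J growing (\<lambda>j z. \<bar>fst j\<bar> * ((1 + norm (fst z)) * (1 + norm (snd z)))) A" for k
  proof -
    have "symb k J growing (\<lambda>j z. \<bar>fst j\<bar> * (1 + norm (l j z))) (\<lambda>j z. ck (fst j) (l j z) - ck (fst j) 0)"
    proof (rule symb_affine[where L = "\<lambda>_ z. ((1 - t) *\<^sub>R fst z, snd z)" and D = 1])
      show "symb k J (\<lambda>_ _ _. 1) (\<lambda>j z. \<bar>fst j\<bar> * (1 + norm z)) (\<lambda>j z. ck (fst j) z - ck (fst j) 0)"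
        using symb_reindex[OF ck_symb, of J fst k] by (auto simp: J_def)
      show "(l j has_derivative (\<lambda>z. ((1 - t) *\<^sub>R fst z, snd z))) (at z)" for j z
        unfolding l_def[abs_def] by (auto intro!: derivative_eq_intros)
      show "\<bar>((1 - t) *\<^sub>R fst f, snd f) \<bullet> e\<bar> * 1 \<le> 1 * growing j f z" if "f \<in> Basis" "e \<in> Basis"
        for f e z :: "(real ^ 'n) \<times> (real ^ 'n)" and j :: "real \<times> (real ^ 'n)"
      proof -
        have "\<bar>((1 - t) *\<^sub>R fst f, snd f) \<bullet> e\<bar> \<le> 1" using that t by (auto simp: Basis_prod_def inner_Basis)
        then show ?thesis using growing_ge_1[of j f z] by simp
      qed
    qed (auto simp: growing_nonneg)
    from symb_mult[OF this vs] have "symb k J growing (\<lambda>j z. \<bar>fst j\<bar> * (1 + norm (l j z)) * 1) A"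
      unfolding A_def[abs_def] by (auto simp: growing_nonneg)
    then show ?thesis
    proof (rule symb_mono[where C = 2])
      show "\<bar>fst j\<bar> * (1 + norm (l j z)) * 1 \<le> 2 * (\<bar>fst j\<bar> * ((1 + norm (fst z)) * (1 + norm (snd z))))" if "j \<in> J" for j z
        using mult_left_mono[OF l_norm[OF that, of z], of "\<bar>fst j\<bar>"] by (simp add: mult_ac)
    qed (auto simp: growing_nonneg)
  qed
  have vs': "symb k J growing (\<lambda>j z. 1 * ((1 + norm (fst z)) * (1 + norm (snd z)))) (\<lambda>j z. v (fst j) (fst z))" for k
  proof (rule symb_mono[OF vs, where C = 1])
    show "1 \<le> 1 * (1 * ((1 + norm (fst z)) * (1 + norm (snd z))))" for z :: "(real ^ 'n) \<times> (real ^ 'n)"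
      using mult_mono[of 1 "1 + norm (fst z)" 1 "1 + norm (snd z)"] by simp
  qed (auto simp: growing_nonneg)
  have x: "norm (snd j) \<le> 1" if "j \<in> J" for j using that by (auto simp: J_def)
  have sA: "\<exists>R. \<forall>y \<eta>. norm y > R \<longrightarrow> A j (y, \<eta>) = 0" and sv: "\<exists>R. \<forall>y \<eta>. norm y > R \<longrightarrow> v (fst j) (fst (y, \<eta> :: real ^ 'n)) = 0"
    if j: "j \<in> J" for j
  proof -
    have "fst j \<in> K" using j by (auto simp: J_def)
    then obtain R where "\<And>y. norm y > R \<Longrightarrow> v (fst j) y = 0" using v_support by blast
    then show "\<exists>R. \<forall>y \<eta>. norm y > R \<longrightarrow> A j (y, \<eta>) = 0" "\<exists>R. \<forall>y \<eta>. norm y > R \<longrightarrow> v (fst j) (fst (y, \<eta> :: real ^ 'n)) = 0"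
      by (intro exI[of _ R]; simp add: A_def)+
  qed
  have "\<exists>C\<ge>0. \<forall>j\<in>J. integrable lborel (\<lambda>\<eta>. LINT y|lborel. osc (snd j - y) \<eta> * A j (y, \<eta>)) \<and>
      cmod (LINT \<eta>|lborel. LINT y|lborel. osc (snd j - y) \<eta> * A j (y, \<eta>)) \<le> C * \<bar>fst j\<bar>"
    by (rule double_osc_bound[OF As _ sA x]) auto
  then obtain C where C: "C \<ge> 0" "\<And>j. j \<in> J \<Longrightarrow> integrable lborel (\<lambda>\<eta>. LINT y|lborel. osc (snd j - y) \<eta> * A j (y, \<eta>))"
    "\<And>j. j \<in> J \<Longrightarrow> cmod (LINT \<eta>|lborel. LINT y|lborel. osc (snd j - y) \<eta> * A j (y, \<eta>)) \<le> C * \<bar>fst j\<bar>"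
    by blast
  \<comment> \<open>A second application, with \<open>\<mu> = 1\<close>, for the integrability in
    \<eta> that allows splitting the outer integral.\<close>
  have "\<exists>C\<ge>0. \<forall>j\<in>J. integrable lborel (\<lambda>\<eta>. LINT y|lborel. osc (snd j - y) \<eta> * v (fst j) (fst (y, \<eta>))) \<and>
      cmod (LINT \<eta>|lborel. LINT y|lborel. osc (snd j - y) \<eta> * v (fst j) (fst (y, \<eta>))) \<le> C * 1"
    by (rule double_osc_bound[OF vs' _ sv x]) auto
  then have iv: "integrable lborel (\<lambda>\<eta>. LINT y|lborel. osc (snd j - y) \<eta> * v (fst j) y)" if "j \<in> J" for j
    using that by auto
  show ?thesis
  proof (intro exI[of _ C] conjI ballI allI impI C(1))
    fix \<kappa> and x :: "real ^ 'n" assume \<kappa>: "\<kappa> \<in> K" and x: "norm x \<le> 1"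
    then have j: "(\<kappa>, x) \<in> J" by (simp add: J_def)
    obtain R where R: "\<And>y. norm y > R \<Longrightarrow> v \<kappa> y = 0" using v_support[OF \<kappa>] by blast
    have inner: "(LINT y|lborel. osc (x - y) \<eta> * (ck \<kappa> (t *\<^sub>R x + (1 - t) *\<^sub>R y, \<eta>) * v \<kappa> y)) =
      (LINT y|lborel. osc (x - y) \<eta> * A (\<kappa>, x) (y, \<eta>)) + ck \<kappa> 0 * (LINT y|lborel. osc (x - y) \<eta> * v \<kappa> y)" for \<eta>
    proof -
      have "integrable lborel (\<lambda>y. osc (x - y) \<eta> * A (\<kappa>, x) (y, \<eta>))"
        unfolding A_def l_def
        by (rule integrable_compact_support[where R = R])
          (auto simp: R intro!: continuous_intros v_continuous[OF \<kappa>] continuous_on_compose2[OF ck_continuous[OF \<kappa>, of UNIV]])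
      moreover have "integrable lborel (\<lambda>y. ck \<kappa> 0 * (osc (x - y) \<eta> * v \<kappa> y))"
        by (rule integrable_compact_support[where R = R])
          (auto simp: R intro!: continuous_intros v_continuous[OF \<kappa>])
      moreover have "osc (x - y) \<eta> * (ck \<kappa> (t *\<^sub>R x + (1 - t) *\<^sub>R y, \<eta>) * v \<kappa> y) =
          osc (x - y) \<eta> * A (\<kappa>, x) (y, \<eta>) + ck \<kappa> 0 * (osc (x - y) \<eta> * v \<kappa> y)" for y
        by (simp add: A_def l_def algebra_simps)
      ultimately show ?thesis by simp
    qed
    have "Op1 \<kappa> x = (LINT \<eta>|lborel. LINT y|lborel. osc (x - y) \<eta> * A (\<kappa>, x) (y, \<eta>)) +
      ck \<kappa> 0 * (complex_of_real ((2 * pi) ^ CARD('n)) * v \<kappa> x)"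
      unfolding Op1_def inner using C(2)[OF j] iv[OF j] v_inversion[OF \<kappa>, of x] by simp
    then show "cmod (Op1 \<kappa> x - complex_of_real ((2 * pi) ^ CARD('n)) * ck \<kappa> 0 * v \<kappa> x) \<le> C * \<kappa>"
      using C(3)[OF j] K_bounds[OF \<kappa>] by (simp add: mult_ac)
  qed
qed

end

lemma L2_compact_support:
  fixes f :: "'a::euclidean_space \<Rightarrow> complex"
  assumes "continuous_on UNIV f" "\<And>y. norm y > R \<Longrightarrow> f y = 0"
  shows "L2 f"
proof -
  have "integrable lborel (\<lambda>x. complex_of_real ((cmod (f x))\<^sup>2))"
    by (rule integrable_compact_support[where R = R]) (auto simp: assms(2) intro!: continuous_intros assms(1))
  from integrable_Re[OF this] have "integrable lborel (\<lambda>x. (cmod (f x))\<^sup>2)" by simp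
  then show ?thesis using borel_measurable_continuous_onI[OF assms(1)] by (simp add: L2_def)
qed

context wkb
begin

lemma u_L2: "h > 0 \<Longrightarrow> L2 (u h)"
proof -
  assume h: "h > 0"
  obtain R where "\<And>y. norm y > R \<Longrightarrow> b y = 0" using b_vanishes by blast
  then show ?thesis by (intro L2_compact_support[OF u_continuous[OF h]]) (auto simp: u_def)
qed

end

context wkb_symbol
begin

text \<open>With \<open>n = CARD('n)\<close>, the substitutions contribute
  \<open>\<kappa> ^ n\<close> from \<xi> and \<open>(\<kappa>\<^sup>2) ^ n\<close> from
  \<open>y\<close>, together \<open>h ^ n\<close>, which cancels the power of \<open>h\<close> in
  the normalization.\<close>

lemma Op_rescale:
  assumes \<kappa>: "\<kappa> \<in> K"
  shows "cmod (Op_schwartz t (\<kappa> ^ 3) (c (\<kappa> ^ 3)) (u (\<kappa> ^ 3)) (x0 + \<kappa>\<^sup>2 *\<^sub>R x)) = 1 / (2 * pi) ^ CARD('n) *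
    cmod (Op1 \<kappa> x)"
proof -
  have k: "\<kappa> > 0" "0 < \<kappa> ^ 3" "\<kappa> ^ 3 < h0" using \<kappa> by (auto simp: K_def)
  define G where "G \<xi> y = c (\<kappa> ^ 3) (t *\<^sub>R (x0 + \<kappa>\<^sup>2 *\<^sub>R x) + (1 - t) *\<^sub>R y, \<xi>) *
    exp (\<i> * complex_of_real (inner (x0 + \<kappa>\<^sup>2 *\<^sub>R x - y) \<xi> / \<kappa> ^ 3)) * u (\<kappa> ^ 3) y" for \<xi> y
  have contG: "continuous_on UNIV (\<lambda>(\<xi>, y). G \<xi> y)"
    unfolding G_def split_beta'
    by (intro continuous_intros continuous_on_compose2[OF c_continuous[OF k(2,3), of UNIV]]
        continuous_on_compose2[OF u_continuous[OF k(2), of UNIV]]) (use k(1) in auto)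
  have Gm: "(\<lambda>(\<xi>, y). G \<xi> y) \<in> borel_measurable (borel \<Otimes>\<^sub>M lborel)"
  proof -
    have "(\<lambda>(\<xi>, y). G \<xi> y) \<in> borel_measurable (borel \<Otimes>\<^sub>M borel)"
      unfolding borel_prod by (rule borel_measurable_continuous_onI[OF contG])
    then show ?thesis by (simp cong: measurable_cong_sets)
  qed
  have Gm1: "G \<xi> \<in> borel_measurable borel" for \<xi>
  proof (rule borel_measurable_continuous_onI)
    have "continuous_on UNIV (\<lambda>y. (\<xi>, y :: real ^ 'n))" by (intro continuous_intros)
    from continuous_on_compose2[OF contG this] show "continuous_on UNIV (G \<xi>)" by simp
  qed
  have Gm2: "(\<lambda>\<xi>. LINT y|lborel. G \<xi> y) \<in> borel_measurable borel"
    using lborel.borel_measurable_lebesgue_integral[OF Gm] .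
  \<comment> \<open>The phases that depend on neither \<open>y\<close> nor \<eta>. This factor is
    unimodular because \<open>\<phi> x0\<close> is real.\<close>
  define E where "E = exp (\<i> * \<phi> x0 / complex_of_real (\<kappa> ^ 3)) * exp (\<i> * complex_of_real (\<xi>0 \<bullet> x / \<kappa>))"
  have E: "cmod E = 1" by (simp add: E_def norm_mult norm_exp_eq_Re Im0 Re_divide_of_real del: of_real_power)
  have GE: "G (\<xi>0 + \<kappa> *\<^sub>R \<eta>) (x0 + \<kappa>\<^sup>2 *\<^sub>R y) = E * (osc (x - y) \<eta> * (ck \<kappa> (t *\<^sub>R x + (1 - t) *\<^sub>R y, \<eta>) * v \<kappa> y))" for \<eta> y
  proof -
    let ?p = "\<phi> (x0 + \<kappa>\<^sup>2 *\<^sub>R y)"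
    have arg: "t *\<^sub>R (x0 + \<kappa>\<^sup>2 *\<^sub>R x) + (1 - t) *\<^sub>R (x0 + \<kappa>\<^sup>2 *\<^sub>R y) = x0 + \<kappa>\<^sup>2 *\<^sub>R (t *\<^sub>R x + (1 - t) *\<^sub>R y)"
      by (simp add: algebra_simps)
    have e1: "inner (x0 + \<kappa>\<^sup>2 *\<^sub>R x - (x0 + \<kappa>\<^sup>2 *\<^sub>R y)) (\<xi>0 + \<kappa> *\<^sub>R \<eta>) / \<kappa> ^ 3 = \<xi>0 \<bullet> x / \<kappa> - \<xi>0 \<bullet> y / \<kappa> + (x - y) \<bullet> \<eta>"
      using k(1) by (simp add: inner_simps inner_commute field_simps power2_eq_square power3_eq_cube)
    have e2: "complex_of_real (\<kappa>\<^sup>2 * (\<xi>0 \<bullet> y)) / complex_of_real (\<kappa> ^ 3) = complex_of_real (\<xi>0 \<bullet> y / \<kappa>)"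
      using k(1) by (simp add: field_simps power2_eq_square power3_eq_cube)
    have e3: "\<psi> \<kappa> y = \<i> / complex_of_real (\<kappa> ^ 3) * ?p - \<i> * \<phi> x0 / complex_of_real (\<kappa> ^ 3) -
        \<i> * (complex_of_real (\<kappa>\<^sup>2 * (\<xi>0 \<bullet> y)) / complex_of_real (\<kappa> ^ 3))"
      unfolding \<psi>_def by (simp add: diff_divide_distrib right_diff_distrib del: of_real_power of_real_mult)
    have "\<i> * complex_of_real (inner (x0 + \<kappa>\<^sup>2 *\<^sub>R x - (x0 + \<kappa>\<^sup>2 *\<^sub>R y)) (\<xi>0 + \<kappa> *\<^sub>R \<eta>) / \<kappa> ^ 3) + \<i> / complex_of_real (\<kappa> ^ 3) * ?p =
        \<i> * \<phi> x0 / complex_of_real (\<kappa> ^ 3) + \<i> * complex_of_real (\<xi>0 \<bullet> x / \<kappa>) + \<i> * complex_of_real ((x - y) \<bullet> \<eta>) + \<psi> \<kappa> y"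
      unfolding e3 e2 e1 of_real_add of_real_diff by (simp add: algebra_simps del: of_real_power of_real_divide)
    then have "exp (\<i> * complex_of_real (inner (x0 + \<kappa>\<^sup>2 *\<^sub>R x - (x0 + \<kappa>\<^sup>2 *\<^sub>R y)) (\<xi>0 + \<kappa> *\<^sub>R \<eta>) / \<kappa> ^ 3)) * exp (\<i> / complex_of_real (\<kappa> ^ 3) * ?p) =
        E * osc (x - y) \<eta> * exp (\<psi> \<kappa> y)"
      unfolding E_def osc_def exp_add[symmetric] by (simp only:)
    then show ?thesis unfolding G_def arg ck_def u_def v_def fst_conv snd_conv by (simp add: mult_ac)
  qed
  have "(LINT \<xi>|lborel. LINT y|lborel. G \<xi> y) = \<kappa> ^ CARD('n) *\<^sub>R (LINT \<eta>|lborel. LINT y|lborel. G (\<xi>0 + \<kappa> *\<^sub>R \<eta>) y)"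
    using integral_affine[OF _ Gm2, of \<kappa> \<xi>0] k(1) by simp
  also have "\<dots> = \<kappa> ^ CARD('n) *\<^sub>R (LINT \<eta>|lborel. (\<kappa>\<^sup>2) ^ CARD('n) *\<^sub>R (LINT y|lborel. G (\<xi>0 + \<kappa> *\<^sub>R \<eta>) (x0 + \<kappa>\<^sup>2 *\<^sub>R y)))"
    using integral_affine[OF _ Gm1, of "\<kappa>\<^sup>2" _ x0] k(1) by simp
  also have "\<dots> = \<kappa> ^ CARD('n) *\<^sub>R (\<kappa>\<^sup>2) ^ CARD('n) *\<^sub>R (E * Op1 \<kappa> x)"
    unfolding GE Op1_def by simp
  finally have "cmod (LINT \<xi>|lborel. LINT y|lborel. G \<xi> y) = \<kappa> ^ CARD('n) * ((\<kappa>\<^sup>2) ^ CARD('n) *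
      cmod (Op1 \<kappa> x))"
    using k(1) by (simp add: norm_mult E)
  moreover have "\<kappa> ^ CARD('n) * (\<kappa>\<^sup>2) ^ CARD('n) = (\<kappa> ^ 3) ^ CARD('n)"
    by (simp add: power_mult_distrib[symmetric] power2_eq_square power3_eq_cube mult.assoc)
  ultimately have "cmod (LINT \<xi>|lborel. LINT y|lborel. G \<xi> y) = (\<kappa> ^ 3) ^ CARD('n) *
      cmod (Op1 \<kappa> x)"
    by (simp add: mult.assoc[symmetric])
  moreover have "cmod (Op_schwartz t (\<kappa> ^ 3) (c (\<kappa> ^ 3)) (u (\<kappa> ^ 3)) (x0 + \<kappa>\<^sup>2 *\<^sub>R x)) =
      1 / (2 * pi * \<kappa> ^ 3) ^ CARD('n) * cmod (LINT \<xi>|lborel. LINT y|lborel. G \<xi> y)"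
    unfolding Op_schwartz_def G_def norm_mult norm_of_real using k(1) by simp
  ultimately show ?thesis using k(1) by (simp add: power_mult_distrib)
qed

lemma Op_lower_bound:
  assumes \<epsilon>: "\<epsilon> > 0" "\<And>h. 0 < h \<Longrightarrow> h < h0 \<Longrightarrow> \<epsilon> \<le> cmod (c h (x0, \<xi>0))"
  shows "\<exists>c1>0. \<exists>\<kappa>1>0. \<forall>\<kappa>\<in>K. \<kappa> < \<kappa>1 \<longrightarrow> (\<forall>x. norm x \<le> 1 \<longrightarrow>
    c1 \<le> cmod (Op_schwartz t (\<kappa> ^ 3) (c (\<kappa> ^ 3)) (u (\<kappa> ^ 3)) (x0 + \<kappa>\<^sup>2 *\<^sub>R x)))"
proof -
  define N where "N = (2 * pi) ^ CARD('n)"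
  have N: "N > 0" by (simp add: N_def)
  obtain C where C: "C \<ge> 0" "\<And>\<kappa> x. \<kappa> \<in> K \<Longrightarrow> norm x \<le> 1 \<Longrightarrow>
    cmod (Op1 \<kappa> x - complex_of_real N * ck \<kappa> 0 * v \<kappa> x) \<le> C * \<kappa>"
    using op_approx unfolding N_def by blast
  obtain D where D: "\<And>\<kappa> x. \<kappa> \<in> K \<Longrightarrow> norm x \<le> 1 \<Longrightarrow> cmod (\<psi> \<kappa> x) \<le> D" using psi_bound by blast
  obtain L where L: "L \<ge> 0" "\<And>p q. cmod (b p - b q) \<le> L * norm (p - q)"
    using symb_lipschitz[OF bsymb[of "Suc 0" "{()}"]] by auto
  \<comment> \<open>The inversion constant \<open>N\<close> times lower bounds: \<epsilon> for the
    symbol, half of \<open>cmod (b x0)\<close> for the amplitude and \<open>exp (- D)\<close> for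
    the exponential.\<close>
  define m where "m = N * (\<epsilon> * (cmod (b x0) / 2 * exp (- D)))"
  have m: "m > 0" unfolding m_def using N \<epsilon>(1) b0 by simp
  \<comment> \<open>The first entry keeps \<open>b\<close> within half of \<open>cmod (b x0)\<close>
    of its value at \<open>x0\<close>, the second makes the remainder \<open>C * \<kappa>\<close> at
    most \<open>m / 2\<close>. Adding 1 to \<open>L\<close> and \<open>C\<close> avoids division by
    0.\<close>
  define \<kappa>1 where "\<kappa>1 = min (cmod (b x0) / (2 * (L + 1))) (m / (2 * (C + 1)))"
  have \<kappa>1: "\<kappa>1 > 0" unfolding \<kappa>1_def using m b0 L(1) C(1) by simp
  have "m / 2 / N \<le> cmod (Op_schwartz t (\<kappa> ^ 3) (c (\<kappa> ^ 3)) (u (\<kappa> ^ 3)) (x0 + \<kappa>\<^sup>2 *\<^sub>R x))"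
    if \<kappa>: "\<kappa> \<in> K" "\<kappa> < \<kappa>1" and x: "norm x \<le> 1" for \<kappa> x
  proof -
    note kb = K_bounds[OF \<kappa>(1)]
    have "cmod (b (x0 + \<kappa>\<^sup>2 *\<^sub>R x) - b x0) \<le> L * (\<kappa>\<^sup>2 * norm x)" using L(2)[of "x0 + \<kappa>\<^sup>2 *\<^sub>R x" x0] by simp
    also have "\<dots> \<le> (L + 1) * (\<kappa> * 1)" using kb x L(1) by (intro mult_mono) auto
    also have "\<dots> \<le> cmod (b x0) / 2"
    proof -
      have "\<kappa> \<le> cmod (b x0) / (2 * (L + 1))" using \<kappa>(2) by (simp add: \<kappa>1_def)
      then show ?thesis using L(1) by (simp add: field_simps)
    qed
    finally have bb: "cmod (b x0) / 2 \<le> cmod (b (x0 + \<kappa>\<^sup>2 *\<^sub>R x))"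
      using norm_triangle_ineq2[of "b x0" "b (x0 + \<kappa>\<^sup>2 *\<^sub>R x)"] by (simp add: norm_minus_commute)
    have "- D \<le> Re (\<psi> \<kappa> x)" using D[OF \<kappa>(1) x] abs_Re_le_cmod[of "\<psi> \<kappa> x"] by linarith
    then have "exp (- D) \<le> cmod (exp (\<psi> \<kappa> x))" by (simp add: norm_exp_eq_Re)
    with bb have vb: "cmod (b x0) / 2 * exp (- D) \<le> cmod (v \<kappa> x)"
      unfolding v_def norm_mult by (intro mult_mono) auto
    have "\<epsilon> \<le> cmod (ck \<kappa> 0)" unfolding ck_0 using \<kappa>(1) by (intro \<epsilon>(2)) (auto simp: K_def)
    then have "\<epsilon> * (cmod (b x0) / 2 * exp (- D)) \<le> cmod (ck \<kappa> 0) * cmod (v \<kappa> x)"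
      using vb by (intro mult_mono) auto
    then have "m \<le> cmod (complex_of_real N * ck \<kappa> 0 * v \<kappa> x)"
      unfolding m_def using N by (simp add: norm_mult mult.assoc)
    moreover have "C * \<kappa> \<le> m / 2"
    proof -
      have "\<kappa> \<le> m / (2 * (C + 1))" using \<kappa>(2) by (simp add: \<kappa>1_def)
      then have "(C + 1) * \<kappa> \<le> m / 2" using C(1) by (simp add: field_simps)
      then show ?thesis using kb by (simp add: algebra_simps)
    qed
    ultimately have "m / 2 \<le> cmod (Op1 \<kappa> x)"
      using C(2)[OF \<kappa>(1) x] norm_triangle_ineq3[of "Op1 \<kappa> x" "complex_of_real N * ck \<kappa> 0 * v \<kappa> x"]
      by linarith
    then show ?thesis unfolding Op_rescale[OF \<kappa>(1)] N_def[symmetric] using N by (simp add: field_simps)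
  qed
  then show ?thesis using m N \<kappa>1 by (intro exI[of _ "m / 2 / N"] exI[of _ \<kappa>1] conjI) auto
qed

text \<open>Squared norms are compared. With \<open>n = CARD('n)\<close>, the ball of radius
  \<open>\<kappa>\<^sup>2\<close> contributes at least a constant times
  \<open>\<kappa> ^ (2 * n)\<close>, whereas the assumed decay allows at most a constant times
  \<open>h ^ (2 * n) = \<kappa> ^ (6 * n)\<close>.\<close>

lemma not_negligible:
  assumes \<epsilon>: "\<epsilon> > 0" "\<And>h. 0 < h \<Longrightarrow> h < h0 \<Longrightarrow> \<epsilon> \<le> cmod (c h (x0, \<xi>0))"
    and T: "\<And>h. 0 < h \<Longrightarrow> h < h0 \<Longrightarrow> is_Op t h (c h) (T h)"
    and O: "(\<lambda>h. L2_norm (T h (u h))) \<in> O[at_right 0](\<lambda>h. h ^ CARD('n))"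
  shows False
proof -
  define n where "n = CARD('n)"
  have n: "n > 0" by (simp add: n_def)
  obtain c1 \<kappa>1 where c1: "c1 > 0" "\<kappa>1 > 0" "\<And>\<kappa> x. \<kappa> \<in> K \<Longrightarrow> \<kappa> < \<kappa>1 \<Longrightarrow> norm x \<le> 1 \<Longrightarrow>
      c1 \<le> cmod (Op_schwartz t (\<kappa> ^ 3) (c (\<kappa> ^ 3)) (u (\<kappa> ^ 3)) (x0 + \<kappa>\<^sup>2 *\<^sub>R x))"
    using Op_lower_bound[OF \<epsilon>] by blast
  obtain B where B: "B > 0" "eventually (\<lambda>h. norm (L2_norm (T h (u h))) \<le> B * norm (h ^ n)) (at_right 0)"
    using landau_o.bigE[OF O] unfolding n_def by blast
  then obtain d where d: "d > 0" "\<And>h. 0 < h \<Longrightarrow> h < d \<Longrightarrow> norm (L2_norm (T h (u h))) \<le> B * norm (h ^ n)"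
    unfolding eventually_at_right_field by auto
  define V where "V = measure lborel (cball (0 :: real ^ 'n) 1)"
  have V: "V > 0" unfolding V_def using content_cball_pos[of 1 "0 :: real ^ 'n"] by simp
  \<comment> \<open>The last entry yields \<open>B\<^sup>2 * \<kappa> < c1\<^sup>2 * V\<close>,
    opposite to the inequality that the comparison of norms will give; the other entries put
    \<kappa> and \<open>\<kappa> ^ 3\<close> in the range of the estimates.\<close>
  define \<kappa> where "\<kappa> = min (min (1/2) (h0 / 2)) (min (min (d / 2) (\<kappa>1 / 2)) (c1\<^sup>2 * V / (2 * B\<^sup>2)))"
  have k0: "\<kappa> > 0" unfolding \<kappa>_def using h0 d(1) c1 B(1) V by simp
  have kernel: "\<kappa> < 1" "\<kappa> < h0" "\<kappa> < d" "\<kappa> < \<kappa>1" "\<kappa> < c1\<^sup>2 * V / B\<^sup>2"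
  proof -
    have "c1\<^sup>2 * V / (2 * B\<^sup>2) < c1\<^sup>2 * V / B\<^sup>2" using c1 V B(1) by (simp add: field_simps)
    then show "\<kappa> < c1\<^sup>2 * V / B\<^sup>2" unfolding \<kappa>_def by (simp add: min_less_iff_disj)
  qed (use h0 d(1) c1(1,2) in \<open>simp_all add: \<kappa>_def min_less_iff_disj\<close>)
  have k3: "\<kappa> ^ 3 \<le> \<kappa>" using k0 kernel(1) power_decreasing[of 1 3 \<kappa>] by simp
  then have kK: "\<kappa> \<in> K" using k0 kernel by (auto simp: K_def)
  define h where "h = \<kappa> ^ 3"
  have h: "0 < h" "h < h0" "h < d" using k0 k3 kernel by (auto simp: h_def)
  have op: "is_Op t h (c h) (T h)" by (rule T[OF h(1,2)])
  then have L2: "L2 (T h (u h))" using u_L2[OF h(1)] by (auto simp: is_Op_def L2_bounded_operator_def)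
  have ae: "AE x in lborel. T h (u h) x = Op_schwartz t h (c h) (u h) x"
    using op u_schwartz[OF h(1)] by (simp add: is_Op_def)
  have "(LINT x|lborel. c1\<^sup>2 * indicator (cball x0 (\<kappa>\<^sup>2)) x) \<le> (LINT x|lborel. (cmod (T h (u h) x))\<^sup>2)"
  proof (rule integral_mono_AE)
    show "integrable lborel (\<lambda>x. c1\<^sup>2 * indicator (cball x0 (\<kappa>\<^sup>2)) x)"
      by (intro integrable_mult_right integrable_indicator_cball)
    show "integrable lborel (\<lambda>x. (cmod (T h (u h) x))\<^sup>2)" using L2 by (simp add: L2_def)
    show "AE x in lborel. c1\<^sup>2 * indicator (cball x0 (\<kappa>\<^sup>2)) x \<le> (cmod (T h (u h) x))\<^sup>2"
      using ae
    proof eventually_elim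
      fix x assume e: "T h (u h) x = Op_schwartz t h (c h) (u h) x"
      show "c1\<^sup>2 * indicator (cball x0 (\<kappa>\<^sup>2)) x \<le> (cmod (T h (u h) x))\<^sup>2"
      proof (cases "x \<in> cball x0 (\<kappa>\<^sup>2)")
        case True
        define y where "y = (x - x0) /\<^sub>R \<kappa>\<^sup>2"
        have x: "x = x0 + \<kappa>\<^sup>2 *\<^sub>R y" using k0 by (simp add: y_def)
        have "norm y = norm (x - x0) / \<kappa>\<^sup>2" by (simp add: y_def divide_inverse mult.commute)
        then have "norm y \<le> 1" using True k0 by (simp add: dist_norm norm_minus_commute)
        then have "c1 \<le> cmod (T h (u h) x)" using c1(3)[OF kK kernel(4), of y] by (simp add: e[unfolded h_def] h_def flip: x)
        then show ?thesis using True c1(1) by (simp add: power_mono)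
      qed simp
    qed
  qed
  moreover have "(LINT x|lborel. c1\<^sup>2 * indicator (cball x0 (\<kappa>\<^sup>2)) x) = c1\<^sup>2 * (V * (\<kappa>\<^sup>2) ^ n)"
    using k0 by (simp add: V_def n_def content_cball)
  moreover have "(LINT x|lborel. (cmod (T h (u h) x))\<^sup>2) \<le> (B * h ^ n)\<^sup>2"
  proof -
    have "L2_norm (T h (u h)) \<le> B * h ^ n" "0 \<le> L2_norm (T h (u h))"
      using d(2)[OF h(1,3)] h(1) by (auto simp: L2_norm_def)
    then have "(L2_norm (T h (u h)))\<^sup>2 \<le> (B * h ^ n)\<^sup>2" by (intro power_mono)
    then show ?thesis by (simp add: L2_norm_def)
  qed
  ultimately have "c1\<^sup>2 * (V * (\<kappa>\<^sup>2) ^ n) \<le> (B * h ^ n)\<^sup>2" by linarith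
  also have "(B * h ^ n)\<^sup>2 = B\<^sup>2 * (\<kappa> ^ 4) ^ n * (\<kappa>\<^sup>2) ^ n"
    unfolding h_def by (simp add: power_mult_distrib power_mult[symmetric] power_add[symmetric])
  finally have "c1\<^sup>2 * V \<le> B\<^sup>2 * (\<kappa> ^ 4) ^ n" using k0 by (simp add: mult.assoc[symmetric])
  also have "\<dots> \<le> B\<^sup>2 * \<kappa>"
  proof (intro mult_left_mono)
    have "\<kappa> ^ (4 * n) \<le> \<kappa> ^ 1" using k0 kernel(1) n by (intro power_decreasing) auto
    then show "(\<kappa> ^ 4) ^ n \<le> \<kappa>" by (simp add: power_mult)
  qed simp
  also have "\<dots> < B\<^sup>2 * (c1\<^sup>2 * V / B\<^sup>2)" using kernel(5) B(1) by (intro mult_strict_left_mono) auto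
  also have "\<dots> = c1\<^sup>2 * V" using B(1) by simp
  finally show False by simp
qed

end

subsection \<open>Cutoff functions\<close>

text \<open>The flat function \<open>exp (- 1 / s)\<close> with an extra power of
  \<open>1 / s\<close>, extended by 0. The powers make the family closed under differentiation up to
  linear combinations, so that bounds on all derivatives follow by induction.\<close>

definition qflat :: "nat \<Rightarrow> real \<Rightarrow> real" where
  "qflat k s = (if s \<le> 0 then 0 else inverse s ^ k * exp (- inverse s))"

lemma power_exp_minus_le_fact: "x \<ge> 0 \<Longrightarrow> x ^ k * exp (- x) \<le> fact k" for x :: real
proof -
  assume x: "x \<ge> 0"
  have "(\<Sum>n\<in>{k}. inverse (fact n) * x ^ n) \<le> (\<Sum>n. inverse (fact n) * x ^ n)"
    using summable_exp_generic[of x] x by (intro sum_le_suminf) auto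
  then have "x ^ k / fact k \<le> exp x" unfolding exp_def by (simp add: divide_inverse mult.commute)
  then show ?thesis by (simp add: exp_minus field_simps)
qed

lemma qflat_nonneg: "0 \<le> qflat k s" and qflat_le: "qflat k s \<le> fact k"
  using power_exp_minus_le_fact[of "inverse s" k] by (auto simp: qflat_def)

lemma qflat_sq: "qflat k s = s\<^sup>2 * qflat (Suc (Suc k)) s"
  by (auto simp: qflat_def field_simps power2_eq_square)

lemma qflat_deriv: "(qflat k has_real_derivative qflat (Suc (Suc k)) s - real k * qflat (Suc k) s) (at s)"
proof -
  consider "s > 0" | "s < 0" | "s = 0" by linarith
  then show ?thesis
  proof cases
    case 1
    have "((\<lambda>s. inverse s ^ k * exp (- inverse s)) has_real_derivative
        inverse s ^ (k + 2) * exp (- inverse s) - real k * (inverse s ^ (k + 1) * exp (- inverse s))) (at s)"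
    proof (cases k)
      case 0
      then show ?thesis using 1 by (auto intro!: derivative_eq_intros simp: power2_eq_square)
    next
      case (Suc m)
      have "((\<lambda>s. inverse s ^ Suc m) has_real_derivative (1 + real m) * (- (inverse s)\<^sup>2 * inverse s ^ m)) (at s)"
        using 1 by (intro DERIV_power_Suc) (auto intro!: derivative_eq_intros simp: power2_eq_square)
      moreover have "((\<lambda>s. exp (- inverse s)) has_real_derivative exp (- inverse s) * (inverse s)\<^sup>2) (at s)"
        using 1 by (auto intro!: derivative_eq_intros simp: power2_eq_square)
      ultimately show ?thesis unfolding Suc
        by (rule DERIV_cong[OF DERIV_mult]) (simp add: power2_eq_square algebra_simps)
    qed
    then have "(qflat k has_real_derivative
        inverse s ^ (k + 2) * exp (- inverse s) - real k * (inverse s ^ (k + 1) * exp (- inverse s))) (at s)"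
      by (rule has_field_derivative_transform_within_open[of _ _ _ "{0<..}"]) (use 1 in \<open>auto simp: qflat_def\<close>)
    then show ?thesis using 1 by (simp add: qflat_def)
  next
    case 2
    have "((\<lambda>_. 0) has_real_derivative 0) (at s)" by simp
    then have "(qflat k has_real_derivative 0) (at s)"
      by (rule has_field_derivative_transform_within_open[of _ _ _ "{..<0}"]) (use 2 in \<open>auto simp: qflat_def\<close>)
    then show ?thesis using 2 by (simp add: qflat_def)
  next
    case 3
    \<comment> \<open>By \<open>qflat_sq\<close> the difference quotient at 0 is \<open>h\<close>
      times the bounded function \<open>qflat (Suc (Suc k))\<close>.\<close>
    have "((\<lambda>h. qflat k h / h) \<longlongrightarrow> 0) (at 0)"
    proof (rule Lim_null_comparison)
      have "norm (qflat k h / h) \<le> \<bar>h\<bar> * fact (Suc (Suc k))" for h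
        using qflat_le[of "Suc (Suc k)" h] qflat_nonneg[of "Suc (Suc k)" h]
        by (subst qflat_sq) (auto simp: power2_eq_square abs_mult intro!: mult_left_mono simp del: fact_Suc)
      then show "\<forall>\<^sub>F h in at 0. norm (qflat k h / h) \<le> \<bar>h\<bar> * fact (Suc (Suc k))" by simp
      show "((\<lambda>h::real. \<bar>h\<bar> * fact (Suc (Suc k))) \<longlongrightarrow> 0) (at 0)"
        by (rule tendsto_eq_intros | simp)+
    qed
    then show ?thesis using 3 by (simp add: has_field_derivative_iff qflat_def)
  qed
qed

lemma has_derivative_complex_of_real:
  "(g has_real_derivative d) (at s) \<Longrightarrow> ((\<lambda>s. complex_of_real (g s)) has_derivative (\<lambda>h. complex_of_real (d * h))) (at s)"
  unfolding has_field_derivative_def by (rule has_derivative_of_real)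

lemma qflat_symb: "symb1 k I (\<lambda>_ s. complex_of_real (qflat j s))"
proof (induction k arbitrary: j)
  have bd: "bdd_by I (\<lambda>_ _. 1) (\<lambda>_ s. complex_of_real (qflat j s))" for j
    by (rule bdd_byI[of "fact j"]) (use qflat_nonneg qflat_le in auto)
  { case 0 then show ?case using bd by simp }
  { case (Suc k)
    note der = has_derivative_complex_of_real[OF qflat_deriv, of j]
    show ?case
    proof (rule symb_SucI[OF bd differentiableI_der[OF der]])
      fix v :: real assume "v \<in> Basis"
      then have v: "v = 1" by simp
      have "symb k I (\<lambda>_ _ _. 1) (\<lambda>_ _. cmod (complex_of_real (- real j)) * 1) (\<lambda>_ s. complex_of_real (- real j) * complex_of_real (qflat (Suc j) s))"
        by (rule symb_scale[OF Suc.IH]) auto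
      then have "symb1 k I (\<lambda>_ s. complex_of_real (- real j) * complex_of_real (qflat (Suc j) s))"
        by (rule symb_mono[where C = "real j"]) auto
      from symb_add[OF Suc.IH[of "Suc (Suc j)"] this]
      show "symb k I (\<lambda>_ _ _. 1) (\<lambda>_ _. 1 * 1) (\<lambda>_. dd v (\<lambda>s. complex_of_real (qflat j s)))"
        by (subst symb_cong[OF ext[OF dd_eqI[OF der]]]) (simp add: v)
    qed }
qed

definition rstep :: "real \<Rightarrow> real" where
  "rstep s = qflat 0 s / (qflat 0 s + qflat 0 (1 - s))"

text \<open>One of \<open>s\<close> and \<open>1 - s\<close> is at least 1/2. A uniform lower bound
  is what \<open>symb_inverse\<close> requires for the denominator of \<open>rstep\<close>.\<close>

lemma qflat_0_lower: "exp (- 2) \<le> qflat 0 s + qflat 0 (1 - s)"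
proof -
  have q: "exp (- 2) \<le> qflat 0 s" if "s \<ge> 1/2" for s
    using that le_imp_inverse_le[of "1/2" s] by (simp add: qflat_def)
  show ?thesis
    using q[of s] q[of "1 - s"] qflat_nonneg[of 0 s] qflat_nonneg[of 0 "1 - s"] by (cases "s \<ge> 1/2") auto
qed

lemma rstep_0: "s \<le> 0 \<Longrightarrow> rstep s = 0" and rstep_1: "1 \<le> s \<Longrightarrow> rstep s = 1"
  and rstep_nonneg: "0 \<le> rstep s" and rstep_le_1: "rstep s \<le> 1"
proof -
  have p: "qflat 0 s + qflat 0 (1 - s) > 0" for s using qflat_0_lower[of s] by (smt (verit) exp_gt_zero)
  show "s \<le> 0 \<Longrightarrow> rstep s = 0" by (simp add: rstep_def qflat_def)
  show "1 \<le> s \<Longrightarrow> rstep s = 1" using p[of s] by (simp add: rstep_def qflat_def)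
  show "0 \<le> rstep s" "rstep s \<le> 1" using p[of s] qflat_nonneg[of 0 s] qflat_nonneg[of 0 "1 - s"]
    by (simp_all add: rstep_def)
qed

lemma symb_real_affine:
  fixes f :: "real \<Rightarrow> complex" and l :: "'a::euclidean_space"
  assumes "symb1 k I (\<lambda>_. f)"
  shows "symb1 k I (\<lambda>_ z. f (a + l \<bullet> z))"
proof (rule symb_affine[OF assms, where L = "\<lambda>_ z. l \<bullet> z" and D = "norm l"])
  show "\<bar>(l \<bullet> v) \<bullet> e\<bar> * 1 \<le> norm l * 1" if "v \<in> Basis" "e \<in> Basis" for v :: 'a and e :: real
    using that Basis_le_norm[of v l] by simp
qed (auto intro!: derivative_eq_intros)

lemma rstep_symb: "symb1 k I (\<lambda>_ s. complex_of_real (rstep s))"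
proof -
  have q': "symb1 k I (\<lambda>_ s. complex_of_real (qflat 0 (1 - s)))"
    using symb_real_affine[OF qflat_symb[of k I 0], of 1 "- 1 :: real"] by simp
  have "symb1 k I (\<lambda>_ s. complex_of_real (qflat 0 s) + complex_of_real (qflat 0 (1 - s)))"
    by (rule symb_add[OF qflat_symb q'])
  then have "symb1 k I (\<lambda>_ s. inverse (complex_of_real (qflat 0 s) + complex_of_real (qflat 0 (1 - s))))"
  proof (rule symb_inverse[where \<epsilon> = "exp (- 2)"])
    fix s show "exp (- 2) \<le> cmod (complex_of_real (qflat 0 s) + complex_of_real (qflat 0 (1 - s)))"
      unfolding of_real_add[symmetric] norm_of_real using qflat_0_lower[of s] by (rule order_trans) simp
  qed auto
  from symb_mult[OF qflat_symb[of k I 0] this] show ?thesis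
    by (simp add: rstep_def divide_inverse)
qed

definition rcut :: "real \<Rightarrow> real" where
  "rcut s = rstep (2 - s) * rstep (2 + s)"

lemma rcut_1: "\<bar>s\<bar> \<le> 1 \<Longrightarrow> rcut s = 1" and rcut_0: "2 \<le> \<bar>s\<bar> \<Longrightarrow> rcut s = 0"
  and rcut_nonneg: "0 \<le> rcut s" and rcut_le_1: "rcut s \<le> 1"
  using rstep_0[of "2 - s"] rstep_0[of "2 + s"]
  by (auto simp: rcut_def rstep_1 rstep_nonneg rstep_le_1 mult_le_one abs_if split: if_splits)

lemma rcut_symb: "symb1 k I (\<lambda>_ s. complex_of_real (rcut s))"
  using symb_mult[OF symb_real_affine[OF rstep_symb[of k I], of 2 "- 1 :: real"]
    symb_real_affine[OF rstep_symb[of k I], of 2 "1 :: real"]]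
  by (simp add: rcut_def)

text \<open>Boxes rather than balls: leaving the region where the cutoff is 1 is then witnessed by a
  single coordinate.\<close>

definition boxcut :: "real \<Rightarrow> 'a::euclidean_space \<Rightarrow> 'a \<Rightarrow> complex" where
  "boxcut d a x = complex_of_real (\<Prod>e\<in>Basis. rcut ((x - a) \<bullet> e / d))"

lemma boxcut_1:
  assumes "d > 0" "\<And>e. e \<in> Basis \<Longrightarrow> \<bar>(x - a) \<bullet> e\<bar> \<le> d"
  shows "boxcut d a x = 1"
proof -
  have "(\<Prod>e\<in>Basis. rcut ((x - a) \<bullet> e / d)) = 1"
    by (rule prod.neutral) (use assms in \<open>auto intro!: rcut_1\<close>)
  then show ?thesis by (simp add: boxcut_def)
qed

lemma boxcut_0:
  assumes "d > 0" "e \<in> Basis" "2 * d \<le> \<bar>(x - a) \<bullet> e\<bar>"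
  shows "boxcut d a x = 0"
proof -
  have "rcut ((x - a) \<bullet> e / d) = 0" using assms by (intro rcut_0) (simp add: field_simps)
  then have "(\<Prod>e\<in>Basis. rcut ((x - a) \<bullet> e / d)) = 0" using assms(2) by (intro prod_zero) auto
  then show ?thesis by (simp add: boxcut_def)
qed

lemma boxcut_cmod_le_1: "cmod (boxcut d a x) \<le> 1"
  unfolding boxcut_def norm_of_real abs_prod by (intro prod_le_1) (simp add: rcut_nonneg rcut_le_1)

lemma one_minus_boxcut_cmod_le_1: "cmod (1 - boxcut d a x) \<le> 1"
proof -
  have "0 \<le> (\<Prod>e\<in>Basis. rcut ((x - a) \<bullet> e / d))" "(\<Prod>e\<in>Basis. rcut ((x - a) \<bullet> e / d)) \<le> 1"
    by (auto intro!: prod_nonneg prod_le_1 simp: rcut_nonneg rcut_le_1)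
  moreover have "1 - boxcut d a x = complex_of_real (1 - (\<Prod>e\<in>Basis. rcut ((x - a) \<bullet> e / d)))" by (simp add: boxcut_def)
  ultimately show ?thesis by (simp only: norm_of_real)
qed

lemma boxcut_symb: "symb1 k I (\<lambda>_. boxcut d (a :: 'a::euclidean_space))"
proof -
  have "symb1 k I (\<lambda>_ x. complex_of_real (rcut ((x - a) \<bullet> e / d)))" for e
    using symb_real_affine[OF rcut_symb[of k I], of "- (a \<bullet> e / d)" "e /\<^sub>R d"]
    by (simp add: inner_diff_left inner_commute[of e] divide_inverse algebra_simps)
  from symb_prod[OF finite_Basis this] show ?thesis unfolding boxcut_def[abs_def] by simp
qed

lemma boxcut_continuous: "continuous_on S (boxcut d a)"
  using symb_continuous_on[OF boxcut_symb[of "Suc 0" "{()}"]] by blast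

lemma boxcut_support:
  assumes "d > 0" "boxcut d (a :: 'a::euclidean_space) x \<noteq> 0"
  shows "norm (x - a) \<le> real DIM('a) * (2 * d)"
proof -
  have "norm (x - a) \<le> (\<Sum>e\<in>Basis. \<bar>(x - a) \<bullet> e\<bar>)" by (rule norm_le_l1)
  also have "\<dots> \<le> (\<Sum>e\<in>(Basis :: 'a set). 2 * d)"
    using boxcut_0[OF assms(1), of _ x a] assms(2) by (intro sum_mono) (meson linear)
  finally show ?thesis by simp
qed

subsection \<open>Integral operators on \<open>L\<^sup>2\<close>\<close>

text \<open>Rests on \<open>cmod (u y) \<le> 1 + (cmod (u y))\<^sup>2\<close>: multiplied by
  \<open>decay\<close>, the first term is integrable because \<open>decay\<close> is, the second
  because \<open>decay\<close> is at most 1.\<close>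

lemma kernel_integrable:
  fixes k :: "'a::euclidean_space \<Rightarrow> complex"
  assumes k: "k \<in> borel_measurable borel" "\<And>y. cmod (k y) \<le> C * decay (x - y)" and u: "L2 u"
  shows "integrable lborel (\<lambda>y. k y * u y)" "integrable lborel (\<lambda>y. decay (x - y) * cmod (u y))"
    "integrable lborel (\<lambda>y. decay (x - y) * (cmod (u y))\<^sup>2)"
proof -
  have [measurable]: "u \<in> borel_measurable borel" and ui: "integrable lborel (\<lambda>y. (cmod (u y))\<^sup>2)"
    using u by (auto simp: L2_def)
  note [measurable] = k(1)
  have C: "C \<ge> 0" using k(2)[of x] decay_pos[of 0]
    by (metis diff_self norm_ge_zero order_trans zero_le_mult_iff not_less)
  have young: "decay (x - y) * cmod (u y) \<le> decay (x - y) + (cmod (u y))\<^sup>2" for y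
  proof -
    have "decay (x - y) * cmod (u y) \<le> decay (x - y) * (1 + (cmod (u y))\<^sup>2)"
    proof (intro mult_left_mono decay_nonneg)
      have "0 \<le> (cmod (u y) - 1/2)\<^sup>2 + 3/4" by simp
      then show "cmod (u y) \<le> 1 + (cmod (u y))\<^sup>2" by (simp add: power2_eq_square algebra_simps)
    qed
    also have "\<dots> \<le> decay (x - y) + 1 * (cmod (u y))\<^sup>2"
      unfolding distrib_left using decay_le_1[of "x - y"] by (intro add_mono mult_right_mono) auto
    finally show ?thesis by simp
  qed
  show 1: "integrable lborel (\<lambda>y. decay (x - y) * cmod (u y))"
  proof (rule Bochner_Integration.integrable_bound)
    show "integrable lborel (\<lambda>y. decay (x - y) + (cmod (u y))\<^sup>2)"
      by (intro Bochner_Integration.integrable_add decay_integrable_minus ui)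
    show "AE y in lborel. norm (decay (x - y) * cmod (u y)) \<le> norm (decay (x - y) + (cmod (u y))\<^sup>2)"
      using young by (intro AE_I2) (simp add: decay_nonneg)
  qed measurable
  show "integrable lborel (\<lambda>y. k y * u y)"
  proof (rule Bochner_Integration.integrable_bound)
    show "integrable lborel (\<lambda>y. C * (decay (x - y) * cmod (u y)))" using 1 by simp
    show "AE y in lborel. norm (k y * u y) \<le> norm (C * (decay (x - y) * cmod (u y)))"
      using mult_right_mono[OF k(2) norm_ge_zero] C
      by (intro AE_I2) (simp add: norm_mult decay_nonneg mult.assoc)
  qed measurable
  show "integrable lborel (\<lambda>y. decay (x - y) * (cmod (u y))\<^sup>2)"
  proof (rule Bochner_Integration.integrable_bound[OF ui])
    show "AE y in lborel. norm (decay (x - y) * (cmod (u y))\<^sup>2) \<le> norm ((cmod (u y))\<^sup>2)"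
      using mult_right_mono[OF decay_le_1 zero_le_power2] by (intro AE_I2) (simp add: decay_nonneg)
  qed measurable
qed

text \<open>Schur's test with a convolution majorant: Cauchy-Schwarz with respect to the weight
  \<open>decay (x - y)\<close> bounds the square of the integral by \<open>c0 * g x\<close>, and
  Fubini gives the integral of \<open>g\<close>.\<close>

lemma kernel_operator_L2:
  fixes k :: "'a::euclidean_space \<Rightarrow> 'a \<Rightarrow> complex"
  assumes k: "(\<lambda>(x, y). k x y) \<in> borel_measurable (borel \<Otimes>\<^sub>M borel)" "\<And>x y. cmod (k x y) \<le> C * decay (x - y)"
  shows "L2_bounded_operator (\<lambda>u x. LINT y|lborel. k x y * u y)"
proof -
  define c0 where "c0 = (LINT y|lborel. decay (y :: 'a))"
  have c0: "0 \<le> c0" unfolding c0_def by (simp add: decay_nonneg)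
  have C: "C \<ge> 0" using k(2)[of 0 0] decay_pos[of "0 :: 'a"]
    by (metis diff_self norm_ge_zero order_trans zero_le_mult_iff not_less)
  note km[measurable] = k(1)
  have k1: "k x \<in> borel_measurable borel" for x
    using measurable_Pair2[OF km, of x] by simp
  have main: "L2 (\<lambda>x. LINT y|lborel. k x y * u y) \<and>
      L2_norm (\<lambda>x. LINT y|lborel. k x y * u y) \<le> (C * c0) * L2_norm u" if u: "L2 u" for u
  proof -
    note int = kernel_integrable[OF k1 k(2) u]
    have um[measurable]: "u \<in> borel_measurable borel" and ui: "integrable lborel (\<lambda>y. (cmod (u y))\<^sup>2)"
      using u by (auto simp: L2_def)
    define g where "g x = (LINT y|lborel. decay (x - y) * (cmod (u y))\<^sup>2)" for x
    define p where "p x = (LINT y|lborel. decay (x - y) * cmod (u y))" for x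
    have cs: "(p x)\<^sup>2 \<le> c0 * g x" for x
    proof (cases "c0 = 0")
      case True
      \<comment> \<open>A vanishing \<open>c0\<close> would force the positive function
        \<open>decay\<close> to be 0 almost everywhere; the claim follows from this
        absurdity.\<close>
      have "AE y in lborel. decay (y :: 'a) = 0"
        using integral_nonneg_eq_0_iff_AE[OF decay_integrable] True unfolding c0_def by (auto simp: decay_nonneg)
      moreover have "decay (y :: 'a) \<noteq> 0" for y using decay_pos[of y] by simp
      ultimately have "AE y in (lborel :: 'a measure). False" by simp
      then have "p x = 0" unfolding p_def by (intro integral_eq_zero_AE) (auto elim!: eventually_mono)
      then show ?thesis using True by simp
    next
      case False
      \<comment> \<open>The minimizer of the integral of
        \<open>decay (x - y) * (cmod (u y) - a)\<^sup>2\<close>; that the minimum is nonnegative is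
        the Cauchy-Schwarz inequality.\<close>
      define a where "a = p x / c0"
      have "0 \<le> (LINT y|lborel. decay (x - y) * (cmod (u y) - a)\<^sup>2)"
        by (intro integral_nonneg_AE AE_I2) (simp add: decay_nonneg)
      also have "(\<lambda>y. decay (x - y) * (cmod (u y) - a)\<^sup>2) =
          (\<lambda>y. decay (x - y) * (cmod (u y))\<^sup>2 - 2 * a * (decay (x - y) * cmod (u y)) + a\<^sup>2 * decay (x - y))"
        by (auto simp: power2_eq_square algebra_simps)
      also have "(LINT y|lborel. decay (x - y) * (cmod (u y))\<^sup>2 - 2 * a * (decay (x - y) * cmod (u y)) + a\<^sup>2 * decay (x - y)) =
          g x - 2 * a * p x + a\<^sup>2 * c0"
        using int(2,3) decay_integrable_minus[of x]
        by (simp add: g_def p_def c0_def decay_integral_minus)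
      finally have "0 \<le> g x - (p x)\<^sup>2 / c0" using False by (simp add: a_def power2_eq_square field_simps)
      then show ?thesis using False c0 by (simp add: field_simps)
    qed
    have bound: "cmod (LINT y|lborel. k x y * u y) \<le> C * p x" for x
    proof -
      have "cmod (LINT y|lborel. k x y * u y) \<le> (LINT y|lborel. C * (decay (x - y) * cmod (u y)))"
        by (rule integral_cmod_bound) (use int(2) mult_right_mono[OF k(2) norm_ge_zero] in \<open>auto simp: norm_mult mult.assoc\<close>)
      then show ?thesis by (simp add: p_def)
    qed
    have shift: "integrable lborel (\<lambda>x. decay (x - y))" "(LINT x|lborel. decay (x - y)) = c0" for y :: 'a
      using decay_integrable_minus[of y] decay_integral_minus[of y] by (simp_all add: decay_minus[of y] c0_def)
    have pi: "integrable (lborel \<Otimes>\<^sub>M lborel) (\<lambda>(y, x). decay (x - y) * (cmod (u y))\<^sup>2)"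
    proof (rule lborel_pair.Fubini_integrable)
      show "(\<lambda>(y, x). decay (x - y) * (cmod (u y))\<^sup>2) \<in> borel_measurable (lborel \<Otimes>\<^sub>M lborel)" by measurable
      have "(LINT x|lborel. norm (decay (x - y) * (cmod (u y))\<^sup>2)) = c0 * (cmod (u y))\<^sup>2" for y
        using shift by (simp add: decay_nonneg abs_mult)
      then show "integrable lborel (\<lambda>y. LINT x|lborel. norm ((\<lambda>(y, x). decay (x - y) * (cmod (u y))\<^sup>2) (y, x)))"
        using ui by simp
      show "AE y in lborel. integrable lborel (\<lambda>x. (\<lambda>(y, x). decay (x - y) * (cmod (u y))\<^sup>2) (y, x))"
        using shift by simp
    qed
    have gi: "integrable lborel g" and gI: "(LINT x|lborel. g x) = c0 * (LINT y|lborel. (cmod (u y))\<^sup>2)"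
    proof -
      show "integrable lborel g" using lborel_pair.integrable_snd[OF pi] by (simp add: g_def[abs_def])
      have "(LINT x|lborel. g x) = (LINT y|lborel. LINT x|lborel. decay (x - y) * (cmod (u y))\<^sup>2)"
        unfolding g_def using lborel_pair.Fubini_integral[OF pi] by simp
      also have "\<dots> = (LINT y|lborel. c0 * (cmod (u y))\<^sup>2)"
        using shift by simp
      finally show "(LINT x|lborel. g x) = c0 * (LINT y|lborel. (cmod (u y))\<^sup>2)" by simp
    qed
    have sq: "(cmod (LINT y|lborel. k x y * u y))\<^sup>2 \<le> C\<^sup>2 * c0 * g x" for x
    proof -
      have "(cmod (LINT y|lborel. k x y * u y))\<^sup>2 \<le> (C * p x)\<^sup>2" by (intro power_mono bound) simp
      also have "\<dots> \<le> C\<^sup>2 * (c0 * g x)" unfolding power_mult_distrib by (intro mult_left_mono cs) simp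
      finally show ?thesis by (simp add: mult.assoc)
    qed
    have m[measurable]: "(\<lambda>x. LINT y|lborel. k x y * u y) \<in> borel_measurable borel" by measurable
    have i2: "integrable lborel (\<lambda>x. (cmod (LINT y|lborel. k x y * u y))\<^sup>2)"
    proof (rule Bochner_Integration.integrable_bound)
      show "integrable lborel (\<lambda>x. C\<^sup>2 * c0 * g x)" using gi by simp
      show "AE x in lborel. norm ((cmod (LINT y|lborel. k x y * u y))\<^sup>2) \<le> norm (C\<^sup>2 * c0 * g x)"
        using sq by (intro AE_I2) (auto intro: order_trans[OF _ abs_ge_self])
    qed measurable
    have "(LINT x|lborel. (cmod (LINT y|lborel. k x y * u y))\<^sup>2) \<le> (LINT x|lborel. C\<^sup>2 * c0 * g x)"
      by (rule integral_mono[OF i2 _ sq]) (use gi in simp)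
    also have "\<dots> = (C * c0)\<^sup>2 * (LINT y|lborel. (cmod (u y))\<^sup>2)" by (simp add: gI power2_eq_square)
    finally have "L2_norm (\<lambda>x. LINT y|lborel. k x y * u y) \<le> sqrt ((C * c0)\<^sup>2 * (LINT y|lborel. (cmod (u y))\<^sup>2))"
      unfolding L2_norm_def by (rule real_sqrt_le_mono)
    also have "\<dots> = (C * c0) * L2_norm u" unfolding L2_norm_def real_sqrt_mult using C c0 by simp
    finally show ?thesis using i2 by (simp add: L2_def)
  qed
  show ?thesis unfolding L2_bounded_operator_def
  proof (intro conjI allI impI)
    show "\<exists>D. \<forall>u. L2 u \<longrightarrow> L2_norm (\<lambda>x. LINT y|lborel. k x y * u y) \<le> D * L2_norm u" using main by blast
    show "L2 (\<lambda>x. LINT y|lborel. k x y * u y)" if "L2 u" for u using main[OF that] by blast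
    fix u v :: "'a \<Rightarrow> complex" and \<alpha> \<beta> assume "L2 u" "L2 v"
    then have "(LINT y|lborel. k x y * (\<alpha> * u y + \<beta> * v y)) = \<alpha> * (LINT y|lborel. k x y * u y) + \<beta> * (LINT y|lborel. k x y * v y)" for x
      using kernel_integrable(1)[OF k1[of x] k(2)[of x]] by (simp add: distrib_left mult.left_commute)
    then show "AE x in lborel. (LINT y|lborel. k x y * (\<alpha> * u y + \<beta> * v y)) = \<alpha> * (LINT y|lborel. k x y * u y) + \<beta> * (LINT y|lborel. k x y * v y)"
      by simp
  qed
qed

subsection \<open>Non-stationary phase\<close>

text \<open>Uniform in the shift \<open>p i\<close>, which will be the point \<open>x\<close> at
  which the operator is evaluated: derivatives in \<open>y\<close> see only the factor
  \<open>1 - t\<close>.\<close>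

lemma boxcut_affine_symb:
  fixes t :: real and a :: "'a::euclidean_space" and p :: "'i \<Rightarrow> 'a"
  assumes "0 \<le> t" "t \<le> 1"
  shows "symb1 k I (\<lambda>i y. boxcut d a (t *\<^sub>R p i + (1 - t) *\<^sub>R y))"
proof (rule symb_affine[OF boxcut_symb, where L = "\<lambda>_ y. (1 - t) *\<^sub>R y" and D = 1])
  show "\<bar>(1 - t) *\<^sub>R v \<bullet> e\<bar> * 1 \<le> 1 * 1" if "v \<in> Basis" "e \<in> Basis" for v e :: 'a
    using that assms by (auto simp: inner_Basis)
qed (auto intro!: derivative_eq_intros)

context wkb
begin

lemma b_bound: "\<exists>B\<ge>0. \<forall>y. cmod (b y) \<le> B"
  using symb_bound[OF bsymb[of 0 "{()}"]] by (auto simp: bdd_by_def)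

definition osc_phase :: "real \<Rightarrow> real ^ 'n \<Rightarrow> real ^ 'n \<Rightarrow> complex" where
  "osc_phase h \<xi> y = exp (\<i> / complex_of_real h * (\<phi> y - complex_of_real (\<xi> \<bullet> y)))"

lemma osc_phase_der:
  "(osc_phase h \<xi> has_derivative (\<lambda>v. osc_phase h \<xi> y * (\<i> / complex_of_real h * (dd v \<phi> y - complex_of_real (\<xi> \<bullet> v))))) (at y)"
proof -
  have "((\<lambda>y. \<i> / complex_of_real h * (\<phi> y - complex_of_real (\<xi> \<bullet> y))) has_derivative
      (\<lambda>v. \<i> / complex_of_real h * (dd v \<phi> y - complex_of_real (\<xi> \<bullet> v)))) (at y)"
    by (intro has_derivative_mult_right has_derivative_diff phi_der has_derivative_of_real)
      (auto intro!: derivative_eq_intros)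
  from has_derivative_compose[OF this DERIV_exp[unfolded has_field_derivative_def]]
  show ?thesis unfolding osc_phase_def[abs_def] by simp
qed

lemma osc_phase_continuous: "continuous_on S (osc_phase h \<xi>)"
  by (meson continuous_at_imp_continuous_on has_derivative_continuous osc_phase_der)

lemma osc_phase_le_1: "h > 0 \<Longrightarrow> cmod (osc_phase h \<xi> y) \<le> 1"
  using Im\<phi>[of y] by (simp add: osc_phase_def norm_exp_eq_Re)

text \<open>
  \<open>Q\<close> extends the derivative \<open>\<partial>\<^sub>e\<phi> - \<xi> \<bullet> e\<close> of the phase from \<open>S\<close> to a function
  that vanishes nowhere, so that one can divide by it globally.
\<close>

lemma nonstationary_phase:
  fixes Q a :: "'i \<Rightarrow> real ^ 'n \<Rightarrow> complex" and \<xi> :: "'i \<Rightarrow> real ^ 'n"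
  assumes e: "e \<in> Basis"
    and Q: "\<And>k. symb1 k I Q" "q > 0" "\<And>i y. i \<in> I \<Longrightarrow> q \<le> cmod (Q i y)"
    and S: "closed S" "bounded S" "\<And>i y. i \<in> I \<Longrightarrow> y \<in> S \<Longrightarrow> Q i y = dd e \<phi> y - complex_of_real (\<xi> i \<bullet> e)"
    and a: "\<And>k. symb1 k I a" "\<And>i y. i \<in> I \<Longrightarrow> y \<notin> S \<Longrightarrow> a i y = 0"
  shows "\<exists>C\<ge>0. \<forall>i\<in>I. \<forall>h>0. cmod (LINT y|lborel. a i y * osc_phase h (\<xi> i) y) \<le> C * h ^ N"
  using a
proof (induction N arbitrary: a)
  obtain R where R: "\<And>y. y \<in> S \<Longrightarrow> norm y \<le> R" using S(2) bounded_iff by blast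
  { case 0
    obtain C where C: "C \<ge> 0" "\<And>i y. i \<in> I \<Longrightarrow> cmod (a i y) \<le> C * 1"
      by (rule bdd_byE[OF symb_bound[OF 0(1)[of 0]]]) (rule that)
    have "cmod (LINT y|lborel. a i y * osc_phase h (\<xi> i) y) \<le> (LINT y|lborel. C * indicator (cball 0 R) (y :: real ^ 'n)) * h ^ 0"
      if "i \<in> I" "h > 0" for i h
      unfolding power_0 mult_1_right
    proof (rule integral_cmod_bound)
      show "integrable lborel (\<lambda>y :: real ^ 'n. C * indicator (cball 0 R) y)"
        by (intro integrable_mult_right integrable_indicator_cball)
      show "cmod (a i y * osc_phase h (\<xi> i) y) \<le> C * indicator (cball 0 R) y" for y
      proof (cases "y \<in> S")
        case True
        have "cmod (a i y) * cmod (osc_phase h (\<xi> i) y) \<le> C * 1"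
          using C(2)[OF that(1), of y] C(1) osc_phase_le_1[OF that(2)] by (intro mult_mono) auto
        then show ?thesis using R[OF True] by (simp add: norm_mult)
      next
        case False
        then show ?thesis using 0(2)[OF that(1)] C(1) by simp
      qed
    qed
    moreover have "0 \<le> (LINT y|lborel. C * indicator (cball 0 R) (y :: real ^ 'n))" using C(1) by simp
    ultimately show ?case by blast }
  { case (Suc N)
    \<comment> \<open>On \<open>S\<close>, \<open>a\<close> times the exponential is
      \<open>h / \<i>\<close> times \<open>g\<close> times the \<open>e\<close>-derivative of the
      exponential. Moving the derivative to \<open>g\<close> gains one factor \<open>h\<close>, and
      \<open>dd e (g i)\<close> is again an admissible amplitude for the induction.\<close>
    define g where "g i y = a i y * inverse (Q i y)" for i y
    have g: "symb1 k I g" for k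
      using symb_mult[OF Suc.prems(1) symb_inverse[OF Q]] unfolding g_def[abs_def] by simp
    have g0: "g i y = 0" if "i \<in> I" "y \<notin> S" for i y using Suc.prems(2)[OF that] by (simp add: g_def)
    have dg: "symb1 k I (\<lambda>i. dd e (g i))" for k using symb_dd[OF g e] by simp
    have dg0: "dd e (g i) y = 0" if "i \<in> I" "y \<notin> S" for i y
      by (rule dd_eq_0_outside[OF S(1) g0[OF that(1)] that(2)])
    obtain C where C: "C \<ge> 0" "\<And>i h. i \<in> I \<Longrightarrow> h > 0 \<Longrightarrow> cmod (LINT y|lborel. dd e (g i) y * osc_phase h (\<xi> i) y) \<le> C * h ^ N"
      using Suc.IH[OF dg dg0] by blast
    have "cmod (LINT y|lborel. a i y * osc_phase h (\<xi> i) y) \<le> C * h ^ Suc N" if i: "i \<in> I" and h: "h > 0" for i h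
    proof -
      let ?E = "osc_phase h (\<xi> i)"
      have ca: "continuous_on UNIV (a i)" and cg: "continuous_on UNIV (g i)" and cdg: "continuous_on UNIV (dd e (g i))"
        using symb_continuous_on[OF Suc.prems(1) i] symb_continuous_on[OF g i] symb_continuous_on[OF dg i] by auto
      have i1: "integrable lborel (\<lambda>y. a i y * ?E y)" and i2: "integrable lborel (\<lambda>y. g i y * ?E y)"
        and i3: "integrable lborel (\<lambda>y. dd e (g i) y * ?E y)"
      proof -
        have out: "y \<notin> S" if "norm y > R" for y using R[of y] that by linarith
        show "integrable lborel (\<lambda>y. a i y * ?E y)" "integrable lborel (\<lambda>y. g i y * ?E y)"
          "integrable lborel (\<lambda>y. dd e (g i) y * ?E y)"
          by (rule integrable_compact_support[where R = R];
              simp add: Suc.prems(2)[OF i out] g0[OF i out] dg0[OF i out] continuous_on_mult ca cg cdg osc_phase_continuous)+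
      qed
      have der: "((\<lambda>y. g i y * ?E y) has_derivative (\<lambda>v. g i y * (?E y * (\<i> / complex_of_real h * (dd v \<phi> y - complex_of_real (\<xi> i \<bullet> v)))) + dd v (g i) y * ?E y)) (at y)" for y
        by (intro has_derivative_mult osc_phase_der dd_works symb_differentiable[OF g i])
      have eq: "dd e (\<lambda>y. g i y * ?E y) = (\<lambda>y. \<i> / complex_of_real h * (a i y * ?E y) + dd e (g i) y * ?E y)"
      proof
        fix y
        \<comment> \<open>On \<open>S\<close>, \<open>Q\<close> is the true derivative of the phase;
          off \<open>S\<close> both sides vanish.\<close>
        have "g i y * (dd e \<phi> y - complex_of_real (\<xi> i \<bullet> e)) = a i y"
        proof (cases "y \<in> S")
          case True
          have "Q i y \<noteq> 0" using Q(2) Q(3)[OF i, of y] by auto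
          then show ?thesis using S(3)[OF i True] by (simp add: g_def)
        next
          case False
          then show ?thesis using g0[OF i] Suc.prems(2)[OF i] by simp
        qed
        note G = this[symmetric]
        show "dd e (\<lambda>y. g i y * ?E y) y = \<i> / complex_of_real h * (a i y * ?E y) + dd e (g i) y * ?E y"
          unfolding dd_eqI[OF der] G by (simp only: mult_ac)
      qed
      have "(LINT y|lborel. dd e (\<lambda>y. g i y * ?E y) y) = 0"
      proof (rule integral_dd_eq_0[OF differentiableI_der[OF der] _ i2])
        show "continuous_on UNIV (dd e (\<lambda>y. g i y * ?E y))"
          unfolding eq by (intro continuous_intros ca cdg osc_phase_continuous)
        show "integrable lborel (dd e (\<lambda>y. g i y * ?E y))" unfolding eq using i1 i3 by simp
      qed
      then have "\<i> / complex_of_real h * (LINT y|lborel. a i y * ?E y) + (LINT y|lborel. dd e (g i) y * ?E y) = 0"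
        unfolding eq using i1 i3 by simp
      then have "(LINT y|lborel. a i y * ?E y) = \<i> * complex_of_real h * (LINT y|lborel. dd e (g i) y * ?E y)"
        using h by (simp add: field_simps add_eq_0_iff)
      then have "cmod (LINT y|lborel. a i y * ?E y) = h * cmod (LINT y|lborel. dd e (g i) y * ?E y)"
        using h by (simp add: norm_mult)
      also have "\<dots> \<le> h * (C * h ^ N)" using h by (intro mult_left_mono C(2)[OF i h]) simp
      finally show ?thesis by (simp add: mult_ac)
    qed
    then show ?case using C(1) by blast }
qed

end

section \<open>Contribution of the points near x0\<close>

locale wkb_regular = wkb b \<phi> h0 for b \<phi> :: "real ^ 'n \<Rightarrow> complex" and h0 :: real +
  fixes t :: real and x0 \<xi>0 :: "real ^ 'n"
  assumes t: "0 \<le> t" "t \<le> 1"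
    and regular: "x0 \<notin> supp b \<or> Im (\<phi> x0) \<noteq> 0 \<or> complex_vec \<xi>0 \<noteq> grad \<phi> x0"
begin

text \<open>Radii: the cutoff at the intermediate point
  \<open>t *\<^sub>R x + (1 - t) *\<^sub>R y\<close> lives where all coordinates differ from those
  of \<open>x0\<close> by less than \<open>d / 4\<close>, while the cutoff in \<open>y\<close> is 1
  up to \<open>d / 2\<close>. Where the latter is not 1, \<open>x\<close> and \<open>y\<close> are
  at least \<open>d / 4\<close> apart, as \<open>far_kernel\<close> exploits.\<close>

definition near_part :: "real \<Rightarrow> real \<Rightarrow> real ^ 'n \<Rightarrow> real ^ 'n \<Rightarrow> complex" where
  "near_part d h x \<xi> = (LINT y|lborel. osc ((x - y) /\<^sub>R h) \<xi> * (boxcut (d / 8) x0 (t *\<^sub>R x + (1 - t) *\<^sub>R y) * boxcut (d / 2) x0 y * u h y))"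

text \<open>Uniformity in \<xi> lets the bound be integrated against the frequency cutoff, which
  vanishes outside the box of half-width \<open>d\<close>.\<close>

definition near_negligible :: "real \<Rightarrow> bool" where
  "near_negligible d \<longleftrightarrow> (\<forall>N. \<exists>C\<ge>0. \<forall>h x \<xi>. 0 < h \<longrightarrow> h < h0 \<longrightarrow> (\<forall>e\<in>Basis. \<bar>(\<xi> - \<xi>0) \<bullet> e\<bar> \<le> d) \<longrightarrow>
    cmod (near_part d h x \<xi>) \<le> C * h ^ N)"

text \<open>Exponential smallness beats all powers: \<open>exp (- (\<epsilon> / h))\<close> is at
  most \<open>fact N / \<epsilon> ^ N * h ^ N\<close>. The oscillation is simply bounded by
  1.\<close>

lemma near_negligible_small:
  assumes r: "r > 0" and \<epsilon>: "\<epsilon> > 0"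
    and small: "\<And>h y. 0 < h \<Longrightarrow> norm (y - x0) < r \<Longrightarrow> cmod (u h y) \<le> B * exp (- (\<epsilon> / h))"
  shows "\<exists>d>0. near_negligible d"
proof -
  \<comment> \<open>By \<open>boxcut_support\<close> the cutoff in \<open>y\<close> then lives
    within distance \<open>r / 2\<close> of \<open>x0\<close>.\<close>
  define d where "d = r / (2 * real CARD('n))"
  have d: "d > 0" using r by (simp add: d_def)
  have supp: "norm (y - x0) < r" if "boxcut (d / 2) x0 y \<noteq> 0" for y
    using boxcut_support[OF _ that] d r by (simp add: d_def field_simps)
  have "0 \<le> B * exp (- (\<epsilon> / 1))" using order_trans[OF norm_ge_zero small[of 1 x0]] r by simp
  then have B: "B \<ge> 0" by (simp add: zero_le_mult_iff)
  define V where "V = (LINT y|lborel. indicator (cball x0 r) (y :: real ^ 'n) :: real)"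
  have V: "V \<ge> 0" by (simp add: V_def)
  have "\<exists>C\<ge>0. \<forall>h x \<xi>. 0 < h \<longrightarrow> h < h0 \<longrightarrow> (\<forall>e\<in>Basis. \<bar>(\<xi> - \<xi>0) \<bullet> e\<bar> \<le> d) \<longrightarrow>
    cmod (near_part d h x \<xi>) \<le> C * h ^ N" for N
  proof (intro exI[of _ "B * (fact N / \<epsilon> ^ N) * V"] conjI allI impI)
    fix h :: real and x \<xi> assume h: "0 < h"
    have "cmod (near_part d h x \<xi>) \<le> (LINT y|lborel. B * exp (- (\<epsilon> / h)) * indicator (cball x0 r) y)"
      unfolding near_part_def
    proof (rule integral_cmod_bound)
      show "integrable lborel (\<lambda>y :: real ^ 'n. B * exp (- (\<epsilon> / h)) * indicator (cball x0 r) y)"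
        by (intro integrable_mult_right integrable_indicator_cball)
      fix y
      show "cmod (osc ((x - y) /\<^sub>R h) \<xi> * (boxcut (d / 8) x0 (t *\<^sub>R x + (1 - t) *\<^sub>R y) * boxcut (d / 2) x0 y * u h y)) \<le> B * exp (- (\<epsilon> / h)) * indicator (cball x0 r) y"
      proof (cases "boxcut (d / 2) x0 y = 0")
        case False
        have "cmod (boxcut (d / 8) x0 (t *\<^sub>R x + (1 - t) *\<^sub>R y)) * cmod (boxcut (d / 2) x0 y) * cmod (u h y) \<le> 1 * 1 * (B * exp (- (\<epsilon> / h)))"
          using small[OF h supp[OF False]] by (intro mult_mono boxcut_cmod_le_1) auto
        then show ?thesis using supp[OF False] by (simp add: norm_mult dist_norm norm_minus_commute)
      qed (use B in simp)
    qed
    also have "\<dots> = B * exp (- (\<epsilon> / h)) * V" by (simp add: V_def)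
    also have "\<dots> \<le> B * (fact N / \<epsilon> ^ N * h ^ N) * V"
    proof (intro mult_right_mono mult_left_mono B V)
      have "(\<epsilon> / h) ^ N * exp (- (\<epsilon> / h)) \<le> fact N" by (rule power_exp_minus_le_fact) (use \<epsilon> h in simp)
      then show "exp (- (\<epsilon> / h)) \<le> fact N / \<epsilon> ^ N * h ^ N" using \<epsilon> h by (simp add: power_divide field_simps)
    qed
    finally show "cmod (near_part d h x \<xi>) \<le> B * (fact N / \<epsilon> ^ N) * V * h ^ N" by (simp add: mult_ac)
  qed (use B V \<epsilon> in simp)
  then show ?thesis using d unfolding near_negligible_def by blast
qed

lemma near_negligible_nonstationary:
  assumes e: "e \<in> Basis" and D0: "dd e \<phi> x0 \<noteq> complex_of_real (\<xi>0 \<bullet> e)"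
  shows "\<exists>d>0. near_negligible d"
proof -
  define D where "D = dd e \<phi> x0 - complex_of_real (\<xi>0 \<bullet> e)"
  have D: "cmod D > 0" using D0 by (simp add: D_def)
  have ds: "symb1 k I (\<lambda>_. dd e \<phi>)" for k and I :: "((real ^ 'n) \<times> (real ^ 'n)) set"
    using symb_dd[OF \<phi>symb e] by simp
  have "continuous_on UNIV (dd e \<phi>)" using symb_continuous_on[OF ds[where I = UNIV]] by blast
  then have "isCont (dd e \<phi>) x0" by (simp add: continuous_on_eq_continuous_at)
  then have "\<exists>r>0. \<forall>y. dist y x0 < r \<longrightarrow> dist (dd e \<phi> y) (dd e \<phi> x0) < cmod D / 4"
    unfolding continuous_at_eps_delta using D by (metis divide_pos_pos zero_less_numeral)
  then obtain r where r: "r > 0" "\<And>y. dist y x0 < r \<Longrightarrow> dist (dd e \<phi> y) (dd e \<phi> x0) < cmod D / 4" by blast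
  \<comment> \<open>The first entry keeps the support of \<open>boxcut d x0\<close> within
    \<open>r / 2\<close> of \<open>x0\<close>, so that \<open>dd e \<phi>\<close> varies there by at
    most \<open>cmod D / 4\<close>; the second limits the variation caused by \<xi> in the same
    way.\<close>
  define d where "d = min (r / (4 * real CARD('n))) (cmod D / 4)"
  have d: "d > 0" "d \<le> r / (4 * real CARD('n))" "d \<le> cmod D / 4" using r D by (auto simp: d_def)
  define I where "I = {(x :: real ^ 'n, \<xi>). \<bar>(\<xi> - \<xi>0) \<bullet> e\<bar> \<le> d}"
  define S where "S = {y. \<forall>f\<in>Basis. \<bar>(y - x0) \<bullet> f\<bar> \<le> d}"
  \<comment> \<open>\<open>Q\<close> interpolates between the nonzero constant \<open>D\<close> and
    the actual derivative of the phase. Where the cutoff is not 0, the bracket is at most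
    \<open>cmod D / 2\<close>; on \<open>S\<close> the cutoff is 1 and \<open>Q\<close> is the
    derivative.\<close>
  define Q where "Q i y = D + boxcut d x0 y * (dd e \<phi> y + (- dd e \<phi> x0 - complex_of_real ((snd i - \<xi>0) \<bullet> e)))" for i :: "(real ^ 'n) \<times> (real ^ 'n)" and y
  define a where "a i y = boxcut (d / 8) x0 (t *\<^sub>R fst i + (1 - t) *\<^sub>R y) * boxcut (d / 2) x0 y * b y" for i :: "(real ^ 'n) \<times> (real ^ 'n)" and y
  have "\<exists>C\<ge>0. \<forall>i\<in>I. \<forall>h>0. cmod (LINT y|lborel. a i y * osc_phase h (snd i) y) \<le> C * h ^ N" for N
  proof (rule nonstationary_phase[OF e, where Q = Q and q = "cmod D / 2" and S = S])
    fix k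
    have "symb1 k I (\<lambda>i y. - dd e \<phi> x0 - complex_of_real ((snd i - \<xi>0) \<bullet> e))"
    proof (rule symb_const[where C = "cmod (dd e \<phi> x0) + d"])
      fix i assume "i \<in> I"
      then have "cmod (complex_of_real ((snd i - \<xi>0) \<bullet> e)) \<le> d" unfolding norm_of_real by (auto simp: I_def)
      then show "cmod (- dd e \<phi> x0 - complex_of_real ((snd i - \<xi>0) \<bullet> e)) \<le> (cmod (dd e \<phi> x0) + d) * 1"
        using norm_triangle_ineq4[of "- dd e \<phi> x0" "complex_of_real ((snd i - \<xi>0) \<bullet> e)"] by (simp only: norm_minus_cancel mult_1_right)
    qed (use d in auto)
    from symb_mult[OF boxcut_symb symb_add[OF ds this]]
    have "symb1 k I (\<lambda>i y. boxcut d x0 y * (dd e \<phi> y + (- dd e \<phi> x0 - complex_of_real ((snd i - \<xi>0) \<bullet> e))))" by simp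
    moreover have "symb1 k I (\<lambda>_ _. D)" by (rule symb_const[where C = "cmod D"]) auto
    ultimately show "symb1 k I Q" unfolding Q_def[abs_def] by (intro symb_add)
    show "symb1 k I a"
      using symb_mult[OF symb_mult[OF boxcut_affine_symb[OF t, of k I "d / 8" x0 fst] boxcut_symb] bsymb] unfolding a_def[abs_def] by simp
  next
    show "cmod D / 2 > 0" using D by simp
    show "cmod D / 2 \<le> cmod (Q i y)" if i: "i \<in> I" for i y
    proof (cases "boxcut d x0 y = 0")
      case True
      then show ?thesis using D by (simp add: Q_def)
    next
      case False
      have "norm (y - x0) \<le> real CARD('n) * (2 * d)" using boxcut_support[OF d(1) False] by simp
      also have "\<dots> \<le> r / 2" using d(2) by (simp add: field_simps)
      also have "\<dots> < r" using r(1) by simp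
      finally have "cmod (dd e \<phi> y - dd e \<phi> x0) \<le> cmod D / 4" using r(2)[of y] by (simp add: dist_norm)
      moreover have "cmod (complex_of_real ((snd i - \<xi>0) \<bullet> e)) \<le> cmod D / 4"
        unfolding norm_of_real using i d(3) by (auto simp: I_def)
      ultimately have "cmod (dd e \<phi> y + (- dd e \<phi> x0 - complex_of_real ((snd i - \<xi>0) \<bullet> e))) \<le> cmod D / 2"
        using norm_triangle_ineq4[of "dd e \<phi> y - dd e \<phi> x0" "complex_of_real ((snd i - \<xi>0) \<bullet> e)"]
        by (simp add: algebra_simps)
      then have "cmod (boxcut d x0 y * (dd e \<phi> y + (- dd e \<phi> x0 - complex_of_real ((snd i - \<xi>0) \<bullet> e)))) \<le> 1 * (cmod D / 2)"
        unfolding norm_mult by (intro mult_mono boxcut_cmod_le_1) auto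
      then show ?thesis unfolding Q_def
        using norm_diff_ineq[of D "boxcut d x0 y * (dd e \<phi> y + (- dd e \<phi> x0 - complex_of_real ((snd i - \<xi>0) \<bullet> e)))"] by linarith
    qed
    have "S = (\<Inter>f\<in>Basis. {y. \<bar>(y - x0) \<bullet> f\<bar> \<le> d})" by (auto simp: S_def)
    moreover have "closed {y. \<bar>(y - x0) \<bullet> f\<bar> \<le> d}" for f by (intro closed_Collect_le continuous_intros)
    ultimately show "closed S" by auto
    show "bounded S"
    proof -
      have "norm (y - x0) \<le> (\<Sum>f\<in>(Basis :: (real ^ 'n) set). d)" if "y \<in> S" for y
        using that by (intro order_trans[OF norm_le_l1] sum_mono) (auto simp: S_def)
      then have "S \<subseteq> cball x0 (\<Sum>f\<in>(Basis :: (real ^ 'n) set). d)" by (auto simp: dist_norm norm_minus_commute)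
      then show ?thesis using bounded_cball bounded_subset by blast
    qed
    show "Q i y = dd e \<phi> y - complex_of_real (snd i \<bullet> e)" if "y \<in> S" for i y
    proof -
      have "boxcut d x0 y = 1" using that d(1) by (intro boxcut_1) (auto simp: S_def)
      then show ?thesis by (simp add: Q_def D_def inner_diff_left)
    qed
    show "a i y = 0" if "y \<notin> S" for i y
    proof -
      have "\<exists>f\<in>Basis. \<not> \<bar>(y - x0) \<bullet> f\<bar> \<le> d" using that unfolding S_def by blast
      then obtain f where "f \<in> Basis" "\<bar>(y - x0) \<bullet> f\<bar> > d" by (auto simp only: not_le)
      then have "boxcut (d / 2) x0 y = 0" using d(1) by (intro boxcut_0[of _ f]) auto
      then show ?thesis by (simp add: a_def)
    qed
  qed
  note bound = this
  have "\<exists>C\<ge>0. \<forall>h x \<xi>. 0 < h \<longrightarrow> h < h0 \<longrightarrow> (\<forall>e\<in>Basis. \<bar>(\<xi> - \<xi>0) \<bullet> e\<bar> \<le> d) \<longrightarrow>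
    cmod (near_part d h x \<xi>) \<le> C * h ^ N" for N
  proof -
    obtain C where C: "C \<ge> 0" "\<And>i h. i \<in> I \<Longrightarrow> h > 0 \<Longrightarrow> cmod (LINT y|lborel. a i y * osc_phase h (snd i) y) \<le> C * h ^ N"
      using bound by blast
    show ?thesis
    proof (intro exI[of _ C] conjI allI impI C(1))
      fix h :: real and x \<xi> assume h: "0 < h" and \<xi>: "\<forall>e\<in>Basis. \<bar>(\<xi> - \<xi>0) \<bullet> e\<bar> \<le> d"
      then have i: "(x, \<xi>) \<in> I" using e by (auto simp: I_def)
      have ex: "osc ((x - y) /\<^sub>R h) \<xi> * exp (\<i> / complex_of_real h * \<phi> y) = osc (x /\<^sub>R h) \<xi> * osc_phase h \<xi> y" for y
        unfolding osc_def osc_phase_def exp_add[symmetric]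
        by (rule arg_cong[where f = exp]) (simp add: inner_diff_left inner_commute[of \<xi>] divide_inverse algebra_simps)
      have "near_part d h x \<xi> =
          (LINT y|lborel. osc (x /\<^sub>R h) \<xi> * (a (x, \<xi>) y * osc_phase h \<xi> y))"
        unfolding near_part_def
      proof (rule arg_cong[where f = "integral\<^sup>L lborel"], rule ext)
        fix y
        have "osc ((x - y) /\<^sub>R h) \<xi> * (boxcut (d / 8) x0 (t *\<^sub>R x + (1 - t) *\<^sub>R y) * boxcut (d / 2) x0 y * u h y) =
            a (x, \<xi>) y * (osc ((x - y) /\<^sub>R h) \<xi> * exp (\<i> / complex_of_real h * \<phi> y))"
          by (simp add: a_def u_def mult_ac)
        then show "osc ((x - y) /\<^sub>R h) \<xi> * (boxcut (d / 8) x0 (t *\<^sub>R x + (1 - t) *\<^sub>R y) * boxcut (d / 2) x0 y * u h y) =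
            osc (x /\<^sub>R h) \<xi> * (a (x, \<xi>) y * osc_phase h \<xi> y)"
          unfolding ex by (simp only: mult_ac)
      qed
      then show "cmod (near_part d h x \<xi>) \<le> C * h ^ N"
        using C(2)[OF i h] by (simp add: norm_mult)
    qed
  qed
  then show ?thesis using d(1) unfolding near_negligible_def by blast
qed

lemma near_negligible_exists: "\<exists>d>0. near_negligible d"
proof -
  obtain B where B: "B \<ge> 0" "\<And>y. cmod (b y) \<le> B" using b_bound by blast
  consider "x0 \<notin> supp b" | "Im (\<phi> x0) \<noteq> 0" | "complex_vec \<xi>0 \<noteq> grad \<phi> x0" using regular by blast
  then show ?thesis
  proof cases
    case 1
    have "open (- supp b)" using compact_supp_b compact_imp_closed by blast
    then obtain r where r: "r > 0" "ball x0 r \<subseteq> - supp b" using 1 open_contains_ball by blast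
    have "u h y = 0" if "norm (y - x0) < r" for h y
    proof -
      have "y \<notin> supp b" using that r(2) by (auto simp: dist_norm norm_minus_commute)
      then show ?thesis using supp_b by (auto simp: u_def)
    qed
    \<comment> \<open>Here \<open>u h\<close> vanishes identically near \<open>x0\<close>, so
      \<open>B = 0\<close> will do.\<close>
    then show ?thesis using r(1) by (intro near_negligible_small[of r 1 0]) auto
  next
    case 2
    then have pos: "Im (\<phi> x0) > 0" using Im\<phi>[of x0] by simp
    have "continuous_on UNIV \<phi>" using symb_continuous_on[OF \<phi>symb[of _ "{()}"]] by blast
    then have "isCont \<phi> x0" by (simp add: continuous_on_eq_continuous_at)
    then have "\<exists>r>0. \<forall>y. dist y x0 < r \<longrightarrow> dist (\<phi> y) (\<phi> x0) < Im (\<phi> x0) / 2"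
      unfolding continuous_at_eps_delta using pos by (metis half_gt_zero)
    then obtain r where r: "r > 0" "\<And>y. dist y x0 < r \<Longrightarrow> dist (\<phi> y) (\<phi> x0) < Im (\<phi> x0) / 2" by blast
    show ?thesis
    proof (rule near_negligible_small[of r "Im (\<phi> x0) / 2" B])
      fix h y assume h: "(0 :: real) < h" and y: "norm (y - x0) < r"
      have "\<bar>Im (\<phi> y) - Im (\<phi> x0)\<bar> < Im (\<phi> x0) / 2"
        using r(2)[of y] y abs_Im_le_cmod[of "\<phi> y - \<phi> x0"] by (simp add: dist_norm)
      then have "Im (\<phi> x0) / 2 \<le> Im (\<phi> y)" by linarith
      then have "- (Im (\<phi> y) / h) \<le> - (Im (\<phi> x0) / 2 / h)" using h by (intro le_imp_neg_le divide_right_mono) auto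
      then have "cmod (exp (\<i> / complex_of_real h * \<phi> y)) \<le> exp (- (Im (\<phi> x0) / 2 / h))"
        by (simp add: norm_exp_eq_Re)
      then show "cmod (u h y) \<le> B * exp (- (Im (\<phi> x0) / 2 / h))"
        unfolding u_def norm_mult by (intro mult_mono B) auto
    qed (use r pos in auto)
  next
    case 3
    then obtain j where "complex_vec \<xi>0 $ j \<noteq> grad \<phi> x0 $ j" by (auto simp: vec_eq_iff)
    then have "dd (axis j 1) \<phi> x0 \<noteq> complex_of_real (\<xi>0 \<bullet> axis j 1)"
      by (simp add: complex_vec_def grad_def dd_def inner_axis)
    then show ?thesis by (rule near_negligible_nonstationary[rotated]) (auto simp: Basis_vec_def)
  qed
qed

end

text \<open>Dividing by \<open>h\<close> improves the decay if \<open>h \<le> 1\<close>. As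
  \<open>h0\<close> may exceed 1, each coordinate costs a factor
  \<open>max 1 (h0\<^sup>2)\<close>.\<close>

lemma decay_scale:
  fixes w :: "'a::euclidean_space"
  assumes "0 < h" "h < h0"
  shows "decay (w /\<^sub>R h) \<le> (max 1 (h0\<^sup>2)) ^ DIM('a) * decay w"
proof -
  have "inverse (1 + (a / h)\<^sup>2) \<le> max 1 (h0\<^sup>2) * inverse (1 + a\<^sup>2)" for a :: real
  proof -
    have "h\<^sup>2 \<le> max 1 (h0\<^sup>2)" using assms by (intro max.coboundedI2 power_mono) auto
    then have "(a / h)\<^sup>2 * h\<^sup>2 \<le> (a / h)\<^sup>2 * max 1 (h0\<^sup>2)" by (intro mult_left_mono) auto
    then have "1 + a\<^sup>2 \<le> max 1 (h0\<^sup>2) * (1 + (a / h)\<^sup>2)"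
      using assms by (simp add: power_divide distrib_left mult.commute)
    then show ?thesis using one_plus_sq_pos[of a] one_plus_sq_pos[of "a / h"] by (simp add: divide_simps mult_ac)
  qed
  then have "(\<Prod>b\<in>Basis. inverse (1 + ((w \<bullet> b) / h)\<^sup>2)) \<le> (\<Prod>b\<in>(Basis :: 'a set). max 1 (h0\<^sup>2) * inverse (1 + (w \<bullet> b)\<^sup>2))"
    using one_plus_sq_pos by (intro prod_mono) (auto intro: less_imp_le)
  then show ?thesis by (simp add: decay_def prod.distrib divide_inverse mult.commute)
qed

lemma schwartz_continuous: "schwartz f \<Longrightarrow> continuous_on S f"
proof -
  assume "schwartz f"
  then have "\<forall>x. iter_deriv [] f differentiable (at x)" unfolding schwartz_def smooth_def by (metis empty_subsetI list.set(1))
  then show ?thesis by (intro continuous_at_imp_continuous_on ballI differentiable_imp_continuous_within) simp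
qed

text \<open>\<open>1 / decay x\<close> is at most \<open>(1 + (norm x)\<^sup>2) ^ n\<close> with
  \<open>n\<close> the dimension, so the Schwartz bounds with the powers 0 and \<open>2 * n\<close>
  of the norm give domination by \<open>decay\<close>.\<close>

lemma schwartz_integrable:
  fixes f :: "'a::euclidean_space \<Rightarrow> complex"
  assumes "schwartz f"
  shows "integrable lborel f"
proof -
  let ?n = "DIM('a)"
  have "\<exists>C. \<forall>x. norm x ^ k * cmod (f x) \<le> C" for k
    using assms unfolding schwartz_def by (metis empty_subsetI iter_deriv.simps(1) list.set(1))
  then obtain C where C: "\<And>k x. norm x ^ k * cmod (f x) \<le> C k" by metis
  have "cmod (f x) \<le> 2 ^ ?n * (C 0 + C (2 * ?n)) * decay x" for x
  proof -
    have "1 + (norm x)\<^sup>2 \<le> 2 * max 1 ((norm x)\<^sup>2)" by simp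
    then have "(1 + (norm x)\<^sup>2) ^ ?n \<le> (2 * max 1 ((norm x)\<^sup>2)) ^ ?n" by (intro power_mono) auto
    also have "\<dots> = 2 ^ ?n * max 1 ((norm x)\<^sup>2) ^ ?n" by (rule power_mult_distrib)
    also have "max 1 ((norm x)\<^sup>2) ^ ?n \<le> 1 + norm x ^ (2 * ?n)"
      by (cases "1 \<le> (norm x)\<^sup>2") (simp_all add: max_def power_mult)
    finally have "(1 + (norm x)\<^sup>2) ^ ?n * cmod (f x) \<le> 2 ^ ?n * (1 + norm x ^ (2 * ?n)) * cmod (f x)"
      by (intro mult_right_mono) auto
    also have "\<dots> = 2 ^ ?n * (norm x ^ 0 * cmod (f x) + norm x ^ (2 * ?n) * cmod (f x))" by (simp add: algebra_simps)
    also have "\<dots> \<le> 2 ^ ?n * (C 0 + C (2 * ?n))" by (intro mult_left_mono add_mono C) auto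
    finally have 1: "(1 + (norm x)\<^sup>2) ^ ?n * cmod (f x) \<le> 2 ^ ?n * (C 0 + C (2 * ?n))" .
    have "(\<Prod>b\<in>Basis. 1 + (x \<bullet> b)\<^sup>2) \<le> (\<Prod>b\<in>(Basis :: 'a set). 1 + (norm x)\<^sup>2)"
    proof (intro prod_mono conjI add_left_mono)
      show "(x \<bullet> b)\<^sup>2 \<le> (norm x)\<^sup>2" if "b \<in> Basis" for b
        using Basis_le_norm[OF that, of x] by (metis abs_ge_zero power2_abs power_mono)
    qed simp
    then have "inverse (decay x) \<le> (1 + (norm x)\<^sup>2) ^ ?n" by (simp add: decay_eq)
    then have "inverse (decay x) * cmod (f x) \<le> (1 + (norm x)\<^sup>2) ^ ?n * cmod (f x)" by (intro mult_right_mono) auto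
    with 1 have "inverse (decay x) * cmod (f x) \<le> 2 ^ ?n * (C 0 + C (2 * ?n))" by linarith
    then show ?thesis using decay_pos[of x] by (simp add: field_simps)
  qed
  then show ?thesis
    by (rule integrable_bound_cont[OF integrable_mult_right[OF decay_integrable] schwartz_continuous[OF assms]])
qed

lemma boxcut_integrable: "d > 0 \<Longrightarrow> integrable lborel (boxcut d (a :: 'a::euclidean_space))"
proof -
  assume d: "d > 0"
  show ?thesis
  proof (rule integrable_compact_support[OF boxcut_continuous])
    fix y :: 'a assume y: "norm y > norm a + real DIM('a) * (2 * d)"
    show "boxcut d a y = 0"
    proof (rule ccontr)
      assume "boxcut d a y \<noteq> 0"
      from boxcut_support[OF d this] show False using y norm_triangle_sub[of y a] by linarith
    qed
  qed
qed

text \<open>The square is there because \<open>T_decay\<close> spends one factor on Peetre's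
  inequality and integrates the other. The quotient is bounded by compactness of the
  support.\<close>

lemma (in wkb) b_decay: "\<exists>B\<ge>0. \<forall>y. cmod (b y) \<le> B * (decay y * decay y)"
proof -
  let ?f = "\<lambda>y. b y / complex_of_real (decay y * decay y)"
  have nz: "complex_of_real (decay y * decay y) \<noteq> 0" for y using decay_pos[of y] by simp
  have "continuous_on (supp b) ?f"
    by (intro continuous_intros decay_continuous symb_continuous_on[OF bsymb[of _ "{()}"]] ballI nz) simp
  then have "bounded (?f ` supp b)" using compact_continuous_image compact_supp_b compact_imp_bounded by blast
  then obtain B where B: "\<And>y. y \<in> supp b \<Longrightarrow> cmod (?f y) \<le> B" unfolding bounded_iff by blast
  have "cmod (b y) \<le> max B 0 * (decay y * decay y)" for y
  proof (cases "y \<in> supp b")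
    case True
    have "cmod (b y) = cmod (?f y) * (decay y * decay y)"
      using decay_pos[of y] by (simp add: norm_divide norm_mult)
    also have "\<dots> \<le> max B 0 * (decay y * decay y)"
      using B[OF True] by (intro mult_right_mono) (auto simp: decay_nonneg)
    finally show ?thesis .
  next
    case False
    then have "b y = 0" using supp_b by blast
    then show ?thesis by (simp add: decay_nonneg)
  qed
  then show ?thesis by (intro exI[of _ "max B 0"]) simp
qed

subsection \<open>The microlocal cutoff\<close>

locale wkb_cutoff = wkb_regular b \<phi> h0 t x0 \<xi>0 for b \<phi> :: "real ^ 'n \<Rightarrow> complex" and h0 t x0 \<xi>0 +
  fixes d :: real
  assumes d: "d > 0" and near: "near_negligible d"
begin

definition \<beta> :: "real ^ 'n \<Rightarrow> complex" where "\<beta> = boxcut (d / 2) \<xi>0"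

definition c :: "real \<Rightarrow> (real ^ 'n) \<times> (real ^ 'n) \<Rightarrow> complex" where
  "c h z = boxcut (d / 8) x0 (fst z) * \<beta> (snd z)"

definition profile :: "real ^ 'n \<Rightarrow> complex" where
  "profile w = (LINT \<xi>|lborel. osc w \<xi> * \<beta> \<xi>)"

definition kernel :: "real \<Rightarrow> real ^ 'n \<Rightarrow> real ^ 'n \<Rightarrow> complex" where
  "kernel h x y = boxcut (d / 8) x0 (t *\<^sub>R x + (1 - t) *\<^sub>R y) * (complex_of_real (1 / (2 * pi * h) ^ CARD('n)) * profile ((x - y) /\<^sub>R h))"

definition T :: "real \<Rightarrow> (real ^ 'n \<Rightarrow> complex) \<Rightarrow> real ^ 'n \<Rightarrow> complex" where
  "T h w x = (LINT y|lborel. kernel h x y * w y)"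

lemma c_symbol_class: "c \<in> symbol_class h0"
  unfolding symbol_class_iff_symb
proof
  fix k
  have f: "symb1 k {0<..<h0} (\<lambda>_ z. boxcut (d / 8) x0 (fst (z :: (real ^ 'n) \<times> (real ^ 'n))))"
  proof (rule symb_affine[OF boxcut_symb, where l = "\<lambda>_. fst" and L = "\<lambda>_. fst" and D = 1])
    show "\<bar>fst v \<bullet> e\<bar> * 1 \<le> 1 * 1" if "v \<in> Basis" "e \<in> Basis" for v :: "(real ^ 'n) \<times> (real ^ 'n)" and e
      using that by (auto simp: Basis_prod_def inner_Basis)
  qed (auto intro!: derivative_eq_intros)
  have g: "symb1 k {0<..<h0} (\<lambda>_ z. \<beta> (snd (z :: (real ^ 'n) \<times> (real ^ 'n))))"
    unfolding \<beta>_def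
  proof (rule symb_affine[OF boxcut_symb, where l = "\<lambda>_. snd" and L = "\<lambda>_. snd" and D = 1])
    show "\<bar>snd v \<bullet> e\<bar> * 1 \<le> 1 * 1" if "v \<in> Basis" "e \<in> Basis" for v :: "(real ^ 'n) \<times> (real ^ 'n)" and e
      using that by (auto simp: Basis_prod_def inner_Basis)
  qed (auto intro!: derivative_eq_intros)
  show "symb1 k {0<..<h0} c"
    using symb_mult[OF f g] unfolding c_def[abs_def] by simp
qed

lemma c_point: "c h (x0, \<xi>0) = 1"
  unfolding c_def \<beta>_def using d by (simp add: boxcut_1)

lemma beta_continuous: "continuous_on S \<beta>" and beta_integrable: "integrable lborel \<beta>"
  unfolding \<beta>_def using d by (auto intro: boxcut_continuous boxcut_integrable)

lemma beta_support: "\<beta> \<xi> \<noteq> 0 \<Longrightarrow> e \<in> Basis \<Longrightarrow> \<bar>(\<xi> - \<xi>0) \<bullet> e\<bar> \<le> d"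
  using boxcut_0[of "d / 2" e \<xi> \<xi>0] d unfolding \<beta>_def by force

lemma profile_bound: "\<exists>C\<ge>0. \<forall>w. cmod (profile w) \<le> C * decay w ^ L"
proof -
  define R where "R = real CARD('n) * d"
  have "symb k {()} (\<lambda>_ _ _. 1) (\<lambda>_ y. 1 * indicator (cball \<xi>0 R) y) (\<lambda>_. \<beta>)" for k
  proof (rule symb_indicator)
    show "symb1 k {()} (\<lambda>_. \<beta>)" unfolding \<beta>_def by (rule boxcut_symb)
    show "\<beta> z = 0" if "z \<notin> cball \<xi>0 R" for z
    proof (rule ccontr)
      assume "\<beta> z \<noteq> 0"
      then have "norm (z - \<xi>0) \<le> R" using boxcut_support[of "d / 2" \<xi>0 z] d by (simp add: \<beta>_def R_def)
      with that show False by (simp add: dist_norm norm_minus_commute)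
    qed
  qed simp
  then have s: "symb k {()} (\<lambda>_ _ _. 1) (\<lambda>_. indicator (cball \<xi>0 R)) (\<lambda>_. \<beta>)" for k by (simp only: mult_1_left)
  have "\<exists>C\<ge>0. \<forall>i\<in>{()}. \<forall>w. cmod (LINT y|lborel. osc w y * \<beta> y) \<le> C * (decay w ^ L * (LINT y|lborel. indicator (cball \<xi>0 R) y))"
    by (rule osc_bound[OF s]) (auto intro: integrable_indicator_cball)
  then obtain C where C: "C \<ge> 0" "\<And>w. cmod (profile w) \<le> C * (decay w ^ L * (LINT y|lborel. indicator (cball \<xi>0 R) y))"
    by (auto simp: profile_def)
  show ?thesis
    by (intro exI[of _ "C * (LINT y|lborel. indicator (cball \<xi>0 R) y)"] conjI allI mult_nonneg_nonneg C(1))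
      (use C(2) in \<open>auto simp: mult_ac\<close>)
qed

lemma profile_measurable [measurable]: "profile \<in> borel_measurable borel"
proof -
  have [measurable]: "(\<lambda>(w, \<xi>). osc w \<xi> * \<beta> \<xi>) \<in> borel_measurable (borel \<Otimes>\<^sub>M borel)"
    unfolding borel_prod split_beta'
    by (intro borel_measurable_continuous_onI continuous_intros continuous_on_compose2[OF beta_continuous]) auto
  show ?thesis unfolding profile_def by measurable
qed

lemma kernel_measurable [measurable]: "(\<lambda>(x, y). kernel h x y) \<in> borel_measurable (borel \<Otimes>\<^sub>M borel)"
proof -
  have [measurable]: "boxcut (d / 8) x0 \<in> borel_measurable borel"
    by (rule borel_measurable_continuous_onI[OF boxcut_continuous])
  show ?thesis unfolding kernel_def by measurable
qed

lemma pi_power: "0 < h \<Longrightarrow> 1 / (2 * pi * h) ^ n \<le> 1 / h ^ n"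
proof -
  assume h: "0 < h"
  have "1 * h \<le> 2 * pi * h" using pi_ge_two h by (intro mult_right_mono) auto
  then show ?thesis using h by (intro divide_left_mono power_mono mult_pos_pos zero_less_power) auto
qed

lemma kernel_cmod: "0 < h \<Longrightarrow> cmod (kernel h x y) \<le> 1 / h ^ CARD('n) * cmod (profile ((x - y) /\<^sub>R h))"
proof -
  assume h: "0 < h"
  have "cmod (kernel h x y) = cmod (boxcut (d / 8) x0 (t *\<^sub>R x + (1 - t) *\<^sub>R y)) * (1 / (2 * pi * h) ^ CARD('n) * cmod (profile ((x - y) /\<^sub>R h)))"
    unfolding kernel_def norm_mult norm_of_real using h by simp
  also have "\<dots> \<le> 1 * (1 / h ^ CARD('n) * cmod (profile ((x - y) /\<^sub>R h)))"
    by (intro mult_mono boxcut_cmod_le_1 pi_power[OF h]) (use h in auto)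
  finally show ?thesis by simp
qed

text \<open>The loss of \<open>h ^ CARD('n)\<close> is acceptable for boundedness on
  \<open>L2\<close>, which \<open>is_Op\<close> asks for at each \<open>h\<close>
  separately.\<close>

lemma kernel_bound: "\<exists>C\<ge>0. \<forall>h x y. 0 < h \<longrightarrow> h < h0 \<longrightarrow> cmod (kernel h x y) \<le> C / h ^ CARD('n) * decay (x - y)"
proof -
  obtain C where C: "C \<ge> 0" "\<And>w. cmod (profile w) \<le> C * decay w ^ 1" using profile_bound by blast
  define M where "M = (max 1 (h0\<^sup>2)) ^ CARD('n)"
  have M: "M \<ge> 0" by (simp add: M_def)
  have "cmod (kernel h x y) \<le> (C * M) / h ^ CARD('n) * decay (x - y)" if h: "0 < h" "h < h0" for h x y
  proof -
    have "cmod (profile ((x - y) /\<^sub>R h)) \<le> C * (M * decay (x - y))"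
      using C(2)[of "(x - y) /\<^sub>R h"] mult_left_mono[OF decay_scale[OF h, of "x - y"] C(1)] by (simp add: M_def)
    then have "1 / h ^ CARD('n) * cmod (profile ((x - y) /\<^sub>R h)) \<le> 1 / h ^ CARD('n) * (C * (M * decay (x - y)))"
      using h by (intro mult_left_mono) auto
    then show ?thesis using kernel_cmod[OF h(1), of x y] by simp
  qed
  then show ?thesis using C(1) M by (intro exI[of _ "C * M"]) auto
qed

text \<open>In contrast to general symbols, the double integral converges absolutely because \<beta>
  is integrable, so Fubini applies directly. It is used for Schwartz functions and for the part of
  \<open>u h\<close> near \<open>x0\<close>.\<close>

lemma Op_eq:
  assumes h: "0 < h" and w: "continuous_on UNIV w" "integrable lborel w"
  shows "(LINT y|lborel. kernel h x y * w y) = complex_of_real (1 / (2 * pi * h) ^ CARD('n)) *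
    (LINT \<xi>|lborel. \<beta> \<xi> * (LINT y|lborel. osc ((x - y) /\<^sub>R h) \<xi> * (boxcut (d / 8) x0 (t *\<^sub>R x + (1 - t) *\<^sub>R y) * w y)))"
proof -
  let ?a = "\<lambda>y. boxcut (d / 8) x0 (t *\<^sub>R x + (1 - t) *\<^sub>R y)"
  have "(LINT \<xi>|lborel. LINT y|lborel. \<beta> \<xi> * (osc ((x - y) /\<^sub>R h) \<xi> * (?a y * w y))) =
      (LINT y|lborel. LINT \<xi>|lborel. \<beta> \<xi> * (osc ((x - y) /\<^sub>R h) \<xi> * (?a y * w y)))"
  proof (rule swap_integrals_majorant[OF integrable_norm[OF beta_integrable] integrable_norm[OF w(2)]])
    show "continuous_on UNIV (\<lambda>(\<xi>, y). \<beta> \<xi> * (osc ((x - y) /\<^sub>R h) \<xi> * (?a y * w y)))"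
      unfolding split_beta'
      by (intro continuous_intros continuous_on_compose2[OF beta_continuous[of UNIV]]
          continuous_on_compose2[OF boxcut_continuous[of UNIV]] continuous_on_compose2[OF w(1)]) auto
    fix \<xi> y
    have "cmod (?a y) * cmod (w y) \<le> 1 * cmod (w y)" by (intro mult_right_mono boxcut_cmod_le_1) auto
    then have "cmod (\<beta> \<xi>) * (cmod (?a y) * cmod (w y)) \<le> cmod (\<beta> \<xi>) * (1 * cmod (w y))" by (intro mult_left_mono) auto
    then show "cmod (\<beta> \<xi> * (osc ((x - y) /\<^sub>R h) \<xi> * (?a y * w y))) \<le> cmod (\<beta> \<xi>) * cmod (w y)"
      by (simp add: norm_mult)
  qed
  also have "(\<lambda>y. LINT \<xi>|lborel. \<beta> \<xi> * (osc ((x - y) /\<^sub>R h) \<xi> * (?a y * w y))) = (\<lambda>y. profile ((x - y) /\<^sub>R h) * (?a y * w y))"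
  proof
    fix y
    have e: "\<beta> \<xi> * (osc ((x - y) /\<^sub>R h) \<xi> * (?a y * w y)) = osc ((x - y) /\<^sub>R h) \<xi> * \<beta> \<xi> * (?a y * w y)" for \<xi>
      by (simp only: mult_ac)
    show "(LINT \<xi>|lborel. \<beta> \<xi> * (osc ((x - y) /\<^sub>R h) \<xi> * (?a y * w y))) = profile ((x - y) /\<^sub>R h) * (?a y * w y)"
      unfolding profile_def e by simp
  qed
  finally have eq: "(LINT \<xi>|lborel. \<beta> \<xi> * (LINT y|lborel. osc ((x - y) /\<^sub>R h) \<xi> * (?a y * w y))) =
      (LINT y|lborel. profile ((x - y) /\<^sub>R h) * (?a y * w y))" by simp
  have "kernel h x y * w y = complex_of_real (1 / (2 * pi * h) ^ CARD('n)) * (profile ((x - y) /\<^sub>R h) * (?a y * w y))" for y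
    unfolding kernel_def by (simp only: mult_ac)
  then show ?thesis unfolding eq by simp
qed

lemma is_Op_T:
  assumes h: "0 < h" "h < h0"
  shows "is_Op t h (c h) (T h)"
  unfolding is_Op_def
proof (intro conjI allI impI)
  obtain C where C: "\<And>x y. cmod (kernel h x y) \<le> C / h ^ CARD('n) * decay (x - y)" using kernel_bound h by blast
  show "L2_bounded_operator (T h)"
    using kernel_operator_L2[OF kernel_measurable C] unfolding T_def[abs_def] .
  fix w :: "real ^ 'n \<Rightarrow> complex" assume w: "schwartz w"
  have "T h w x = Op_schwartz t h (c h) w x" for x
  proof -
    have e: "c h (t *\<^sub>R x + (1 - t) *\<^sub>R y, \<xi>) * exp (\<i> * complex_of_real (inner (x - y) \<xi> / h)) * w y =
        \<beta> \<xi> * (osc ((x - y) /\<^sub>R h) \<xi> * (boxcut (d / 8) x0 (t *\<^sub>R x + (1 - t) *\<^sub>R y) * w y))" for \<xi> y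
    proof -
      have o: "osc ((x - y) /\<^sub>R h) \<xi> = exp (\<i> * complex_of_real (inner (x - y) \<xi> / h))"
        by (simp add: osc_def divide_inverse mult.commute)
      show ?thesis unfolding c_def o fst_conv snd_conv by (simp only: mult_ac)
    qed
    show ?thesis
      unfolding T_def Op_schwartz_def Op_eq[OF h(1) schwartz_continuous[OF w] schwartz_integrable[OF w]] e by simp
  qed
  then show "AE x in lborel. T h w x = Op_schwartz t h (c h) w x" by simp
qed

lemma u_cmod: "0 < h \<Longrightarrow> cmod (u h y) \<le> cmod (b y)"
  unfolding u_def norm_mult using exp_phase_le_1[of h y] by (simp add: mult_left_le)

lemma u_integrable: "0 < h \<Longrightarrow> integrable lborel (u h)"
  by (rule schwartz_integrable[OF u_schwartz])

text \<open>Gives integrability in \<open>x\<close>, at the price of a negative power of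
  \<open>h\<close>: Peetre's inequality converts the decay in \<open>x - y\<close> and the decay of
  \<open>b\<close> into decay in \<open>x\<close>.\<close>

lemma T_decay: "\<exists>C\<ge>0. \<forall>h x. 0 < h \<longrightarrow> h < h0 \<longrightarrow> cmod (T h (u h) x) \<le> C / h ^ CARD('n) * decay x"
proof -
  obtain C where C: "C \<ge> 0" "\<And>h x y. 0 < h \<Longrightarrow> h < h0 \<Longrightarrow> cmod (kernel h x y) \<le> C / h ^ CARD('n) * decay (x - y)"
    using kernel_bound by blast
  obtain B where B: "B \<ge> 0" "\<And>y. cmod (b y) \<le> B * (decay y * decay y)" using b_decay by blast
  define I where "I = (LINT y|lborel. decay (y :: real ^ 'n))"
  have I: "I \<ge> 0" by (simp add: I_def decay_nonneg)
  have "cmod (T h (u h) x) \<le> (C * B * 2 ^ CARD('n) * I) / h ^ CARD('n) * decay x" if h: "0 < h" "h < h0" for h x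
  proof -
    have "cmod (T h (u h) x) \<le> (LINT y|lborel. (C / h ^ CARD('n) * B * 2 ^ CARD('n) * decay x) * decay (y :: real ^ 'n))"
      unfolding T_def
    proof (rule integral_cmod_bound)
      show "integrable lborel (\<lambda>y. (C / h ^ CARD('n) * B * 2 ^ CARD('n) * decay x) * decay (y :: real ^ 'n))"
        by (intro integrable_mult_right decay_integrable)
      fix y
      have "cmod (kernel h x y) * cmod (u h y) \<le> (C / h ^ CARD('n) * decay (x - y)) * (B * (decay y * decay y))"
        using C(2)[OF h] order_trans[OF u_cmod[OF h(1)] B(2)] C(1) h
        by (intro mult_mono) (auto simp: decay_nonneg)
      also have "\<dots> = (C / h ^ CARD('n) * B) * ((decay (x - y) * decay y) * decay y)" by (simp add: mult_ac)
      also have "\<dots> \<le> (C / h ^ CARD('n) * B) * ((2 ^ CARD('n) * decay x) * decay y)"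
        using decay_peetre[of x y] C(1) B(1) h by (intro mult_left_mono mult_right_mono) (auto simp: decay_nonneg)
      finally show "cmod (kernel h x y * u h y) \<le> (C / h ^ CARD('n) * B * 2 ^ CARD('n) * decay x) * decay y"
        by (simp add: norm_mult mult_ac)
    qed
    then show ?thesis by (simp add: I_def mult_ac)
  qed
  then show ?thesis using C(1) B(1) I by (intro exI[of _ "C * B * 2 ^ CARD('n) * I"]) auto
qed

text \<open>Where the product is nonzero, \<open>x\<close> and \<open>y\<close> are at least
  \<open>d / 4\<close> apart, so \<open>decay ((x - y) /\<^sub>R h)\<close> is of order
  \<open>h\<^sup>2\<close> and its power \<open>L\<close> of order
  \<open>h ^ (2 * L)\<close>.\<close>

lemma far_kernel:
  assumes h: "0 < h" and C: "\<And>w. cmod (profile w) \<le> C * decay w ^ L"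
  shows "cmod (kernel h x y * (1 - boxcut (d / 2) x0 y)) \<le> C * ((4 / d) ^ (2 * L) * h ^ (2 * L)) / h ^ CARD('n)"
proof (cases "kernel h x y * (1 - boxcut (d / 2) x0 y) = 0")
  case True
  have "C \<ge> 0" using C[of 0] decay_pos[of 0] by (metis norm_ge_zero order_trans zero_le_mult_iff zero_less_power not_less)
  then show ?thesis unfolding True using h d by simp
next
  case False
  then have 1: "boxcut (d / 8) x0 (t *\<^sub>R x + (1 - t) *\<^sub>R y) \<noteq> 0" and 2: "boxcut (d / 2) x0 y \<noteq> 1"
    by (auto simp: kernel_def)
  obtain f where f: "f \<in> Basis" "\<bar>(y - x0) \<bullet> f\<bar> > d / 2"
    using boxcut_1[of "d / 2" y x0] 2 d by (metis half_gt_zero not_le)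
  have "\<bar>(t *\<^sub>R x + (1 - t) *\<^sub>R y - x0) \<bullet> f\<bar> < d / 4"
    using boxcut_0[of "d / 8" f "t *\<^sub>R x + (1 - t) *\<^sub>R y" x0] 1 d f(1) by fastforce
  \<comment> \<open>Relative to \<open>x0\<close>, the intermediate point is \<open>y\<close>
    displaced by \<open>t\<close> times \<open>x - y\<close>. In the coordinate \<open>f\<close>
    this displacement has to bridge the gap between \<open>d / 2\<close> and \<open>d / 4\<close>,
    and \<open>t \<le> 1\<close>.\<close>
  moreover have "(t *\<^sub>R x + (1 - t) *\<^sub>R y - x0) \<bullet> f = t * ((x - y) \<bullet> f) + (y - x0) \<bullet> f"
    by (simp add: inner_simps algebra_simps)
  ultimately have "d / 4 \<le> \<bar>t * ((x - y) \<bullet> f)\<bar>" using f(2) by linarith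
  also have "\<dots> \<le> \<bar>(x - y) \<bullet> f\<bar>" using t by (simp add: abs_mult mult_left_le_one_le)
  also have "\<dots> \<le> norm (x - y)" by (rule Basis_le_norm[OF f(1)])
  finally have n: "d / 4 \<le> norm (x - y)" .
  have "decay ((x - y) /\<^sub>R h) \<le> (4 / d)\<^sup>2 * h\<^sup>2"
  proof -
    have "norm ((x - y) /\<^sub>R h) = norm (x - y) / h" using h by (simp add: divide_inverse mult.commute)
    moreover have "d / 4 / h \<le> norm (x - y) / h" using n h by (intro divide_right_mono) auto
    ultimately have "(d / 4 / h)\<^sup>2 \<le> (norm ((x - y) /\<^sub>R h))\<^sup>2"
      using h d by (intro power_mono) simp_all
    then have "decay ((x - y) /\<^sub>R h) * (d / 4 / h)\<^sup>2 \<le> decay ((x - y) /\<^sub>R h) * (1 + (norm ((x - y) /\<^sub>R h))\<^sup>2)"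
      by (intro mult_left_mono) (auto simp: decay_nonneg)
    also have "\<dots> \<le> 1" by (rule decay_norm_sq)
    finally show ?thesis using d h by (simp add: power_divide field_simps)
  qed
  then have "decay ((x - y) /\<^sub>R h) ^ L \<le> ((4 / d)\<^sup>2 * h\<^sup>2) ^ L" by (intro power_mono) (auto simp: decay_nonneg)
  then have dl: "decay ((x - y) /\<^sub>R h) ^ L \<le> (4 / d) ^ (2 * L) * h ^ (2 * L)" by (simp add: power_mult power_mult_distrib)
  have C0: "C \<ge> 0" using C[of 0] decay_pos[of 0] by (metis norm_ge_zero order_trans zero_le_mult_iff zero_less_power not_less)
  have "cmod (kernel h x y * (1 - boxcut (d / 2) x0 y)) \<le> (1 / h ^ CARD('n) * cmod (profile ((x - y) /\<^sub>R h))) * 1"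
    unfolding norm_mult using h by (intro mult_mono kernel_cmod one_minus_boxcut_cmod_le_1) auto
  also have "\<dots> \<le> 1 / h ^ CARD('n) * (C * ((4 / d) ^ (2 * L) * h ^ (2 * L)))"
    unfolding mult_1_right using h order_trans[OF C mult_left_mono[OF dl C0]] by (intro mult_left_mono) auto
  finally show ?thesis by simp
qed

lemma T_sup: "\<exists>C\<ge>0. \<forall>h x. 0 < h \<longrightarrow> h < h0 \<longrightarrow> cmod (T h (u h) x) \<le> C * h ^ N"
proof -
  define n where "n = CARD('n)"
  \<comment> \<open>The exponent \<open>N + n\<close> makes up for the factor
    \<open>1 / h ^ n\<close> in the kernel, here and in the choice of \<open>C2\<close>; in the far
    part the surplus power of \<open>h\<close> is bounded by the same power of
    \<open>h0\<close>.\<close>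
  obtain C1 where C1: "C1 \<ge> 0" "\<And>w. cmod (profile w) \<le> C1 * decay w ^ (N + n)" using profile_bound by blast
  obtain C2 where C2: "C2 \<ge> 0" "\<And>h x \<xi>. 0 < h \<Longrightarrow> h < h0 \<Longrightarrow> (\<forall>e\<in>Basis. \<bar>(\<xi> - \<xi>0) \<bullet> e\<bar> \<le> d) \<Longrightarrow>
    cmod (near_part d h x \<xi>) \<le> C2 * h ^ (N + n)"
    using near[unfolded near_negligible_def, rule_format, of "N + n"] by blast
  have bi: "integrable lborel b"
    using b_vanishes symb_continuous_on[OF bsymb[of _ "{()}"]] by (metis insertI1 integrable_compact_support)
  define Ib where "Ib = (LINT y|lborel. cmod (b y))"
  define I\<beta> where "I\<beta> = (LINT \<xi>|lborel. cmod (\<beta> \<xi>))"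
  have I0: "Ib \<ge> 0" "I\<beta> \<ge> 0" by (simp_all add: Ib_def I\<beta>_def)
  define D1 where "D1 = C1 * (4 / d) ^ (2 * (N + n)) * h0 ^ (N + n) * Ib"
  define D2 where "D2 = I\<beta> * C2"
  have D0: "D1 \<ge> 0" "D2 \<ge> 0" using C1(1) C2(1) I0 d h0 by (simp_all add: D1_def D2_def)
  have "cmod (T h (u h) x) \<le> (D1 + D2) * h ^ N" if h: "0 < h" "h < h0" for h x
  proof -
    let ?\<theta> = "boxcut (d / 2) x0"
    obtain C where C: "\<And>x y. cmod (kernel h x y) \<le> C / h ^ CARD('n) * decay (x - y)" using kernel_bound h by blast
    have cu: "continuous_on UNIV (u h)" by (rule u_continuous[OF h(1)])
    have c\<theta>: "continuous_on UNIV (\<lambda>y. ?\<theta> y * u h y)" by (intro continuous_intros boxcut_continuous cu)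
    have i\<theta>: "integrable lborel (\<lambda>y. ?\<theta> y * u h y)"
      by (rule integrable_bound_cont[OF integrable_norm[OF u_integrable[OF h(1)]] c\<theta>])
        (simp add: norm_mult boxcut_cmod_le_1 mult_left_le_one_le)
    have kc: "kernel h x \<in> borel_measurable borel" using measurable_Pair2[OF kernel_measurable, of x] by simp
    have i1: "integrable lborel (\<lambda>y. kernel h x y * u h y)"
      by (rule kernel_integrable(1)[OF kc C u_L2[OF h(1)]])
    have i2: "integrable lborel (\<lambda>y. kernel h x y * (?\<theta> y * u h y))"
    proof (rule Bochner_Integration.integrable_bound[OF i1])
      have [measurable]: "?\<theta> \<in> borel_measurable borel" by (rule borel_measurable_continuous_onI[OF boxcut_continuous])
      have [measurable]: "u h \<in> borel_measurable borel" by (rule borel_measurable_continuous_onI[OF cu])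
      note [measurable] = kc
      show "(\<lambda>y. kernel h x y * (?\<theta> y * u h y)) \<in> borel_measurable lborel" by measurable
      show "AE y in lborel. norm (kernel h x y * (?\<theta> y * u h y)) \<le> norm (kernel h x y * u h y)"
        by (intro AE_I2) (simp add: norm_mult boxcut_cmod_le_1 mult_left_le_one_le mult_left_mono)
    qed
    have "T h (u h) x = (LINT y|lborel. kernel h x y * u h y - kernel h x y * (?\<theta> y * u h y)) + (LINT y|lborel. kernel h x y * (?\<theta> y * u h y))"
      unfolding T_def using i1 i2 by simp
    moreover have "cmod (LINT y|lborel. kernel h x y * u h y - kernel h x y * (?\<theta> y * u h y)) \<le> D1 * h ^ N"
    proof -
      let ?M = "C1 * ((4 / d) ^ (2 * (N + n)) * h ^ (2 * (N + n))) / h ^ n"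
      have "cmod (LINT y|lborel. kernel h x y * u h y - kernel h x y * (?\<theta> y * u h y)) \<le> (LINT y|lborel. ?M * cmod (b y))"
      proof (rule integral_cmod_bound)
        show "integrable lborel (\<lambda>y. ?M * cmod (b y))" using bi by simp
        fix y
        have "kernel h x y * u h y - kernel h x y * (?\<theta> y * u h y) = (kernel h x y * (1 - ?\<theta> y)) * u h y" by (simp add: algebra_simps)
        then have "cmod (kernel h x y * u h y - kernel h x y * (?\<theta> y * u h y)) = cmod (kernel h x y * (1 - ?\<theta> y)) * cmod (u h y)" by (simp only: norm_mult)
        also have "\<dots> \<le> ?M * cmod (b y)"
          using far_kernel[OF h(1) C1(2), of x y] u_cmod[OF h(1)] C1(1) h d unfolding n_def by (intro mult_mono) auto
        finally show "cmod (kernel h x y * u h y - kernel h x y * (?\<theta> y * u h y)) \<le> ?M * cmod (b y)" .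
      qed
      also have "\<dots> = ?M * Ib" by (simp add: Ib_def)
      also have "?M = C1 * (4 / d) ^ (2 * (N + n)) * (h ^ (N + n) * h ^ N)"
      proof -
        have "h ^ (2 * (N + n)) = h ^ (N + n) * h ^ N * h ^ n" by (simp add: power_add[symmetric] mult_2 add_ac)
        then show ?thesis using h by simp
      qed
      also have "\<dots> * Ib \<le> C1 * (4 / d) ^ (2 * (N + n)) * (h0 ^ (N + n) * h ^ N) * Ib"
        using h C1(1) d I0 by (intro mult_right_mono mult_left_mono power_mono) auto
      finally show ?thesis by (simp add: D1_def mult_ac)
    qed
    moreover have "cmod (LINT y|lborel. kernel h x y * (?\<theta> y * u h y)) \<le> D2 * h ^ N"
    proof -
      let ?J = "\<lambda>\<xi>. LINT y|lborel. osc ((x - y) /\<^sub>R h) \<xi> * (boxcut (d / 8) x0 (t *\<^sub>R x + (1 - t) *\<^sub>R y) * (?\<theta> y * u h y))"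
      have "cmod (LINT \<xi>|lborel. \<beta> \<xi> * ?J \<xi>) \<le> (LINT \<xi>|lborel. cmod (\<beta> \<xi>) * (C2 * h ^ (N + n)))"
      proof (rule integral_cmod_bound)
        show "integrable lborel (\<lambda>\<xi>. cmod (\<beta> \<xi>) * (C2 * h ^ (N + n)))" using beta_integrable by simp
        show "cmod (\<beta> \<xi> * ?J \<xi>) \<le> cmod (\<beta> \<xi>) * (C2 * h ^ (N + n))" for \<xi>
        proof (cases "\<beta> \<xi> = 0")
          case False
          then have "cmod (?J \<xi>) \<le> C2 * h ^ (N + n)"
            using C2(2)[OF h, of \<xi> x] beta_support[of \<xi>] by (simp add: near_part_def mult.assoc)
          then show ?thesis unfolding norm_mult by (intro mult_left_mono) auto
        qed simp
      qed
      also have "\<dots> = I\<beta> * C2 * h ^ (N + n)" by (simp add: I\<beta>_def)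
      finally have J: "cmod (LINT \<xi>|lborel. \<beta> \<xi> * ?J \<xi>) \<le> I\<beta> * C2 * h ^ (N + n)" .
      have "cmod (LINT y|lborel. kernel h x y * (?\<theta> y * u h y)) = 1 / (2 * pi * h) ^ n * cmod (LINT \<xi>|lborel. \<beta> \<xi> * ?J \<xi>)"
        unfolding Op_eq[OF h(1) c\<theta> i\<theta>] norm_mult norm_of_real n_def using h by simp
      also have "\<dots> \<le> 1 / h ^ n * (I\<beta> * C2 * h ^ (N + n))"
        using h by (intro mult_mono pi_power J) auto
      also have "\<dots> = D2 * h ^ N" using h by (simp add: D2_def power_add)
      finally show ?thesis .
    qed
    ultimately show ?thesis
      using norm_triangle_ineq[of "LINT y|lborel. kernel h x y * u h y - kernel h x y * (?\<theta> y * u h y)" "LINT y|lborel. kernel h x y * (?\<theta> y * u h y)"]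
      by (simp add: distrib_right)
  qed
  then show ?thesis using D0 by (intro exI[of _ "D1 + D2"]) auto
qed

text \<open>One factor of \<open>cmod (T h (u h) x)\<close> squared is estimated by the uniform
  bound of order \<open>h ^ (2 * N + n)\<close>, the other by \<open>decay x / h ^ n\<close>. The
  product is integrable and of order \<open>h ^ (2 * N)\<close>, whose square root is the desired
  rate.\<close>

lemma T_negligible: "(\<lambda>h. L2_norm (T h (u h))) \<in> O[at_right 0](\<lambda>h. h ^ N)"
proof -
  define n where "n = CARD('n)"
  obtain C1 where C1: "C1 \<ge> 0" "\<And>h x. 0 < h \<Longrightarrow> h < h0 \<Longrightarrow> cmod (T h (u h) x) \<le> C1 * h ^ (2 * N + n)"
    using T_sup by blast
  obtain C2 where C2: "C2 \<ge> 0" "\<And>h x. 0 < h \<Longrightarrow> h < h0 \<Longrightarrow> cmod (T h (u h) x) \<le> C2 / h ^ n * decay x"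
    using T_decay unfolding n_def by blast
  define I where "I = (LINT y|lborel. decay (y :: real ^ 'n))"
  have I: "I \<ge> 0" by (simp add: I_def decay_nonneg)
  have "norm (L2_norm (T h (u h))) \<le> sqrt (C1 * C2 * I) * norm (h ^ N)" if h: "0 < h" "h < h0" for h
  proof -
    have L2: "L2 (T h (u h))"
      using is_Op_T[OF h] u_L2[OF h(1)] by (auto simp: is_Op_def L2_bounded_operator_def)
    have "(LINT x|lborel. (cmod (T h (u h) x))\<^sup>2) \<le> (LINT x|lborel. (C1 * C2 * h ^ (2 * N)) * decay (x :: real ^ 'n))"
    proof (rule integral_mono)
      show "integrable lborel (\<lambda>x. (cmod (T h (u h) x))\<^sup>2)" using L2 by (simp add: L2_def)
      show "integrable lborel (\<lambda>x. (C1 * C2 * h ^ (2 * N)) * decay (x :: real ^ 'n))"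
        by (intro integrable_mult_right decay_integrable)
      fix x
      have "cmod (T h (u h) x) * cmod (T h (u h) x) \<le> (C1 * h ^ (2 * N + n)) * (C2 / h ^ n * decay x)"
        using C1 C2 h by (intro mult_mono) auto
      also have "\<dots> = (C1 * C2 * h ^ (2 * N)) * decay x" using h by (simp add: power_add)
      finally show "(cmod (T h (u h) x))\<^sup>2 \<le> (C1 * C2 * h ^ (2 * N)) * decay x" by (simp add: power2_eq_square)
    qed
    also have "\<dots> = C1 * C2 * I * (h ^ N)\<^sup>2" by (simp add: I_def power_mult[symmetric] mult_ac)
    finally have "L2_norm (T h (u h)) \<le> sqrt (C1 * C2 * I * (h ^ N)\<^sup>2)"
      unfolding L2_norm_def by (rule real_sqrt_le_mono)
    also have "\<dots> = sqrt (C1 * C2 * I) * h ^ N" using h by (simp add: real_sqrt_mult)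
    finally show ?thesis using h by (simp add: L2_norm_def)
  qed
  then have "eventually (\<lambda>h. norm (L2_norm (T h (u h))) \<le> sqrt (C1 * C2 * I) * norm (h ^ N)) (at_right 0)"
    unfolding eventually_at_right_field using h0 by blast
  then show ?thesis by (rule bigoI)
qed

end

section \<open>The two inclusions\<close>

context wkb
begin

lemma WF_subset:
  assumes t: "0 \<le> t" "t \<le> 1"
  shows "WF h0 t u \<subseteq> {(x, \<xi>). x \<in> supp b \<and> Im (\<phi> x) = 0 \<and> complex_vec \<xi> = grad \<phi> x}"
proof (rule ccontr)
  assume "\<not> ?thesis"
  then obtain x0 \<xi>0 where p: "(x0, \<xi>0) \<in> WF h0 t u"
    and r: "x0 \<notin> supp b \<or> Im (\<phi> x0) \<noteq> 0 \<or> complex_vec \<xi>0 \<noteq> grad \<phi> x0" by auto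
  interpret wkb_regular b \<phi> h0 t x0 \<xi>0 by unfold_locales (use t r in auto)
  obtain d where d: "d > 0" "near_negligible d" using near_negligible_exists by blast
  interpret wkb_cutoff b \<phi> h0 t x0 \<xi>0 d by unfold_locales (use d in auto)
  have "(INF h\<in>{0<..<h0}. cmod (c h (x0, \<xi>0))) = 1" using h0 by (simp add: c_point)
  then have "\<exists>c\<in>symbol_class h0. (INF h\<in>{0<..<h0}. cmod (c h (x0, \<xi>0))) > 0 \<and>
      (\<exists>T. (\<forall>h\<in>{0<..<h0}. is_Op t h (c h) (T h)) \<and>
           (\<forall>N::nat. (\<lambda>h. L2_norm (T h (u h))) \<in> O[at_right 0](\<lambda>h. h ^ N)))"
    using c_symbol_class is_Op_T T_negligible by (intro bexI[of _ c] conjI exI[of _ T]) auto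
  then show False using p unfolding WF_def by blast
qed

lemma subset_WF:
  assumes t: "0 \<le> t" "t \<le> 1"
  shows "closure {(x, \<xi>). b x \<noteq> 0 \<and> Im (\<phi> x) = 0 \<and> complex_vec \<xi> = grad \<phi> x} \<subseteq> WF h0 t u"
proof
  fix p assume p: "p \<in> closure {(x, \<xi>). b x \<noteq> 0 \<and> Im (\<phi> x) = 0 \<and> complex_vec \<xi> = grad \<phi> x}"
  show "p \<in> WF h0 t u"
  proof (rule ccontr)
    assume "p \<notin> WF h0 t u"
    then obtain c T where c: "c \<in> symbol_class h0" and m: "(INF h\<in>{0<..<h0}. cmod (c h p)) > 0"
      and T: "\<And>h. h \<in> {0<..<h0} \<Longrightarrow> is_Op t h (c h) (T h)"
      and O: "\<And>N::nat. (\<lambda>h. L2_norm (T h (u h))) \<in> O[at_right 0](\<lambda>h. h ^ N)"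
      unfolding WF_def by blast
    define m where "m = (INF h\<in>{0<..<h0}. cmod (c h p))"
    have m0: "m > 0" using m by (simp add: m_def)
    have mp: "m \<le> cmod (c h p)" if "h \<in> {0<..<h0}" for h
      unfolding m_def using that by (intro cINF_lower bdd_belowI2[of _ 0]) auto
    have "symb1 (Suc 0) {0<..<h0} c" using c unfolding symbol_class_iff_symb by blast
    from symb_lipschitz[OF this] obtain L where L: "L \<ge> 0"
      "\<And>h p q. h \<in> {0<..<h0} \<Longrightarrow> cmod (c h p - c h q) \<le> L * norm (p - q)" by blast
    \<comment> \<open>Within this distance of \<open>p\<close> the lower bound \<open>m\<close>
      drops by at most \<open>m / 2\<close>, for all \<open>h\<close> at once since \<open>L\<close>
      is uniform in \<open>h\<close>. Adding 1 guards against \<open>L = 0\<close>.\<close>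
    have "m / (2 * (L + 1)) > 0" using m0 L(1) by simp
    with p obtain q where q: "q \<in> {(x, \<xi>). b x \<noteq> 0 \<and> Im (\<phi> x) = 0 \<and> complex_vec \<xi> = grad \<phi> x}"
      "dist q p < m / (2 * (L + 1))" unfolding closure_approachable by blast
    obtain x0 \<xi>0 where q0: "q = (x0, \<xi>0)" by (cases q)
    interpret wkb_point b \<phi> h0 x0 \<xi>0 by unfold_locales (use q(1) q0 in auto)
    interpret wkb_symbol b \<phi> h0 x0 \<xi>0 t c by unfold_locales (use t c in auto)
    show False
    proof (rule not_negligible[of "m / 2" T])
      fix h assume h: "0 < h" "h < h0"
      have "cmod (c h p - c h q) \<le> L * dist q p" using L(2)[of h p q] h by (simp add: dist_norm norm_minus_commute)
      also have "\<dots> \<le> (L + 1) * (m / (2 * (L + 1)))" using q(2) L(1) by (intro mult_mono) auto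
      also have "\<dots> = m / 2" using L(1) by (simp add: field_simps)
      finally show "m / 2 \<le> cmod (c h (x0, \<xi>0))"
        using mp[of h] h norm_triangle_ineq2[of "c h p" "c h q"] unfolding q0 by simp
    qed (use m0 T O in auto)
  qed
qed

end

theorem proposition3:
  fixes b \<phi> :: "real ^ 'n \<Rightarrow> complex" and h0 t :: real
  assumes "h0 > 0" and "0 \<le> t" and "t \<le> 1"
    and "test_function b" and "test_function \<phi>"
    and "\<And>x. Im (\<phi> x) \<ge> 0"
  shows
    "WF h0 t (\<lambda>h x. b x * exp (\<i> / complex_of_real h * \<phi> x))
       \<subseteq> {(x, \<xi>). x \<in> supp b \<and> Im (\<phi> x) = 0 \<and> complex_vec \<xi> = grad \<phi> x}
     \<and> closure {(x, \<xi>). b x \<noteq> 0 \<and> Im (\<phi> x) = 0 \<and> complex_vec \<xi> = grad \<phi> x}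
       \<subseteq> WF h0 t (\<lambda>h x. b x * exp (\<i> / complex_of_real h * \<phi> x))"
proof -
  interpret wkb b \<phi> h0 by unfold_locales (use assms in auto)
  have "(\<lambda>h x. b x * exp (\<i> / complex_of_real h * \<phi> x)) = u" by (simp add: u_def[abs_def])
  then show ?thesis using WF_subset[OF assms(2,3)] subset_WF[OF assms(2,3)] by simp
qed

end
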